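(* Let $H$ be a good homogeneous relation on a finite set $X$, given by its matrix representation. Then a super modular decomposition tree of $H$ can be computed in $O(|X|^2)$ time.
   Context: A diverse triple of $X$ is $(x,y,z)\in X^3$ with $x\neq y$, $x\neq z$, written $(x|yz)$. A homogeneous relation $H$ on $X$ is a relation on diverse triples such that for every $x\in X$ the relation $H_x(y,z)\Leftrightarrow H(x|yz)$ is an equivalence relation on $X\setminus\{x\}$. $M\subseteq X$ is a homogeneous module if $H(x|mm')$ for all $m,m'\in M$, $x\in X\setminus M$. $H$ is good if for every homogeneous module $M$, all $x,y\in M$ and all $s,t\notin M$, $H(x|st)\Leftrightarrow H(y|st)$. Sets overlap if their intersection and both differences are non-empty; a homogeneous module is strong if it overlaps no other homogeneous module. A super modular decomposition tree of $H$ is a rooted tree whose leaf set is $X$ (each node identified with the set of leaves below it), such that every node is a homogeneous module of $H$ and every strong homogeneous module of $H$ is a node. Matrix representation: with $X=\{x_1,\dots,x_n\}$, an $n\times n$ matrix $A$ with entries in $\{1,\dots,n\}$ where the classes of each $H_{x_i}$ get distinct numbers and $A_{i,j}=k$ iff $x_j$ lies in the class of $H_{x_i}$ numbered $k$. *)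

theory Defs
  imports Complex_Main "HOL-Library.Landau_Symbols"
begin

section \<open>Homogeneous relations\<close>

text \<open>A triple \<open>(x, y, z)\<close> stands for \<open>(x|yz)\<close>.\<close>

definition diverse_triples :: "'a set \<Rightarrow> ('a \<times> 'a \<times> 'a) set" where
  "diverse_triples X = {(x, y, z). x \<in> X \<and> y \<in> X \<and> z \<in> X \<and> x \<noteq> y \<and> x \<noteq> z}"

definition rel_at :: "('a \<times> 'a \<times> 'a) set \<Rightarrow> 'a \<Rightarrow> ('a \<times> 'a) set" where
  "rel_at H x = {(y, z). (x, y, z) \<in> H}"

definition homogeneous_relation :: "'a set \<Rightarrow> ('a \<times> 'a \<times> 'a) set \<Rightarrow> bool" where
  "homogeneous_relation X H \<longleftrightarrow>
     H \<subseteq> diverse_triples X \<and> (\<forall>x\<in>X. equiv (X - {x}) (rel_at H x))"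

definition homogeneous_module :: "'a set \<Rightarrow> ('a \<times> 'a \<times> 'a) set \<Rightarrow> 'a set \<Rightarrow> bool" where
  "homogeneous_module X H M \<longleftrightarrow>
     M \<subseteq> X \<and> (\<forall>x\<in>X - M. \<forall>m\<in>M. \<forall>m'\<in>M. (x, m, m') \<in> H)"

definition good :: "'a set \<Rightarrow> ('a \<times> 'a \<times> 'a) set \<Rightarrow> bool" where
  "good X H \<longleftrightarrow>
     (\<forall>M. homogeneous_module X H M \<longrightarrow>
       (\<forall>x\<in>M. \<forall>y\<in>M. \<forall>s\<in>X - M. \<forall>t\<in>X - M. (x, s, t) \<in> H \<longleftrightarrow> (y, s, t) \<in> H))"

definition overlap :: "'a set \<Rightarrow> 'a set \<Rightarrow> bool" where
  "overlap A B \<longleftrightarrow> A \<inter> B \<noteq> {} \<and> A - B \<noteq> {} \<and> B - A \<noteq> {}"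

definition strong_module :: "'a set \<Rightarrow> ('a \<times> 'a \<times> 'a) set \<Rightarrow> 'a set \<Rightarrow> bool" where
  "strong_module X H M \<longleftrightarrow>
     homogeneous_module X H M \<and> (\<forall>N. homogeneous_module X H N \<longrightarrow> \<not> overlap M N)"

text \<open>
  The elements of \<open>X\<close> are enumerated as \<open>x 1, \<dots>, x n\<close>. The number \<open>num C\<close> is the one given to
  the class \<open>C\<close> of \<open>rel_at H (x i)\<close>. As \<open>x i\<close> lies in none of these classes, a diagonal entry
  \<open>A i i\<close> is an arbitrary element of \<open>{1..n}\<close>.
\<close>

definition matrix_representation ::
  "'a set \<Rightarrow> ('a \<times> 'a \<times> 'a) set \<Rightarrow> nat \<Rightarrow> (nat \<Rightarrow> 'a) \<Rightarrow> (nat \<Rightarrow> nat \<Rightarrow> nat) \<Rightarrow> bool" where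
  "matrix_representation X H n x A \<longleftrightarrow>
     bij_betw x {1..n} X \<and>
     (\<forall>i\<in>{1..n}. \<forall>j\<in>{1..n}. A i j \<in> {1..n}) \<and>
     (\<forall>i\<in>{1..n}. \<exists>num. inj_on num ((X - {x i}) // rel_at H (x i)) \<and>
        (\<forall>j\<in>{1..n} - {i}. \<forall>k.
           A i j = k \<longleftrightarrow> (\<exists>C\<in>(X - {x i}) // rel_at H (x i). num C = k \<and> x j \<in> C)))"


section \<open>Rooted trees given by parent pointers\<close>

definition tree_edges :: "'v set \<Rightarrow> 'v \<Rightarrow> ('v \<Rightarrow> 'v) \<Rightarrow> ('v \<times> 'v) set" where
  "tree_edges V r par = {(v, par v) | v. v \<in> V - {r}}"

text \<open>The root has no parent, so reachability of the root from every node excludes cycles.\<close>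

definition rooted_tree :: "'v set \<Rightarrow> 'v \<Rightarrow> ('v \<Rightarrow> 'v) \<Rightarrow> bool" where
  "rooted_tree V r par \<longleftrightarrow>
     finite V \<and> r \<in> V \<and> (\<forall>v\<in>V - {r}. par v \<in> V) \<and>
     (\<forall>v\<in>V. (v, r) \<in> (tree_edges V r par)\<^sup>*)"

definition leaves :: "'v set \<Rightarrow> 'v \<Rightarrow> ('v \<Rightarrow> 'v) \<Rightarrow> 'v set" where
  "leaves V r par = {v \<in> V. \<forall>u. (u, v) \<notin> tree_edges V r par}"

definition leaves_below :: "'v set \<Rightarrow> 'v \<Rightarrow> ('v \<Rightarrow> 'v) \<Rightarrow> 'v \<Rightarrow> 'v set" where
  "leaves_below V r par v = {l \<in> leaves V r par. (l, v) \<in> (tree_edges V r par)\<^sup>*}"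

text \<open>
  The bijection \<open>lab\<close> identifies the leaves with the elements of \<open>X\<close>. Injectivity says that a node
  may be identified with the set of leaves below it (so no node has exactly one child).
  The empty set is vacuously a strong module but never a set of leaves below a node,
  hence the condition \<open>M \<noteq> {}\<close>.
\<close>

definition super_modular_decomposition_tree ::
  "'a set \<Rightarrow> ('a \<times> 'a \<times> 'a) set \<Rightarrow> 'v set \<Rightarrow> 'v \<Rightarrow> ('v \<Rightarrow> 'v) \<Rightarrow> ('v \<Rightarrow> 'a) \<Rightarrow> bool" where
  "super_modular_decomposition_tree X H V r par lab \<longleftrightarrow>
     rooted_tree V r par \<and>
     bij_betw lab (leaves V r par) X \<and>
     inj_on (\<lambda>v. lab ` leaves_below V r par v) V \<and>
     (\<forall>v\<in>V. homogeneous_module X H (lab ` leaves_below V r par v)) \<and>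
     (\<forall>M. strong_module X H M \<and> M \<noteq> {} \<longrightarrow> (\<exists>v\<in>V. M = lab ` leaves_below V r par v))"


section \<open>A random access machine with bounded words\<close>

text \<open>
  A program uses finitely many registers and finitely many arrays, all named by literals and
  all holding natural numbers; array cells are accessed at computed addresses in unit time.
  Every operation, memory access and test costs one unit. Execution is stuck as soon as a
  value larger than the word bound \<open>w\<close> occurs, so for \<open>w\<close> polynomial in the input size the
  machine works on words of logarithmic length.
\<close>

record ram =
  reg :: "nat \<Rightarrow> nat"
  arr :: "nat \<Rightarrow> nat \<Rightarrow> nat"

datatype expr =
    Lit nat
  | Reg nat
  | Cell nat expr
  | Add expr expr
  | Sub expr expr
  | Mul expr expr
  | Eq expr expr
  | Less expr expr

primrec val :: "ram \<Rightarrow> expr \<Rightarrow> nat" where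
  "val s (Lit k) = k"
| "val s (Reg x) = reg s x"
| "val s (Cell a e) = arr s a (val s e)"
| "val s (Add e f) = val s e + val s f"
| "val s (Sub e f) = val s e - val s f"
| "val s (Mul e f) = val s e * val s f"
| "val s (Eq e f) = of_bool (val s e = val s f)"
| "val s (Less e f) = of_bool (val s e < val s f)"

primrec cost :: "expr \<Rightarrow> nat" where
  "cost (Lit k) = 1"
| "cost (Reg x) = 1"
| "cost (Cell a e) = cost e + 1"
| "cost (Add e f) = cost e + cost f + 1"
| "cost (Sub e f) = cost e + cost f + 1"
| "cost (Mul e f) = cost e + cost f + 1"
| "cost (Eq e f) = cost e + cost f + 1"
| "cost (Less e f) = cost e + cost f + 1"

primrec subexprs :: "expr \<Rightarrow> expr set" where
  "subexprs (Lit k) = {Lit k}"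
| "subexprs (Reg x) = {Reg x}"
| "subexprs (Cell a e) = insert (Cell a e) (subexprs e)"
| "subexprs (Add e f) = insert (Add e f) (subexprs e \<union> subexprs f)"
| "subexprs (Sub e f) = insert (Sub e f) (subexprs e \<union> subexprs f)"
| "subexprs (Mul e f) = insert (Mul e f) (subexprs e \<union> subexprs f)"
| "subexprs (Eq e f) = insert (Eq e f) (subexprs e \<union> subexprs f)"
| "subexprs (Less e f) = insert (Less e f) (subexprs e \<union> subexprs f)"

definition fits :: "nat \<Rightarrow> ram \<Rightarrow> expr \<Rightarrow> bool" where
  "fits w s e \<longleftrightarrow> (\<forall>e'\<in>subexprs e. val s e' \<le> w)"

datatype com =
    Skip
  | Set nat expr
  | Store nat expr expr
  | Seq com com
  | Cond expr com com
  | While expr com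

text \<open>\<open>exec w c s t s'\<close>: started in \<open>s\<close>, the program \<open>c\<close> halts in \<open>s'\<close> after \<open>t\<close> time units.\<close>

inductive exec :: "nat \<Rightarrow> com \<Rightarrow> ram \<Rightarrow> nat \<Rightarrow> ram \<Rightarrow> bool" for w where
  Skip: "exec w Skip s 1 s"
| Set: "fits w s e \<Longrightarrow>
    exec w (Set x e) s (cost e + 1) (s\<lparr>reg := (reg s)(x := val s e)\<rparr>)"
| Store: "fits w s e \<Longrightarrow> fits w s f \<Longrightarrow>
    exec w (Store a e f) s (cost e + cost f + 1)
      (s\<lparr>arr := (arr s)(a := (arr s a)(val s e := val s f))\<rparr>)"
| Seq: "exec w c s t s' \<Longrightarrow> exec w d s' t' s'' \<Longrightarrow> exec w (Seq c d) s (t + t') s''"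
| CondTrue: "fits w s b \<Longrightarrow> val s b \<noteq> 0 \<Longrightarrow> exec w c s t s' \<Longrightarrow>
    exec w (Cond b c d) s (cost b + 1 + t) s'"
| CondFalse: "fits w s b \<Longrightarrow> val s b = 0 \<Longrightarrow> exec w d s t s' \<Longrightarrow>
    exec w (Cond b c d) s (cost b + 1 + t) s'"
| WhileFalse: "fits w s b \<Longrightarrow> val s b = 0 \<Longrightarrow>
    exec w (While b c) s (cost b + 1) s"
| WhileTrue: "fits w s b \<Longrightarrow> val s b \<noteq> 0 \<Longrightarrow> exec w c s t s' \<Longrightarrow>
    exec w (While b c) s' t' s'' \<Longrightarrow> exec w (While b c) s (cost b + 1 + t + t') s''"

inductive_cases SkipE: "exec w Skip s t s'"
inductive_cases SetE: "exec w (Set x e) s t s'"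
inductive_cases StoreE: "exec w (Store a e f) s t s'"
inductive_cases SeqE: "exec w (Seq c d) s t s'"
inductive_cases CondE: "exec w (Cond b c d) s t s'"
inductive_cases WhileE: "exec w (While b c) s t s'"

lemma exec_deterministic:
  "exec w c s t s' \<Longrightarrow> exec w c s u s'' \<Longrightarrow> t = u \<and> s' = s''"
proof (induction arbitrary: u s'' rule: exec.induct)
  case Skip
  then show ?case by (elim SkipE) simp
next
  case Set
  from Set.prems show ?case by (elim SetE) simp
next
  case Store
  from Store.prems show ?case by (elim StoreE) simp
next
  case (Seq c s t s' d t' r)
  from Seq.prems obtain t1 s1 t2
    where "u = t1 + t2" and c: "exec w c s t1 s1" and d: "exec w d s1 t2 s''"
    by (rule SeqE)
  moreover have "t = t1" "s' = s1"
    using Seq.IH(1)[OF c] by simp_all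
  ultimately show ?case
    using Seq.IH(2)[of t2 s''] by simp
next
  case (CondTrue s b c t s' d)
  from CondTrue.prems obtain t1 where "u = cost b + 1 + t1" and c: "exec w c s t1 s''"
    by (rule CondE) (use CondTrue.hyps in simp_all)
  then show ?case
    using CondTrue.IH[OF c] by simp
next
  case (CondFalse s b d t s' c)
  from CondFalse.prems obtain t1 where "u = cost b + 1 + t1" and d: "exec w d s t1 s''"
    by (rule CondE) (use CondFalse.hyps in simp_all)
  then show ?case
    using CondFalse.IH[OF d] by simp
next
  case (WhileFalse s b c)
  from WhileFalse.prems show ?case
    by (rule WhileE) (use WhileFalse.hyps in simp_all)
next
  case (WhileTrue s b c t s' t' r)
  from WhileTrue.prems obtain t1 s1 t2
    where "u = cost b + 1 + t1 + t2" and c: "exec w c s t1 s1"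
      and d: "exec w (While b c) s1 t2 s''"
    by (rule WhileE) (use WhileTrue.hyps in simp_all)
  moreover have "t = t1" "s' = s1"
    using WhileTrue.IH(1)[OF c] by simp_all
  ultimately show ?case
    using WhileTrue.IH(2)[of t2 s''] by simp
qed


section \<open>Input and output conventions\<close>

text \<open>
  Register 0 holds the order \<open>n\<close> of the matrix, and array 0 holds the matrix row by row.
  All other registers and cells are 0.
\<close>

definition input_state :: "nat \<Rightarrow> (nat \<Rightarrow> nat \<Rightarrow> nat) \<Rightarrow> ram" where
  "input_state n A =
     \<lparr>reg = (\<lambda>_. 0)(0 := n),
      arr = (\<lambda>_ _. 0)(0 := (\<lambda>a. if a < n * n then A (a div n + 1) (a mod n + 1) else 0))\<rparr>"

text \<open>
  The nodes of the computed tree are \<open>1, \<dots>, N\<close> with \<open>N\<close> in register 1. Register 2 holds the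
  root, and cell \<open>v\<close> of array 1 holds the parent of the node \<open>v\<close>. The leaves are the
  nodes \<open>1, \<dots>, n\<close>, where the leaf \<open>i\<close> stands for \<open>x i\<close>.
\<close>

definition outputs_tree ::
  "'a set \<Rightarrow> ('a \<times> 'a \<times> 'a) set \<Rightarrow> nat \<Rightarrow> (nat \<Rightarrow> 'a) \<Rightarrow> ram \<Rightarrow> bool" where
  "outputs_tree X H n x s \<longleftrightarrow>
     leaves {1..reg s 1} (reg s 2) (arr s 1) = {1..n} \<and>
     super_modular_decomposition_tree X H {1..reg s 1} (reg s 2) (arr s 1) x"

end

(*
  Fix an element v of a module P. The maximal modules inside P that avoid v are found by partition
  refinement of P - {v}: whenever a part is split in two, the elements of either half become pivots
  for the other half. Every pair of elements is separated only once, so all refinements together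
  take quadratic time. A strong module that avoids v lies inside one of the resulting parts.

  The modules between v and P are read off a digraph on the parts, with an arc from Q to R if the
  representative of R distinguishes v from the representative of Q. As H is good, the
  representatives do not matter, and every closed set of vertices yields a module containing v;
  conversely a strong module containing v yields a closed set that is comparable with all closed
  sets. Outputting the strong components from the sinks upwards gives a chain of closed sets, and
  such a comparable closed set always occurs in the chain: the first component outside of it is
  output only after the whole set. So the chain becomes a path of the tree, the parts
  are attached to the path, and the same procedure is applied to each part. With m parts this takes
  time O(m^2), which the pairs of elements separated at this stage pay for.
*)

theory Submission
  imports Defs
begin


section \<open>Reasoning about programs\<close>

text \<open>All time is paid from one quantity, the sum of the squared cell lengths. It counts the
  ordered pairs of elements that are still together, starts at n^2 and drops by 2uw when a cell is
  cut into lengths u and w. Refinement tasks and the search in the digraph are both charged to such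
  drops.

  The recursion has no stack. Every cell is an interval of one permutation array,
  \<open>a_att\<close> keeps for its start the node below which its subtree will hang, and one scan
  over the positions replaces the recursive calls. The element at the current position serves as the
  center, so its own leaf comes next.

  Strong components must be found in time O(m^2) although an arc is known only by comparing two
  matrix entries. The search keeps contracted adjacency rows for the blocks on a stack; each of the
  at most m pushes is undone by one merge or one output, and each of these steps takes time O(m).

  The chain may contain modules that are not strong. A super modular decomposition tree permits
  them, so strength never has to be decided. Elements outside of P do not act as pivots for its
  parts, because P is a module.\<close>

text \<open>
  Programs are run against a number of credits, one for each time unit. As every iteration of a
  loop consumes credits, a loop invariant that guarantees enough credits also proves termination.
  All stored values are kept below a bound \<open>B\<close>; only intermediate values such as matrix
  addresses may reach \<open>word B\<close>.
\<close>

definition word :: "nat \<Rightarrow> nat" where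
  "word B = B * B + 2 * B + 2"

definition bounded :: "nat \<Rightarrow> ram \<Rightarrow> bool" where
  "bounded B s \<longleftrightarrow> (\<forall>x. reg s x \<le> B) \<and> (\<forall>a i. arr s a i \<le> B)"

lemma bounded_reg: "bounded B s \<Longrightarrow> reg s x \<le> B"
  and bounded_arr: "bounded B s \<Longrightarrow> arr s a i \<le> B"
  by (simp_all add: bounded_def)

text \<open>A bound on the value in every bounded state, computed from the syntax alone. It turns
  the word check of the machine into the state-free condition \<open>safe\<close>. Subtraction is
  truncated, so only its first operand counts.\<close>

primrec val_bound :: "nat \<Rightarrow> expr \<Rightarrow> nat" where
  "val_bound B (Lit k) = k"
| "val_bound B (Reg x) = B"
| "val_bound B (Cell a e) = B"
| "val_bound B (Add e f) = val_bound B e + val_bound B f"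
| "val_bound B (Sub e f) = val_bound B e"
| "val_bound B (Mul e f) = val_bound B e * val_bound B f"
| "val_bound B (Eq e f) = 1"
| "val_bound B (Less e f) = 1"

primrec safe :: "nat \<Rightarrow> expr \<Rightarrow> bool" where
  "safe B (Lit k) \<longleftrightarrow> k \<le> word B"
| "safe B (Reg x) \<longleftrightarrow> True"
| "safe B (Cell a e) \<longleftrightarrow> safe B e"
| "safe B (Add e f) \<longleftrightarrow> safe B e \<and> safe B f \<and> val_bound B e + val_bound B f \<le> word B"
| "safe B (Sub e f) \<longleftrightarrow> safe B e \<and> safe B f"
| "safe B (Mul e f) \<longleftrightarrow> safe B e \<and> safe B f \<and> val_bound B e * val_bound B f \<le> word B"
| "safe B (Eq e f) \<longleftrightarrow> safe B e \<and> safe B f"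
| "safe B (Less e f) \<longleftrightarrow> safe B e \<and> safe B f"

lemma val_le_val_bound: "bounded B s \<Longrightarrow> val s e \<le> val_bound B e"
  by (induction e) (auto simp: bounded_reg bounded_arr add_mono mult_mono intro: le_trans[OF diff_le_self])

lemma val_bound_le_word: "safe B e \<Longrightarrow> val_bound B e \<le> word B"
  by (induction e) (auto simp: word_def)

lemma fits_safe: "bounded B s \<Longrightarrow> safe B e \<Longrightarrow> fits (word B) s e"
proof -
  assume *: "bounded B s"
  have "safe B e \<Longrightarrow> e' \<in> subexprs e \<Longrightarrow> safe B e'" for e'
    by (induction e) auto
  moreover have "safe B e' \<Longrightarrow> val s e' \<le> word B" for e'
    using val_le_val_bound[OF *, of e'] val_bound_le_word[of B e'] by linarith
  ultimately show "safe B e \<Longrightarrow> fits (word B) s e"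
    unfolding fits_def by blast
qed

section \<open>Frames and a program logic with credits\<close>

primrec written_regs :: "com \<Rightarrow> nat set" where
  "written_regs Skip = {}"
| "written_regs (Set x e) = {x}"
| "written_regs (Store a e f) = {}"
| "written_regs (Seq c d) = written_regs c \<union> written_regs d"
| "written_regs (Cond b c d) = written_regs c \<union> written_regs d"
| "written_regs (While b c) = written_regs c"

primrec written_arrs :: "com \<Rightarrow> nat set" where
  "written_arrs Skip = {}"
| "written_arrs (Set x e) = {}"
| "written_arrs (Store a e f) = {a}"
| "written_arrs (Seq c d) = written_arrs c \<union> written_arrs d"
| "written_arrs (Cond b c d) = written_arrs c \<union> written_arrs d"
| "written_arrs (While b c) = written_arrs c"

text \<open>A frame condition read off the syntax. The loop rule and the specifications of the
  subprograms hand it over, so that invariants and postconditions mention only what changes.\<close>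

definition agree :: "com \<Rightarrow> ram \<Rightarrow> ram \<Rightarrow> bool" where
  "agree c s s' \<longleftrightarrow>
     (\<forall>x. x \<notin> written_regs c \<longrightarrow> reg s' x = reg s x) \<and>
     (\<forall>a. a \<notin> written_arrs c \<longrightarrow> arr s' a = arr s a)"

lemma exec_agree: "exec w c s t s' \<Longrightarrow> agree c s s'"
  by (induction rule: exec.induct) (auto simp: agree_def)

text \<open>A weakest precondition for total correctness: \<open>Q\<close> receives the credits that
  are left, so sequencing becomes nesting. Boundedness is assumed of the first state and asserted of
  the last one, which makes it available in all side conditions and keeps it out of the
  invariants.\<close>

definition run :: "nat \<Rightarrow> com \<Rightarrow> nat \<Rightarrow> ram \<Rightarrow> (nat \<Rightarrow> ram \<Rightarrow> bool) \<Rightarrow> bool" where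
  "run B c k s Q \<longleftrightarrow> (bounded B s \<longrightarrow>
     (\<exists>t s'. exec (word B) c s t s' \<and> t \<le> k \<and> bounded B s' \<and> Q (k - t) s'))"

lemma run_mono:
  assumes "run B c k s Q"
    and "\<And>k' s'. bounded B s' \<Longrightarrow> agree c s s' \<Longrightarrow> Q k' s' \<Longrightarrow> R k' s'"
  shows "run B c k s R"
  using assms exec_agree unfolding run_def by blast

lemma run_Skip:
  assumes "bounded B s \<Longrightarrow> 1 \<le> k" and "bounded B s \<Longrightarrow> Q (k - 1) s"
  shows "run B Skip k s Q"
  using assms exec.Skip unfolding run_def by blast

lemma run_Set:
  assumes "safe B e" and "bounded B s \<Longrightarrow> val s e \<le> B" and "bounded B s \<Longrightarrow> cost e + 1 \<le> k"
    and "bounded B s \<Longrightarrow> Q (k - (cost e + 1)) (s\<lparr>reg := (reg s)(x := val s e)\<rparr>)"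
  shows "run B (Set x e) k s Q"
  unfolding run_def
proof
  assume b: "bounded B s"
  have "bounded B (s\<lparr>reg := (reg s)(x := val s e)\<rparr>)"
    using b assms(2) by (simp add: bounded_def)
  then show "\<exists>t s'. exec (word B) (Set x e) s t s' \<and> t \<le> k \<and> bounded B s' \<and> Q (k - t) s'"
    using exec.Set[OF fits_safe[OF b assms(1)], of x] assms(3,4)[OF b] by blast
qed

lemma run_Store:
  assumes "safe B e" and "safe B f" and "bounded B s \<Longrightarrow> val s f \<le> B"
    and "bounded B s \<Longrightarrow> cost e + cost f + 1 \<le> k"
    and "bounded B s \<Longrightarrow>
      Q (k - (cost e + cost f + 1)) (s\<lparr>arr := (arr s)(a := (arr s a)(val s e := val s f))\<rparr>)"
  shows "run B (Store a e f) k s Q"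
  unfolding run_def
proof
  assume b: "bounded B s"
  have "bounded B (s\<lparr>arr := (arr s)(a := (arr s a)(val s e := val s f))\<rparr>)"
    using b assms(3) by (simp add: bounded_def)
  then show "\<exists>t s'. exec (word B) (Store a e f) s t s' \<and> t \<le> k \<and> bounded B s' \<and> Q (k - t) s'"
    using exec.Store[OF fits_safe[OF b assms(1)] fits_safe[OF b assms(2)], of a] assms(4,5)[OF b]
    by blast
qed

lemma run_Seq:
  assumes "run B c k s (\<lambda>k s. run B d k s Q)"
  shows "run B (Seq c d) k s Q"
  unfolding run_def
proof
  assume "bounded B s"
  then obtain t s' where 1: "exec (word B) c s t s'" "t \<le> k" "bounded B s'"
    "run B d (k - t) s' Q"
    using assms unfolding run_def[of _ c] by blast
  then obtain t' s'' where 2: "exec (word B) d s' t' s''" "t' \<le> k - t" "bounded B s''"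
    "Q (k - t - t') s''"
    unfolding run_def by blast
  show "\<exists>t s'. exec (word B) (Seq c d) s t s' \<and> t \<le> k \<and> bounded B s' \<and> Q (k - t) s'"
    using exec.Seq[OF 1(1) 2(1)] 1(2) 2(2-4)
    by (intro exI[of _ "t + t'"] exI[of _ s'']) simp
qed

lemma run_Cond:
  assumes "safe B b" and "bounded B s \<Longrightarrow> cost b + 1 \<le> k"
    and "bounded B s \<Longrightarrow> val s b \<noteq> 0 \<Longrightarrow> run B c (k - (cost b + 1)) s Q"
    and "bounded B s \<Longrightarrow> val s b = 0 \<Longrightarrow> run B d (k - (cost b + 1)) s Q"
  shows "run B (Cond b c d) k s Q"
  unfolding run_def
proof
  assume B: "bounded B s"
  note f = fits_safe[OF B assms(1)]
  show "\<exists>t s'. exec (word B) (Cond b c d) s t s' \<and> t \<le> k \<and> bounded B s' \<and> Q (k - t) s'"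
  proof (cases "val s b = 0")
    case True
    obtain t s' where 1: "exec (word B) d s t s'" "t \<le> k - (cost b + 1)" "bounded B s'"
      "Q (k - (cost b + 1) - t) s'"
      using assms(4)[OF B True] B unfolding run_def by blast
    show ?thesis
      using CondFalse[OF f True 1(1), of c] 1 assms(2)[OF B]
      by (intro exI[of _ "cost b + 1 + t"] exI[of _ s']) simp
  next
    case False
    obtain t s' where 1: "exec (word B) c s t s'" "t \<le> k - (cost b + 1)" "bounded B s'"
      "Q (k - (cost b + 1) - t) s'"
      using assms(3)[OF B False] B unfolding run_def by blast
    show ?thesis
      using CondTrue[OF f False 1(1), of d] 1 assms(2)[OF B]
      by (intro exI[of _ "cost b + 1 + t"] exI[of _ s']) simp
  qed
qed

lemma agree_refl: "agree c s s"
  by (simp add: agree_def)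

lemma agree_trans: "agree c s s' \<Longrightarrow> agree c s' s'' \<Longrightarrow> agree c s s''"
  by (simp add: agree_def)

text \<open>Induction on the credits: the guard alone consumes at least one unit, so they decrease
  strictly with every iteration. The frame \<open>agree c s s'\<close> refers to the state before
  the loop, hence \<open>I\<close> may omit everything that the body does not write.\<close>

lemma run_While:
  assumes "I k s" and "safe B b"
    and c: "\<And>k s'. bounded B s' \<Longrightarrow> agree c s s' \<Longrightarrow> I k s' \<Longrightarrow> cost b + 1 \<le> k"
    and step: "\<And>k s'. bounded B s' \<Longrightarrow> agree c s s' \<Longrightarrow> I k s' \<Longrightarrow> val s' b \<noteq> 0 \<Longrightarrow>
      run B c (k - (cost b + 1)) s' I"
    and exit: "\<And>k s'. bounded B s' \<Longrightarrow> agree c s s' \<Longrightarrow> I k s' \<Longrightarrow> val s' b = 0 \<Longrightarrow>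
      Q (k - (cost b + 1)) s'"
  shows "run B (While b c) k s Q"
proof -
  have "run B (While b c) k s' Q" if "I k s'" "agree c s s'" for s'
    using that
  proof (induction k arbitrary: s' rule: less_induct)
    case (less k)
    show ?case
      unfolding run_def
    proof
      assume B: "bounded B s'"
      note f = fits_safe[OF B assms(2)]
      note c = c[OF B less.prems(2,1)]
      show "\<exists>t s''. exec (word B) (While b c) s' t s'' \<and> t \<le> k \<and> bounded B s'' \<and> Q (k - t) s''"
      proof (cases "val s' b = 0")
        case True
        then show ?thesis
          using WhileFalse[OF f True, of c] c B exit[OF B less.prems(2,1) True] by blast
      next
        case False
        obtain t1 s1 where 1: "exec (word B) c s' t1 s1" "t1 \<le> k - (cost b + 1)" "bounded B s1"
          "I (k - (cost b + 1) - t1) s1"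
          using step[OF B less.prems(2,1) False] B unfolding run_def by blast
        have "run B (While b c) (k - (cost b + 1) - t1) s1 Q"
          using c by (intro less.IH 1(4) agree_trans[OF less.prems(2) exec_agree[OF 1(1)]]) simp
        then obtain t2 s2 where 2: "exec (word B) (While b c) s1 t2 s2"
          "t2 \<le> k - (cost b + 1) - t1" "bounded B s2" "Q (k - (cost b + 1) - t1 - t2) s2"
          using 1(3) unfolding run_def by blast
        show ?thesis
          using WhileTrue[OF f False 1(1) 2(1)] 1(2) 2(2-4) c
          by (intro exI[of _ "cost b + 1 + t1 + t2"] exI[of _ s2]) simp
      qed
    qed
  qed
  then show ?thesis
    using assms(1) agree_refl by blast
qed

lemmas run_intros = run_Seq run_Skip run_Set run_Store run_Cond


section \<open>Interval partitions of a permutation\<close>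

definition uniform :: "(nat \<Rightarrow> nat \<Rightarrow> nat) \<Rightarrow> nat \<Rightarrow> nat set \<Rightarrow> bool" where
  "uniform a x M \<longleftrightarrow> (\<forall>y\<in>M. \<forall>z\<in>M. a x y = a x z)"

definition matrix_module :: "nat \<Rightarrow> (nat \<Rightarrow> nat \<Rightarrow> nat) \<Rightarrow> nat set \<Rightarrow> bool" where
  "matrix_module n a M \<longleftrightarrow> M \<subseteq> {..<n} \<and> (\<forall>x\<in>{..<n} - M. uniform a x M)"

text \<open>
  A set \<open>S\<close> of starting positions with \<open>0 \<in> S\<close> divides \<open>{..<n}\<close> into intervals.
\<close>

definition next_start :: "nat \<Rightarrow> nat set \<Rightarrow> nat \<Rightarrow> nat" where
  "next_start n S s = (LEAST t. s < t \<and> (t \<in> S \<or> t = n))"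

abbreviation interval :: "nat \<Rightarrow> nat set \<Rightarrow> nat \<Rightarrow> nat set" where
  "interval n S s \<equiv> {s..<next_start n S s}"

lemma next_start:
  assumes "s < n"
  shows "s < next_start n S s" and "next_start n S s \<in> S \<or> next_start n S s = n"
    and "next_start n S s \<le> n"
  using LeastI[of "\<lambda>t. s < t \<and> (t \<in> S \<or> t = n)" n] Least_le[of "\<lambda>t. s < t \<and> (t \<in> S \<or> t = n)" n] assms
  unfolding next_start_def by auto

lemma next_start_le: "s < t \<Longrightarrow> t \<in> S \<or> t = n \<Longrightarrow> next_start n S s \<le> t"
  unfolding next_start_def by (rule Least_le) auto

lemma next_start_eqI:
  assumes "s < t" and "t \<in> S \<or> t = n" and "\<And>u. u \<in> S \<Longrightarrow> s < u \<Longrightarrow> t \<le> u" and "t \<le> n"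
  shows "next_start n S s = t"
  unfolding next_start_def using assms by (intro Least_equality) auto

lemma next_start_insert:
  assumes "s < n" "m < n"
  shows "next_start n (insert m S) s =
    (if s < m \<and> m < next_start n S s then m else next_start n S s)"
proof (cases "s < m \<and> m < next_start n S s")
  case True
  have "next_start n (insert m S) s = m"
  proof (rule next_start_eqI)
    fix u assume "u \<in> insert m S" "s < u"
    then show "m \<le> u"
      using next_start_le[of s u S n] True by auto
  qed (use True assms in auto)
  then show ?thesis using True by simp
next
  case False
  have "next_start n (insert m S) s = next_start n S s"
  proof (rule next_start_eqI)
    fix u assume "u \<in> insert m S" "s < u"
    then show "next_start n S s \<le> u"
      using next_start_le[of s u S n] False by auto
  qed (use next_start[OF assms(1), of S] in auto)
  then show ?thesis using False by auto
qed

lemma next_start_interior: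
  assumes "c < n" "c < m" "m < next_start n S c"
  shows "next_start n S m = next_start n S c"
proof (rule next_start_eqI)
  fix u assume "u \<in> S" "m < u"
  then show "next_start n S c \<le> u"
    using next_start_le[of c u S n] assms(2) by simp
qed (use next_start[OF assms(1), of S] assms in auto)

lemma interval_disjoint:
  assumes "s \<in> S" "t \<in> S" "s \<noteq> t"
  shows "interval n S s \<inter> interval n S t = {}"
  using assms next_start_le[of s t S n] next_start_le[of t s S n]
  by (cases "s < t") auto

lemma interval_cover:
  assumes "S \<subseteq> {..<n}" "p \<in> S" "p \<le> i" "i < n"
  obtains s where "s \<in> S" "p \<le> s" "i \<in> interval n S s"
proof -
  let ?T = "{s \<in> S. s \<le> i}"
  define s where "s = Max ?T"
  have fin: "finite ?T" by simp
  have "p \<in> ?T" using assms by simp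
  then have s: "s \<in> ?T" "p \<le> s"
    unfolding s_def using Max_in[OF fin] Max_ge[OF fin] by blast+
  have "i < next_start n S s"
  proof (rule ccontr)
    assume *: "\<not> i < next_start n S s"
    have "s < n" using s assms(1) by auto
    note ns = next_start[OF this, of S]
    have "next_start n S s \<in> ?T" using ns * assms(4) by auto
    then have "next_start n S s \<le> s" unfolding s_def using Max_ge[OF fin] by blast
    then show False using ns by simp
  qed
  then show ?thesis using s that by auto
qed

text \<open>The number of ordered pairs of positions in a common interval, that is, of pairs not yet
  separated. It is \<open>n * n\<close> for the trivial partition and pays for the whole
  computation.\<close>

definition square_weight :: "nat \<Rightarrow> nat set \<Rightarrow> nat" where
  "square_weight n S = (\<Sum>s\<in>S. (next_start n S s - s)\<^sup>2)"

text \<open>Cutting lengths u and w apart separates 2uw ordered pairs, as (u + w)^2 = u^2 + w^2 +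
  2uw.\<close>

lemma square_weight_insert:
  assumes S: "S \<subseteq> {..<n}" and c: "c \<in> S" "c < m" "m < next_start n S c"
  shows "square_weight n S =
    square_weight n (insert m S) + 2 * (m - c) * (next_start n S c - m)"
proof -
  have fin: "finite S" using S finite_subset by blast
  have cn: "c < n" using S c by auto
  have mn: "m < n" using next_start[OF cn, of S] c by linarith
  have mS: "m \<notin> S" using next_start_le[of c m S n] c by auto
  have eq: "next_start n (insert m S) s = next_start n S s" if "s \<in> S - {c}" for s
  proof -
    have "interval n S s \<inter> interval n S c = {}" using interval_disjoint[of s S c n] that c by blast
    moreover have "m \<in> interval n S c" using c by simp
    ultimately have "\<not> (s < m \<and> m < next_start n S s)" by auto
    then show ?thesis using next_start_insert[of s n m S] that S mn by auto
  qed
  have rest: "(\<Sum>s\<in>S - {c}. (next_start n (insert m S) s - s)\<^sup>2) = (\<Sum>s\<in>S - {c}. (next_start n S s - s)\<^sup>2)"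
    using eq by simp
  have nc: "next_start n (insert m S) c = m" using next_start_insert[OF cn mn, of S] c by simp
  have nm: "next_start n (insert m S) m = next_start n S c"
    using next_start_insert[OF mn mn, of S] next_start_interior[OF cn c(2,3)] by simp
  obtain d1 where d1: "m = c + d1" using le_Suc_ex[OF less_imp_le_nat[OF c(2)]] by blast
  obtain d2 where d2: "next_start n S c = m + d2" using le_Suc_ex[OF less_imp_le_nat[OF c(3)]] by blast
  have "square_weight n (insert m S) =
      (next_start n S c - m)\<^sup>2 + ((m - c)\<^sup>2 + (\<Sum>s\<in>S - {c}. (next_start n S s - s)\<^sup>2))"
    unfolding square_weight_def sum.insert[OF fin mS] sum.remove[OF fin c(1)] nm nc rest ..
  moreover have "square_weight n S =
      (next_start n S c - c)\<^sup>2 + (\<Sum>s\<in>S - {c}. (next_start n S s - s)\<^sup>2)"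
    unfolding square_weight_def using sum.remove[OF fin c(1)] .
  ultimately show ?thesis
    unfolding d2 unfolding d1 by (simp add: power2_eq_square algebra_simps)
qed

text \<open>
  Pairs \<open>(i, q) \<in> P\<close> are still to be processed: the element at position \<open>i\<close> is going to split the
  interval of position \<open>q\<close>.
\<close>

definition covered ::
  "nat \<Rightarrow> (nat \<Rightarrow> nat \<Rightarrow> nat) \<Rightarrow> nat set \<Rightarrow> (nat \<Rightarrow> nat) \<Rightarrow> (nat \<times> nat) set \<Rightarrow> bool" where
  "covered n a S f P \<longleftrightarrow> (\<forall>s\<in>S. \<forall>i<n. i \<notin> interval n S s \<longrightarrow>
     uniform a (f i) (f ` interval n S s) \<or> {i} \<times> interval n S s \<subseteq> P)"

lemma uniform_subset: "uniform a x M \<Longrightarrow> N \<subseteq> M \<Longrightarrow> uniform a x N"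
  unfolding uniform_def by blast

text \<open>The halves may distinguish each other's elements, so these pairs enter
  \<open>P'\<close>; all other pairs inherit their state, since a part of a uniform set is uniform.
  The cell may be permuted at the same time: the element now at \<open>i\<close> was before at some
  \<open>i''\<close> of the same cell, and \<open>P\<close> does not tell the positions of a cell
  apart.\<close>

lemma covered_split:
  assumes S: "S \<subseteq> {..<n}" and c: "c \<in> S" "c < m" "m < next_start n S c"
    and f: "\<And>i. i \<notin> interval n S c \<Longrightarrow> f' i = f i" "f' ` interval n S c = f ` interval n S c"
    and cov: "covered n a S f P"
    and P: "\<And>i i' q. i \<in> interval n S c \<Longrightarrow> i' \<in> interval n S c \<Longrightarrow> (i, q) \<in> P \<Longrightarrow> (i', q) \<in> P"
    and P': "P \<subseteq> P'" "{c..<m} \<times> {m..<next_start n S c} \<subseteq> P'" "{m..<next_start n S c} \<times> {c..<m} \<subseteq> P'"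
  shows "covered n a (insert m S) f' P'"
  unfolding covered_def
proof (intro ballI allI impI)
  fix s i assume s: "s \<in> insert m S" and i: "i < n" "i \<notin> interval n (insert m S) s"
  let ?R = "interval n S c"
  have cn: "c < n" using S c by auto
  have mn: "m < n" using next_start[OF cn, of S] c by linarith
  have nc: "next_start n (insert m S) c = m" using next_start_insert[OF cn mn, of S] c by simp
  have nm: "next_start n (insert m S) m = next_start n S c"
    using next_start_insert[OF mn mn, of S] next_start_interior[OF cn c(2,3)] by simp
  show "uniform a (f' i) (f' ` interval n (insert m S) s) \<or> {i} \<times> interval n (insert m S) s \<subseteq> P'"
  proof (cases "s = c \<or> s = m")
    case True
    then have sub: "interval n (insert m S) s \<subseteq> ?R"
      using nc nm c by auto
    show ?thesis
    proof (cases "i \<in> ?R")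
      case True
      then show ?thesis using \<open>s = c \<or> s = m\<close> P' i(2) nc nm by (auto simp: subset_iff)
    next
      case False
      then have "uniform a (f i) (f ` ?R) \<or> {i} \<times> ?R \<subseteq> P"
        using cov c(1) i(1) unfolding covered_def by blast
      then show ?thesis
      proof
        assume "uniform a (f i) (f ` ?R)"
        moreover have "f' ` interval n (insert m S) s \<subseteq> f ` ?R" using sub f(2) by blast
        ultimately show ?thesis using f(1)[OF False] uniform_subset by metis
      next
        assume "{i} \<times> ?R \<subseteq> P"
        then show ?thesis using sub P'(1) by blast
      qed
    qed
  next
    case False
    then have s': "s \<in> S" "s \<noteq> c" using s by auto
    then have dis: "interval n S s \<inter> ?R = {}" using interval_disjoint c(1) by blast
    have "m \<in> ?R" using c by simp
    then have "\<not> (s < m \<and> m < next_start n S s)" using dis by auto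
    then have eq: "next_start n (insert m S) s = next_start n S s"
      using next_start_insert[of s n m S] s' S mn by auto
    have fs: "f' ` interval n S s = f ` interval n S s"
      by (intro image_cong refl f(1)) (use dis in blast)
    have i': "i \<notin> interval n S s" using i(2) eq by simp
    show ?thesis
    proof (cases "i \<in> ?R")
      case False
      then show ?thesis using cov s'(1) i(1) i' P'(1) f(1)[OF False] unfolding covered_def eq fs by fastforce
    next
      case True
      then have "f' i \<in> f ` ?R" using f(2) by blast
      then obtain i'' where i'': "i'' \<in> ?R" "f' i = f i''" by blast
      have "i'' < n" "i'' \<notin> interval n S s"
        using i'' dis next_start(3)[OF cn, of S] by auto
      then have "uniform a (f i'') (f ` interval n S s) \<or> {i''} \<times> interval n S s \<subseteq> P"
        using cov s'(1) unfolding covered_def by blast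
      then show ?thesis
        using P[OF i''(1) True] P'(1) unfolding eq fs i''(2) by blast
    qed
  qed
qed

text \<open>The argument of \<open>covered_split\<close> without a cut, for a pivot that has moved
  elements within a cell but not divided it.\<close>

lemma covered_permute:
  assumes S: "S \<subseteq> {..<n}" and c: "c \<in> S"
    and f: "\<And>i. i \<notin> interval n S c \<Longrightarrow> f' i = f i" "f' ` interval n S c = f ` interval n S c"
    and cov: "covered n a S f P"
    and P: "\<And>i i' q. i \<in> interval n S c \<Longrightarrow> i' \<in> interval n S c \<Longrightarrow> (i, q) \<in> P \<Longrightarrow> (i', q) \<in> P"
  shows "covered n a S f' P"
  unfolding covered_def
proof (intro ballI allI impI)
  fix s i assume s: "s \<in> S" and i: "i < n" "i \<notin> interval n S s"
  let ?R = "interval n S c"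
  have fs: "f' ` interval n S s = f ` interval n S s"
  proof (cases "s = c")
    case False
    then show ?thesis
      using interval_disjoint[OF s c False, of n] by (intro image_cong refl f(1)) blast
  qed (use f in simp)
  show "uniform a (f' i) (f' ` interval n S s) \<or> {i} \<times> interval n S s \<subseteq> P"
  proof (cases "i \<in> ?R")
    case False
    then show ?thesis using cov s i f(1)[OF False] unfolding covered_def fs by fastforce
  next
    case True
    then have "f' i \<in> f ` ?R" using f(2) by blast
    then obtain i'' where i'': "i'' \<in> ?R" "f' i = f i''" by blast
    have "s \<noteq> c" using True i by blast
    then have "i'' \<notin> interval n S s" using i''(1) interval_disjoint[OF s c, of n] by blast
    moreover have "i'' < n" using i'' next_start(3)[of c n S] S c by fastforce
    ultimately have "uniform a (f i'') (f ` interval n S s) \<or> {i''} \<times> interval n S s \<subseteq> P"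
      using cov s unfolding covered_def by blast
    then show ?thesis
      using P[OF i''(1) True] unfolding fs i''(2) by blast
  qed
qed

text \<open>The pairs of \<open>i\<close> with a cell may be struck off once the cell is uniform for
  the element at \<open>i\<close>. Distinct cells are disjoint, so no pair of another cell is lost
  with them.\<close>

lemma covered_done:
  assumes "covered n a S f P" and "P \<subseteq> Q \<union> {i} \<times> interval n S c" and "c \<in> S"
    and "uniform a (f i) (f ` interval n S c)"
  shows "covered n a S f Q"
  unfolding covered_def
proof (intro ballI allI impI)
  fix s j assume s: "s \<in> S" and j: "j < n" "j \<notin> interval n S s"
  then have *: "uniform a (f j) (f ` interval n S s) \<or> {j} \<times> interval n S s \<subseteq> P"
    using assms(1) unfolding covered_def by blast
  show "uniform a (f j) (f ` interval n S s) \<or> {j} \<times> interval n S s \<subseteq> Q"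
  proof (cases "s = c")
    case False
    then have "interval n S s \<inter> interval n S c = {}"
      using interval_disjoint s assms(3) by blast
    then show ?thesis using * assms(2) by blast
  next
    case True
    then show ?thesis using * assms(2,4) by (cases "j = i") blast+
  qed
qed

text \<open>Cuts happen only in \<open>{p..<q}\<close>, elements stay in their old cells, and a
  module inside of an old cell stays inside of a single new one. The last clause speaks about all
  modules, strong or not, because every cut is justified by a pivot outside of the cell.\<close>

definition refined ::
  "nat \<Rightarrow> (nat \<Rightarrow> nat \<Rightarrow> nat) \<Rightarrow> nat \<Rightarrow> nat \<Rightarrow> nat set \<Rightarrow> (nat \<Rightarrow> nat) \<Rightarrow> nat set \<Rightarrow> (nat \<Rightarrow> nat) \<Rightarrow> bool" where
  "refined n a p q S f S' f' \<longleftrightarrow>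
     S \<subseteq> S' \<and> S' \<subseteq> S \<union> {p..<q} \<and> S' \<subseteq> {..<n} \<and>
     bij_betw f' {..<n} {..<n} \<and>
     (\<forall>s\<in>S. f' ` interval n S s = f ` interval n S s) \<and>
     (\<forall>M. matrix_module n a M \<longrightarrow> (\<exists>s\<in>S. M \<subseteq> f ` interval n S s) \<longrightarrow>
       (\<exists>s\<in>S'. M \<subseteq> f' ` interval n S' s))"

lemmas refinedD =
  refined_def[THEN iffD1, THEN conjunct1]
  refined_def[THEN iffD1, THEN conjunct2, THEN conjunct1]
  refined_def[THEN iffD1, THEN conjunct2, THEN conjunct2, THEN conjunct1]
  refined_def[THEN iffD1, THEN conjunct2, THEN conjunct2, THEN conjunct2, THEN conjunct1]
  refined_def[THEN iffD1, THEN conjunct2, THEN conjunct2, THEN conjunct2, THEN conjunct2,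
    THEN conjunct1, rule_format]
  refined_def[THEN iffD1, THEN conjunct2, THEN conjunct2, THEN conjunct2, THEN conjunct2,
    THEN conjunct2, rule_format]

lemma refined_refl: "S \<subseteq> {..<n} \<Longrightarrow> bij_betw f {..<n} {..<n} \<Longrightarrow> refined n a p q S f S f"
  by (simp add: refined_def)

text \<open>An interval of the coarse partition is a union of intervals of the fine one, so equality
  of the images passes upwards. This makes \<open>refined\<close> transitive.\<close>

lemma image_interval_coarse:
  assumes "S \<subseteq> S'" "S' \<subseteq> {..<n}" "s \<in> S"
    and "\<And>t. t \<in> S' \<Longrightarrow> f' ` interval n S' t = f ` interval n S' t"
  shows "f' ` interval n S s = f ` interval n S s"
proof -
  have un: "interval n S s = (\<Union>t\<in>S' \<inter> interval n S s. interval n S' t)"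
  proof
    show "interval n S s \<subseteq> (\<Union>t\<in>S' \<inter> interval n S s. interval n S' t)"
    proof
      fix i assume i: "i \<in> interval n S s"
      moreover have "i < n" using i next_start(3)[of s n S] assms by fastforce
      ultimately obtain t where "t \<in> S'" "s \<le> t" "i \<in> interval n S' t"
        using interval_cover[OF assms(2), of s i] assms(1,3) by auto
      moreover have "t < next_start n S s" using calculation i by auto
      ultimately show "i \<in> (\<Union>t\<in>S' \<inter> interval n S s. interval n S' t)" by auto
    qed
    show "(\<Union>t\<in>S' \<inter> interval n S s. interval n S' t) \<subseteq> interval n S s"
    proof (rule UN_least)
      fix t assume t: "t \<in> S' \<inter> interval n S s"
      have "next_start n S s \<in> S \<or> next_start n S s = n"
        by (rule next_start) (use assms in auto)
      then have "next_start n S' t \<le> next_start n S s"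
        using t assms(1) by (intro next_start_le) auto
      then show "interval n S' t \<subseteq> interval n S s" using t by auto
    qed
  qed
  show ?thesis
    by (subst (1 2) un) (simp add: image_UN assms(4))
qed

lemma refined_trans:
  assumes 1: "refined n a p q S f S' f'" and 2: "refined n a p q S' f' S'' f''"
  shows "refined n a p q S f S'' f''"
proof -
  note D1 = refinedD[OF 1] and D2 = refinedD[OF 2]
  have "f'' ` interval n S s = f ` interval n S s" if "s \<in> S" for s
    using image_interval_coarse[OF D1(1,3) that, of f'' f'] D1(5)[OF that] D2(5) by simp
  moreover have "S'' \<subseteq> S \<union> {p..<q}" "S \<subseteq> S''"
    using D1(1,2) D2(1,2) by blast+
  moreover have "\<exists>s\<in>S''. M \<subseteq> f'' ` interval n S'' s"
    if "matrix_module n a M" "\<exists>s\<in>S. M \<subseteq> f ` interval n S s" for M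
    using D2(6)[OF that(1) D1(6)[OF that]] .
  ultimately show ?thesis
    unfolding refined_def using D2(3,4) by simp
qed

lemma interval_subset_of_mem:
  assumes "S \<subseteq> {..<n}" "c \<in> S" "u \<in> S \<or> u = n" "v \<in> S \<or> v = n" "u \<le> c" "c < v"
  shows "interval n S c \<subseteq> {u..<v}"
  using next_start_le[of c v S n] assms by auto

lemma interval_inter_empty:
  assumes "S \<subseteq> {..<n}" "c \<in> S" "u \<in> S \<or> u = n" "v \<in> S \<or> v = n" "\<not> (u \<le> c \<and> c < v)"
  shows "interval n S c \<inter> {u..<v} = {}"
  using next_start_le[of c u S n] assms by (cases "c < u") auto

text \<open>The pivot \<open>x\<close> lies outside of the cell, hence outside of every module
  \<open>M\<close> in it, and does not distinguish the elements of \<open>M\<close>. So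
  \<open>M\<close> cannot contain both an element of class \<open>v\<close> at \<open>x\<close> and
  one of another class.\<close>

lemma refined_split:
  assumes S: "S \<subseteq> {..<n}" and c: "c \<in> S" "c < m" "m < next_start n S c"
    and pq: "p \<le> c" "next_start n S c \<le> q"
    and bij: "bij_betw f {..<n} {..<n}" "bij_betw f' {..<n} {..<n}"
    and f: "\<And>i. i \<notin> interval n S c \<Longrightarrow> f' i = f i" "f' ` interval n S c = f ` interval n S c"
    and x: "x < n" "x \<notin> f ` interval n S c"
    and sp: "\<And>i. i \<in> {c..<m} \<Longrightarrow> a x (f' i) = v" "\<And>i. i \<in> {m..<next_start n S c} \<Longrightarrow> a x (f' i) \<noteq> v"
  shows "refined n a p q S f (insert m S) f'"
proof -
  let ?R = "interval n S c"
  have cn: "c < n" using S c by auto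
  have mn: "m < n" using next_start[OF cn, of S] c by linarith
  have nc: "next_start n (insert m S) c = m" using next_start_insert[OF cn mn, of S] c by simp
  have nm: "next_start n (insert m S) m = next_start n S c"
    using next_start_insert[OF mn mn, of S] next_start_interior[OF cn c(2,3)] by simp
  have fs: "f' ` interval n S s = f ` interval n S s" if s: "s \<in> S" for s
  proof (cases "s = c")
    case False
    then show ?thesis
      using interval_disjoint[OF s c(1) False, of n] by (intro image_cong refl f(1)) blast
  qed (use f in simp)
  have "\<exists>s\<in>insert m S. M \<subseteq> f' ` interval n (insert m S) s"
    if M: "matrix_module n a M" and s: "s \<in> S" "M \<subseteq> f ` interval n S s" for M s
  proof (cases "s = c")
    case False
    then have "interval n S s \<inter> ?R = {}" using interval_disjoint c(1) s by blast
    moreover have "m \<in> ?R" using c by simp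
    ultimately have "\<not> (s < m \<and> m < next_start n S s)" by auto
    then have eq: "next_start n (insert m S) s = next_start n S s"
      using next_start_insert[of s n m S] s S mn by auto
    show ?thesis using s fs[OF s(1)] eq by (intro bexI[of _ s]) auto
  next
    case True
    then have MR: "M \<subseteq> f' ` ?R" using s f(2) by simp
    have split: "?R = {c..<m} \<union> {m..<next_start n S c}" using c by auto
    have "x \<in> {..<n} - M" using x s True by auto
    then have u: "uniform a x M" using M unfolding matrix_module_def by blast
    show ?thesis
    proof (cases "M \<inter> f' ` {c..<m} = {}")
      case True
      then have "M \<subseteq> f' ` {m..<next_start n S c}" using MR unfolding split by blast
      then show ?thesis using nm by (intro bexI[of _ m]) auto
    next
      case False
      then obtain y where y: "y \<in> M" "y \<in> f' ` {c..<m}" by blast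
      have "M \<inter> f' ` {m..<next_start n S c} = {}"
      proof (rule equals0I)
        fix z assume z: "z \<in> M \<inter> f' ` {m..<next_start n S c}"
        have "a x y = a x z" using u y z unfolding uniform_def by blast
        moreover have "a x y = v" using y sp(1) by auto
        moreover have "a x z \<noteq> v" using z sp(2) by fastforce
        ultimately show False by simp
      qed
      then have "M \<subseteq> f' ` {c..<m}" using MR unfolding split by blast
      then show ?thesis using nc c by (intro bexI[of _ c]) auto
    qed
  qed
  moreover have "insert m S \<subseteq> S \<union> {p..<q}" using c pq by auto
  ultimately show ?thesis
    unfolding refined_def using bij(2) fs S mn by (simp add: subset_insertI) blast
qed

lemma refined_permute:
  assumes S: "S \<subseteq> {..<n}" and c: "c \<in> S"
    and bij: "bij_betw f' {..<n} {..<n}"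
    and f: "\<And>i. i \<notin> interval n S c \<Longrightarrow> f' i = f i" "f' ` interval n S c = f ` interval n S c"
  shows "refined n a p q S f S f'"
proof -
  have fs: "f' ` interval n S s = f ` interval n S s" if s: "s \<in> S" for s
  proof (cases "s = c")
    case False
    then show ?thesis
      using interval_disjoint[OF s c(1) False, of n] by (intro image_cong refl f(1)) blast
  qed (use f in simp)
  then show ?thesis
    unfolding refined_def using bij S by simp
qed

text \<open>Running times are sums of numerals, which these rules would turn into unary notation.\<close>

declare One_nat_def [simp del] add_2_eq_Suc [simp del] add_2_eq_Suc' [simp del]


section \<open>Partition refinement\<close>

text \<open>
  The uses of the registers 0, 1, 2 and of the arrays 0, 1 are prescribed by the conventions for
  input and output.
\<close>

abbreviation (input) "r_order \<equiv> 0 :: nat"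
abbreviation (input) "r_nodes \<equiv> 1 :: nat"
abbreviation (input) "r_root \<equiv> 2 :: nat"
abbreviation (input) "r_pos \<equiv> 3 :: nat"
abbreviation (input) "r_end \<equiv> 4 :: nat"
abbreviation (input) "r_head \<equiv> 5 :: nat"
abbreviation (input) "r_tail \<equiv> 6 :: nat"
abbreviation (input) "r_pivot \<equiv> 7 :: nat"
abbreviation (input) "r_pivot_end \<equiv> 8 :: nat"
abbreviation (input) "r_low \<equiv> 9 :: nat"
abbreviation (input) "r_target_end \<equiv> 10 :: nat"
abbreviation (input) "r_elem \<equiv> 11 :: nat"
abbreviation (input) "r_high \<equiv> 12 :: nat"
abbreviation (input) "r_mid \<equiv> 13 :: nat"
abbreviation (input) "r_scan \<equiv> 14 :: nat"
abbreviation (input) "r_val \<equiv> 15 :: nat"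
abbreviation (input) "r_tmp \<equiv> 16 :: nat"
abbreviation (input) "r_target \<equiv> 17 :: nat"

abbreviation (input) "a_mat \<equiv> 0 :: nat"
abbreviation (input) "a_par \<equiv> 1 :: nat"
abbreviation (input) "a_perm \<equiv> 2 :: nat"
abbreviation (input) "a_fin \<equiv> 3 :: nat"
abbreviation (input) "a_pivot \<equiv> 4 :: nat"
abbreviation (input) "a_pivot_end \<equiv> 5 :: nat"
abbreviation (input) "a_target \<equiv> 6 :: nat"
abbreviation (input) "a_target_end \<equiv> 7 :: nat"

abbreviation seq :: "com \<Rightarrow> com \<Rightarrow> com" (infixr ";;" 60) where
  "c ;; d \<equiv> Seq c d"

abbreviation incr :: "nat \<Rightarrow> com" where
  "incr x \<equiv> Set x (Add (Reg x) (Lit 1))"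

abbreviation mat :: "expr \<Rightarrow> expr \<Rightarrow> expr" where
  "mat e f \<equiv> Cell a_mat (Add (Mul e (Reg r_order)) f)"

text \<open>One step of an in-place partition by equality: from the start of the cell to
  \<open>r_mid\<close> lie elements of class \<open>r_val\<close> at the pivot, from
  \<open>r_mid\<close> to \<open>r_scan\<close> the others.\<close>

definition partition_body :: com where
  "partition_body =
     Cond (Eq (mat (Reg r_elem) (Cell a_perm (Reg r_scan))) (Reg r_val))
       (Set r_tmp (Cell a_perm (Reg r_scan)) ;;
        Store a_perm (Reg r_scan) (Cell a_perm (Reg r_mid)) ;;
        Store a_perm (Reg r_mid) (Reg r_tmp) ;;
        incr r_mid)
       Skip ;;
     incr r_scan"

definition partition_loop :: com where
  "partition_loop = While (Less (Reg r_scan) (Reg r_high)) partition_body"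

lemma image_swap: "i \<in> A \<Longrightarrow> j \<in> A \<Longrightarrow> (f(j := f i, i := f j)) ` A = f ` A"
  by (auto simp: image_def split: if_splits)

lemma bij_betw_swap:
  assumes "bij_betw f A A" "i \<in> A" "j \<in> A"
  shows "bij_betw (f(j := f i, i := f j)) A A"
  using assms image_swap[OF assms(2,3), of f] unfolding bij_betw_def inj_on_def by auto

definition matrix_in :: "nat \<Rightarrow> (nat \<Rightarrow> nat \<Rightarrow> nat) \<Rightarrow> ram \<Rightarrow> bool" where
  "matrix_in n a s \<longleftrightarrow> reg s r_order = n \<and> (\<forall>i<n. \<forall>j<n. arr s a_mat (i * n + j) = a i j)"

lemma bij_betw_lessThan: "bij_betw f {..<n} {..<n} \<Longrightarrow> i < n \<Longrightarrow> f i < n"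
  for n :: nat by (auto simp: bij_betw_def)

text \<open>The scan begins at \<open>c + 1\<close> because the first element defines the class;
  thus the first half is never empty. An iteration takes at most 32 units including its guard, and
  the last guard takes 4.\<close>

lemma run_partition_loop:
  assumes n: "n \<le> B" and mat: "matrix_in n a s" and x: "reg s r_elem < n"
    and ce: "c < e" "e \<le> n" "reg s r_mid = c + 1" "reg s r_scan = c + 1" "reg s r_high = e"
    and perm: "bij_betw (arr s a_perm) {..<n} {..<n}"
    and val: "a (reg s r_elem) (arr s a_perm c) = reg s r_val"
    and k: "32 * (e - (c + 1)) + 4 \<le> k"
    and Q: "\<And>k' s'. bounded B s' \<Longrightarrow> agree partition_loop s s' \<Longrightarrow>
      k \<le> k' + (32 * (e - (c + 1)) + 4) \<Longrightarrow> c < reg s' r_mid \<Longrightarrow> reg s' r_mid \<le> e \<Longrightarrow>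
      bij_betw (arr s' a_perm) {..<n} {..<n} \<Longrightarrow>
      (\<And>i. i \<notin> {c..<e} \<Longrightarrow> arr s' a_perm i = arr s a_perm i) \<Longrightarrow>
      arr s' a_perm ` {c..<e} = arr s a_perm ` {c..<e} \<Longrightarrow>
      (\<And>i. i \<in> {c..<reg s' r_mid} \<Longrightarrow> a (reg s r_elem) (arr s' a_perm i) = reg s r_val) \<Longrightarrow>
      (\<And>i. i \<in> {reg s' r_mid..<e} \<Longrightarrow> a (reg s r_elem) (arr s' a_perm i) \<noteq> reg s r_val) \<Longrightarrow>
      Q k' s'"
  shows "run B partition_loop k s Q"
proof -
  define x where "x = reg s r_elem"
  define v where "v = reg s r_val"
  \<comment> \<open>\<open>J\<close> speaks about plain numbers and functions, so that its
    preservation is proved without record updates; \<open>I\<close> reads it off a state.\<close>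
  define J where "J k' m j f \<longleftrightarrow>
      c < m \<and> m \<le> j \<and> j \<le> e \<and> k \<le> k' + 32 * (j - (c + 1)) \<and> bij_betw f {..<n} {..<n} \<and>
      (\<forall>i. i \<notin> {c..<e} \<longrightarrow> f i = arr s a_perm i) \<and> f ` {c..<e} = arr s a_perm ` {c..<e} \<and>
      (\<forall>i \<in> {c..<m}. a x (f i) = v) \<and> (\<forall>i \<in> {m..<j}. a x (f i) \<noteq> v)" for k' m j and f :: "nat \<Rightarrow> nat"
  define I where "I k' s' \<longleftrightarrow> J k' (reg s' r_mid) (reg s' r_scan) (arr s' a_perm)" for k' and s' :: ram
  show ?thesis
    unfolding partition_loop_def
  proof (rule run_While[where I = I])
    have "{c..<c + 1} = {c}" by auto
    then have "J k (c + 1) (c + 1) (arr s a_perm)"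
      using ce perm val \<open>{c..<c + 1} = {c}\<close> unfolding J_def x_def v_def by simp
    then show "I k s"
      using ce unfolding I_def by simp
  next
    fix k' s'
    let ?b = "Less (Reg r_scan) (Reg r_high)"
    assume ag: "agree partition_body s s'" and B: "bounded B s'" and I: "I k' s'"
    define m where "m = reg s' r_mid"
    define j where "j = reg s' r_scan"
    define f where "f = arr s' a_perm"
    have J: "J k' m j f" using I unfolding I_def m_def j_def f_def .
    note J' = J[unfolded J_def]
    have r: "reg s' r_elem = x" "reg s' r_val = v" "reg s' r_order = n" "reg s' r_high = e"
      and a0: "arr s' a_mat = arr s a_mat"
      using ag mat ce unfolding agree_def x_def v_def matrix_in_def partition_body_def by simp_all
    show "cost ?b + 1 \<le> k'"
      using J' k by simp linarith
    {
      assume "val s' ?b \<noteq> 0"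
      then have j: "j < e" using r by (simp add: j_def split: if_splits)
      have "f j < n" using bij_betw_lessThan[of f n] J' j ce(2) by simp
      then have axj: "arr s' a_mat (x * n + f j) = a x (f j)"
        using mat x a0 unfolding matrix_in_def x_def by simp
      have k': "k' \<ge> 32"
        using J' k j by arith
      have 1: "J k'' (m + 1) (j + 1) (f(j := f m, m := f j))" if "k' \<le> k'' + 32" "a x (f j) = v" for k''
        unfolding J_def
      proof (intro conjI)
        show "bij_betw (f(j := f m, m := f j)) {..<n} {..<n}"
          using J' j ce by (intro bij_betw_swap) auto
        show "(f(j := f m, m := f j)) ` {c..<e} = arr s a_perm ` {c..<e}"
          using J' j by (subst image_swap) auto
        show "k \<le> k'' + 32 * (j + 1 - (c + 1))" using J' that by arith
        have "i < m \<or> i = m" if "i \<in> {c..<m + 1}" for i using that by auto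
        then show "\<forall>i\<in>{c..<m + 1}. a x ((f(j := f m, m := f j)) i) = v"
          using J' that by auto
        show "\<forall>i\<in>{m + 1..<j + 1}. a x ((f(j := f m, m := f j)) i) \<noteq> v"
        proof
          \<comment> \<open>Position \<open>j\<close> now holds the former element of position
            \<open>m\<close>. For \<open>i = j\<close> this forces \<open>m < j\<close>, so that
            element is one of those scanned and found different.\<close>
          fix i assume i: "i \<in> {m + 1..<j + 1}"
          then have "(if i = j then m else i) \<in> {m..<j}" by auto
          then have "a x (f (if i = j then m else i)) \<noteq> v" using J' by blast
          moreover have "(f(j := f m, m := f j)) i = f (if i = j then m else i)" using i by auto
          ultimately show "a x ((f(j := f m, m := f j)) i) \<noteq> v" by simp
        qed
        show "\<forall>i. i \<notin> {c..<e} \<longrightarrow> (f(j := f m, m := f j)) i = arr s a_perm i"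
          using J' j by simp
      qed (use J' j in linarith)+
      have 2: "J k'' m (j + 1) f" if "k' \<le> k'' + 32" "a x (f j) \<noteq> v" for k''
        unfolding J_def
      proof (intro conjI)
        show "k \<le> k'' + 32 * (j + 1 - (c + 1))" using J' that by arith
        have "i = j \<or> i \<in> {m..<j}" if "i \<in> {m..<j + 1}" for i using that by auto
        then show "\<forall>i\<in>{m..<j + 1}. a x (f i) \<noteq> v"
          using J' that by blast
      qed (use J' j in auto)
      have b: "m + 1 \<le> B" "j + 1 \<le> B" "\<And>i. f i \<le> B"
        using J' j ce n bounded_arr[OF B] by (simp_all add: f_def)
      show "run B partition_body (k' - (cost ?b + 1)) s' I"
        unfolding partition_body_def
        by (intro run_intros)
          (use k' 1 2 b in \<open>simp_all add: r axj word_def bounded_reg bounded_arr I_def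
            flip: m_def j_def f_def\<close>)
    }
    {
      assume "val s' ?b = 0"
      then have je: "j = e" using r J' by (simp add: j_def split: if_splits)
      show "Q (k' - (cost ?b + 1)) s'"
      proof (rule Q)
        show "agree partition_loop s s'" using ag unfolding agree_def partition_loop_def by simp
        show "k \<le> k' - (cost ?b + 1) + (32 * (e - (c + 1)) + 4)" using J' je by simp linarith
      qed (use J' je B in \<open>auto simp: x_def v_def m_def f_def\<close>)
    }
  qed (simp add: word_def)
qed

section \<open>The queue of refinement tasks\<close>

definition push_task :: "nat \<Rightarrow> nat \<Rightarrow> nat \<Rightarrow> nat \<Rightarrow> com" where
  "push_task a b c d =
     Store a_pivot (Reg r_tail) (Reg a) ;;
     Store a_pivot_end (Reg r_tail) (Reg b) ;;
     Store a_target (Reg r_tail) (Reg c) ;;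
     Store a_target_end (Reg r_tail) (Reg d) ;;
     incr r_tail"

definition push_tasks :: com where
  "push_tasks =
     Store a_fin (Reg r_low) (Reg r_mid) ;;
     Store a_fin (Reg r_mid) (Reg r_high) ;;
     push_task r_low r_mid r_mid r_high ;;
     push_task r_mid r_high r_low r_mid"

definition task :: "ram \<Rightarrow> nat \<Rightarrow> nat \<times> nat \<times> nat \<times> nat" where
  "task s k = (arr s a_pivot k, arr s a_pivot_end k, arr s a_target k, arr s a_target_end k)"

lemma run_push_task:
  assumes "reg s r_tail + 1 \<le> B" and "16 \<le> k" and "r_tail \<notin> {a, b, c, d}"
    and Q: "\<And>k' s'. bounded B s' \<Longrightarrow> agree (push_task a b c d) s s' \<Longrightarrow> k \<le> k' + 16 \<Longrightarrow>
      reg s' r_tail = reg s r_tail + 1 \<Longrightarrow>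
      (\<And>i. task s' i =
        (if i = reg s r_tail then (reg s a, reg s b, reg s c, reg s d) else task s i)) \<Longrightarrow> Q k' s'"
  shows "run B (push_task a b c d) k s Q"
proof (rule run_mono)
  show "run B (push_task a b c d) k s (\<lambda>k' s'. k \<le> k' + 16 \<and> reg s' r_tail = reg s r_tail + 1 \<and>
      (\<forall>i. task s' i =
        (if i = reg s r_tail then (reg s a, reg s b, reg s c, reg s d) else task s i)))"
    unfolding push_task_def
    by (intro run_intros)
      (use assms(1-3) in \<open>simp_all add: word_def bounded_reg task_def\<close>)
qed (use Q in blast)

lemma run_push_tasks:
  assumes t: "reg s r_tail + 2 \<le> B" and k: "38 \<le> k"
    and c: "reg s r_low = c" "reg s r_mid = m" "reg s r_high = e"
    and Q: "\<And>k' s'. bounded B s' \<Longrightarrow> agree push_tasks s s' \<Longrightarrow> k \<le> k' + 38 \<Longrightarrow>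
      arr s' a_fin = (arr s a_fin)(c := m, m := e) \<Longrightarrow> reg s' r_tail = reg s r_tail + 2 \<Longrightarrow>
      (\<And>i. task s' i = (if i = reg s r_tail then (c, m, m, e)
        else if i = reg s r_tail + 1 then (m, e, c, m) else task s i)) \<Longrightarrow> Q k' s'"
  shows "run B push_tasks k s Q"
proof (rule run_mono)
  let ?R = "\<lambda>k' s'. k \<le> k' + 38 \<and>
      arr s' a_fin = (arr s a_fin)(c := m, m := e) \<and> reg s' r_tail = reg s r_tail + 2 \<and>
      (\<forall>i. task s' i = (if i = reg s r_tail then (c, m, m, e)
        else if i = reg s r_tail + 1 then (m, e, c, m) else task s i))"
  let ?s = "s\<lparr>arr := (arr s)(a_fin := (arr s a_fin)(c := m, m := e))\<rparr>"
  have "run B (push_task r_low r_mid r_mid r_high ;; push_task r_mid r_high r_low r_mid) (k - 6) ?s ?R"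
  proof (rule run_Seq, rule run_push_task)
    fix k1 s1
    assume ag1: "agree (push_task r_low r_mid r_mid r_high) ?s s1" and k1: "k - 6 \<le> k1 + 16"
      and t1: "reg s1 r_tail = reg ?s r_tail + 1"
        "\<And>i. task s1 i = (if i = reg ?s r_tail then
          (reg ?s r_low, reg ?s r_mid, reg ?s r_mid, reg ?s r_high) else task ?s i)"
    have s1: "reg s1 r_low = c" "reg s1 r_mid = m" "reg s1 r_high = e"
      "arr s1 a_fin = (arr s a_fin)(c := m, m := e)"
      using ag1 c unfolding agree_def push_task_def by simp_all
    show "run B (push_task r_mid r_high r_low r_mid) k1 s1 ?R"
    proof (rule run_push_task)
      fix k2 s2
      assume ag2: "agree (push_task r_mid r_high r_low r_mid) s1 s2" and k2: "k1 \<le> k2 + 16"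
        and t2: "reg s2 r_tail = reg s1 r_tail + 1"
          "\<And>i. task s2 i = (if i = reg s1 r_tail then
            (reg s1 r_mid, reg s1 r_high, reg s1 r_low, reg s1 r_mid) else task s1 i)"
      have "arr s2 a_fin = (arr s a_fin)(c := m, m := e)"
        using ag2 s1 unfolding agree_def push_task_def by simp
      moreover have "task ?s i = task s i" for i by (simp add: task_def)
      ultimately show "?R k2 s2"
        using k1 k2 k t1 t2 s1 c by auto
    qed (use t k1 k t1 in simp_all)
  qed (use t k in simp_all)
  moreover have b: "bounded B s \<Longrightarrow> m \<le> B" "bounded B s \<Longrightarrow> e \<le> B"
    using c bounded_reg by blast+
  moreover define rest where
    "rest = (push_task r_low r_mid r_mid r_high ;; push_task r_mid r_high r_low r_mid)"
  ultimately show "run B push_tasks k s ?R"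
    unfolding push_tasks_def
    by (fold rest_def, intro run_Seq run_Store) (use c k b in \<open>simp_all add: word_def bounded_reg\<close>)
qed (use Q in blast)

section \<open>Tasks as sets of pairs of positions, and the invariant of refinement\<close>

fun task_pairs :: "nat \<times> nat \<times> nat \<times> nat \<Rightarrow> (nat \<times> nat) set" where
  "task_pairs (a, b, c, d) = {a..<b} \<times> {c..<d}"

fun task_weight :: "nat \<times> nat \<times> nat \<times> nat \<Rightarrow> nat" where
  "task_weight (a, b, c, d) = (b - a) * (d - c)"

text \<open>The bounds are starts or \<open>n\<close>, so both ranges are unions of current
  intervals. This survives every later cut; hence a task can be stored by positions once and for
  all, even if its cells are refined before it is executed.\<close>

fun task_ok :: "nat \<Rightarrow> nat \<Rightarrow> nat \<Rightarrow> nat set \<Rightarrow> nat \<times> nat \<times> nat \<times> nat \<Rightarrow> bool" where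
  "task_ok n p q S (a, b, c, d) \<longleftrightarrow>
     p \<le> a \<and> a < b \<and> b \<le> q \<and> p \<le> c \<and> c < d \<and> d \<le> q \<and> (b \<le> c \<or> d \<le> a) \<and>
     a \<in> S \<and> c \<in> S \<and> (b \<in> S \<or> b = n) \<and> (d \<in> S \<or> d = n)"

definition pending :: "nat \<Rightarrow> ram \<Rightarrow> (nat \<times> nat) set" where
  "pending h s = (\<Union>k\<in>{h..<reg s r_tail}. task_pairs (task s k))"

text \<open>
  Scanning costs at most \<open>71\<close> units per position, and a task with \<open>u\<close> pivots and \<open>w\<close> target
  positions at most \<open>112 u w\<close>. A split into parts of lengths \<open>u\<close> and \<open>w\<close> lowers the square weight
  by \<open>2 u w\<close> and creates tasks of total weight \<open>2 u w\<close>. The remaining \<open>2 \<cdot> 71 u w\<close> of the released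
  \<open>2 \<cdot> 183 u w\<close> units pay for scanning the interval, since \<open>u + w \<le> 2 u w\<close>.
\<close>

definition potential :: "nat \<Rightarrow> nat set \<Rightarrow> nat \<Rightarrow> ram \<Rightarrow> nat" where
  "potential n S h s =
     183 * square_weight n S + 112 * (\<Sum>k\<in>{h..<reg s r_tail}. task_weight (task s k))"

text \<open>\<open>P\<close> holds the pairs of the task being executed, \<open>pending h s\<close>
  those of the queue from \<open>h\<close> on. A cut adds one start and two tasks, whence
  \<open>reg s r_tail + 2 \<le> 2 * card S\<close>; this keeps the addresses in the queue below
  \<open>B\<close>.\<close>

definition refining ::
  "nat \<Rightarrow> nat \<Rightarrow> (nat \<Rightarrow> nat \<Rightarrow> nat) \<Rightarrow> nat \<Rightarrow> nat \<Rightarrow> nat set \<Rightarrow> (nat \<Rightarrow> nat) \<Rightarrow> nat set \<Rightarrow> nat \<Rightarrow>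
    (nat \<times> nat) set \<Rightarrow> ram \<Rightarrow> bool" where
  "refining B n a p q S0 f0 S h P s \<longleftrightarrow>
     2 * n + 2 \<le> B \<and> matrix_in n a s \<and>
     (\<forall>t\<in>S. arr s a_fin t = next_start n S t) \<and>
     h \<le> reg s r_tail \<and> reg s r_tail + 2 \<le> 2 * card S \<and>
     refined n a p q S0 f0 S (arr s a_perm) \<and>
     (\<forall>k\<in>{h..<reg s r_tail}. task_ok n p q S (task s k)) \<and>
     covered n a S (arr s a_perm) (P \<union> pending h s)"

lemma task_ok_mono: "task_ok n p q S t \<Longrightarrow> S \<subseteq> S' \<Longrightarrow> task_ok n p q S' t"
  by (cases t) auto

text \<open>The pivots of a task form a union of current intervals, so a pair stays pending when its
  first position moves within its interval. This supplies the hypothesis on \<open>P\<close> in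
  \<open>covered_split\<close> and \<open>covered_permute\<close>.\<close>

lemma pending_closed:
  assumes "refining B n a p q S0 f0 S h P s" and c: "c \<in> S"
    and i: "i \<in> interval n S c" "i' \<in> interval n S c" and "(i, j) \<in> pending h s"
  shows "(i', j) \<in> pending h s"
proof -
  note A = assms(1)[unfolded refining_def]
  have S: "S \<subseteq> {..<n}" using A refinedD(3) by blast
  obtain k where k: "k \<in> {h..<reg s r_tail}" "(i, j) \<in> task_pairs (task s k)"
    using assms(5) unfolding pending_def by blast
  obtain u v w z where t: "task s k = (u, v, w, z)" by (cases "task s k")
  have ok: "task_ok n p q S (u, v, w, z)" using A k(1) unfolding t[symmetric] by blast
  have "i \<in> {u..<v}" "j \<in> {w..<z}" using k(2) t by auto
  then have "u \<le> c \<and> c < v"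
    using interval_inter_empty[OF S c, of u v] ok i(1) by auto
  then have "i' \<in> {u..<v}"
    using interval_subset_of_mem[OF S c, of u v] ok i(2) by auto
  then show ?thesis unfolding pending_def using k t \<open>j \<in> {w..<z}\<close> by force
qed

text \<open>Only the class of the first element is split off. The next iteration starts at
  \<open>r_mid\<close> and treats the rest as a cell of its own, so repetition separates all classes
  of the pivot. Without a cut \<open>r_mid\<close> is the end of the cell and the next cell
  follows.\<close>

definition part_body :: com where
  "part_body =
     Set r_high (Cell a_fin (Reg r_low)) ;;
     Set r_val (mat (Reg r_elem) (Cell a_perm (Reg r_low))) ;;
     Set r_mid (Add (Reg r_low) (Lit 1)) ;;
     Set r_scan (Add (Reg r_low) (Lit 1)) ;;
     partition_loop ;;
     Cond (Less (Reg r_mid) (Reg r_high)) push_tasks Skip ;;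
     Set r_low (Reg r_mid)"

definition part_loop :: com where
  "part_loop = While (Less (Reg r_low) (Reg r_target_end)) part_body"

lemma pending_push:
  assumes "h \<le> reg s r_tail" "reg s' r_tail = reg s r_tail + 2"
    and "\<And>i. task s' i = (if i = reg s r_tail then (c, m, m, e)
        else if i = reg s r_tail + 1 then (m, e, c, m) else task s i)"
  shows "pending h s' = pending h s \<union> {c..<m} \<times> {m..<e} \<union> {m..<e} \<times> {c..<m}"
    and "(\<Sum>k\<in>{h..<reg s' r_tail}. task_weight (task s' k)) =
      (\<Sum>k\<in>{h..<reg s r_tail}. task_weight (task s k)) + 2 * (m - c) * (e - m)"
proof -
  have iv: "{h..<reg s' r_tail} = insert (reg s r_tail) (insert (reg s r_tail + 1) {h..<reg s r_tail})"
    using assms(1,2) by auto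
  have old: "task s' i = task s i" if "i \<in> {h..<reg s r_tail}" for i
    using assms(3) that by auto
  show "pending h s' = pending h s \<union> {c..<m} \<times> {m..<e} \<union> {m..<e} \<times> {c..<m}"
    unfolding pending_def iv using old by (auto simp: assms(3))
  show "(\<Sum>k\<in>{h..<reg s' r_tail}. task_weight (task s' k)) =
      (\<Sum>k\<in>{h..<reg s r_tail}. task_weight (task s k)) + 2 * (m - c) * (e - m)"
    unfolding iv using old by (simp add: assms(3))
qed

text \<open>No pivot of \<open>P\<close> lies in the cell, so permuting the cell does not disturb
  \<open>P\<close>. With u and w the lengths of the halves, the weight releases 183 * 2uw units, the
  two new tasks store 112 * 2uw of them, and 142uw remain.\<close>

lemma refining_split:
  assumes ref: "refining B n a p q S0 f0 S h P s" and S': "S' = insert m S"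
    and c: "c \<in> S" "c < m" "m < next_start n S c" "next_start n S c = e"
    and pq: "p \<le> c" "e \<le> q"
    and mat: "matrix_in n a s'"
    and fin: "arr s' a_fin = (arr s a_fin)(c := m, m := e)"
    and tl: "reg s' r_tail = reg s r_tail + 2"
    and tk: "\<And>i. task s' i = (if i = reg s r_tail then (c, m, m, e)
        else if i = reg s r_tail + 1 then (m, e, c, m) else task s i)"
    and bij: "bij_betw (arr s' a_perm) {..<n} {..<n}"
    and f: "\<And>i. i \<notin> {c..<e} \<Longrightarrow> arr s' a_perm i = arr s a_perm i"
      "arr s' a_perm ` {c..<e} = arr s a_perm ` {c..<e}"
    and x: "x < n" "x \<notin> arr s a_perm ` {c..<e}"
    and sp: "\<And>i. i \<in> {c..<m} \<Longrightarrow> a x (arr s' a_perm i) = v"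
      "\<And>i. i \<in> {m..<e} \<Longrightarrow> a x (arr s' a_perm i) \<noteq> v"
    and P: "fst ` P \<inter> {c..<e} = {}"
  shows "refining B n a p q S0 f0 S' h P s'"
    and "potential n S' h s' + 142 * (m - c) * (e - m) = potential n S h s"
proof -
  note A = ref[unfolded refining_def]
  have A1: "refined n a p q S0 f0 S (arr s a_perm)" using A by blast
  note R = refinedD[OF A1]
  have S: "S \<subseteq> {..<n}" and finS: "finite S" using R(3) finite_subset by blast+
  have cn: "c < n" using S c by auto
  have mn: "m < n" using next_start[OF cn, of S] c by linarith
  have mS: "m \<notin> S" using next_start_le[of c m S n] c by auto
  have e: "e \<in> S \<or> e = n" using next_start[OF cn, of S] c by auto
  have h: "h \<le> reg s r_tail" using A by blast
  note pp = pending_push[OF h tl tk]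
  have nc: "next_start n S' c = m" using next_start_insert[OF cn mn, of S] c S' by simp
  have nm: "next_start n S' m = e"
    using next_start_insert[OF mn mn, of S] next_start_interior[OF cn c(2,3)] S' c by simp
  have nt: "next_start n S' t = next_start n S t" if "t \<in> S" "t \<noteq> c" for t
  proof -
    have "interval n S t \<inter> interval n S c = {}" using interval_disjoint[of t S c n] that c by blast
    moreover have "m \<in> interval n S c" using c by simp
    ultimately have "\<not> (t < m \<and> m < next_start n S t)" by auto
    then show ?thesis using next_start_insert[of t n m S] that S mn S' by auto
  qed
  note f' = f[folded c(4)] and x' = x[folded c(4)] and sp' = sp[folded c(4)]
  have ref': "refined n a p q S (arr s a_perm) S' (arr s' a_perm)"
    unfolding S'
  proof (rule refined_split[where x = x and v = v])
    show "\<And>i. i \<notin> interval n S c \<Longrightarrow> arr s' a_perm i = arr s a_perm i"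
      "arr s' a_perm ` interval n S c = arr s a_perm ` interval n S c"
      "x \<notin> arr s a_perm ` interval n S c"
      "\<And>i. i \<in> {c..<m} \<Longrightarrow> a x (arr s' a_perm i) = v"
      "\<And>i. i \<in> {m..<next_start n S c} \<Longrightarrow> a x (arr s' a_perm i) \<noteq> v"
      by (fact f' x' sp')+
  qed (use S c pq R(4) bij x in simp_all)
  have cov: "covered n a S' (arr s' a_perm) (P \<union> pending h s')"
    unfolding S'
  proof (rule covered_split[OF S c(1-3) f'])
    show "covered n a S (arr s a_perm) (P \<union> pending h s)" using A by blast
    show "(i', j) \<in> P \<union> pending h s" if "i \<in> interval n S c" "i' \<in> interval n S c"
      "(i, j) \<in> P \<union> pending h s" for i i' j
      using pending_closed[OF ref c(1) that(1,2)] that P c(4) by force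
    show "{c..<m} \<times> {m..<next_start n S c} \<subseteq> P \<union> pending h s'"
      "{m..<next_start n S c} \<times> {c..<m} \<subseteq> P \<union> pending h s'"
      "P \<union> pending h s \<subseteq> P \<union> pending h s'"
      unfolding pp(1) c(4) by blast+
  qed
  have ok: "task_ok n p q S' (task s' k)" if k: "k \<in> {h..<reg s' r_tail}" for k
  proof (cases "k < reg s r_tail")
    case True
    then have "task_ok n p q S (task s k)" using A k by simp
    from task_ok_mono[OF this, of S'] show ?thesis using True S' by (auto simp: tk)
  next
    case False
    then have "k = reg s r_tail \<or> k = reg s r_tail + 1" using k tl by auto
    then show ?thesis using c e pq S' by (auto simp: tk)
  qed
  have fin': "arr s' a_fin t = next_start n S' t" if "t \<in> S'" for t
    using that A nc nm nt c S' unfolding fin by auto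
  have card: "reg s' r_tail + 2 \<le> 2 * card S'"
    using A tl finS mS S' by simp
  show "refining B n a p q S0 f0 S' h P s'"
    unfolding refining_def
    using A refined_trans[OF A1 ref'] mat fin' tl card ok cov by simp
  show "potential n S' h s' + 142 * (m - c) * (e - m) = potential n S h s"
    using square_weight_insert[OF S c(1-3)] unfolding potential_def pp(2) S' c(4) by simp
qed

lemma refining_permute:
  assumes ref: "refining B n a p q S0 f0 S h P s"
    and c: "c \<in> S" "next_start n S c = e"
    and mat: "matrix_in n a s'"
    and fin: "arr s' a_fin = arr s a_fin"
    and tl: "reg s' r_tail = reg s r_tail"
    and tk: "\<And>i. task s' i = task s i"
    and bij: "bij_betw (arr s' a_perm) {..<n} {..<n}"
    and f: "\<And>i. i \<notin> {c..<e} \<Longrightarrow> arr s' a_perm i = arr s a_perm i"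
      "arr s' a_perm ` {c..<e} = arr s a_perm ` {c..<e}"
    and P: "fst ` P \<inter> {c..<e} = {}"
  shows "refining B n a p q S0 f0 S h P s'" and "potential n S h s' = potential n S h s"
proof -
  note A = ref[unfolded refining_def]
  have A1: "refined n a p q S0 f0 S (arr s a_perm)" using A by blast
  note R = refinedD[OF A1]
  note f' = f[folded c(2)]
  have pe: "pending h s' = pending h s" unfolding pending_def tl tk ..
  have "covered n a S (arr s' a_perm) (P \<union> pending h s)"
  proof (rule covered_permute[OF R(3) c(1) f'])
    show "covered n a S (arr s a_perm) (P \<union> pending h s)" using A by blast
    show "(i', j) \<in> P \<union> pending h s" if "i \<in> interval n S c" "i' \<in> interval n S c"
      "(i, j) \<in> P \<union> pending h s" for i i' j
      using pending_closed[OF ref c(1) that(1,2)] that P c(2) by force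
  qed
  then show "refining B n a p q S0 f0 S h P s'"
    unfolding refining_def pe
    using A mat fin tl tk refined_trans[OF A1 refined_permute[OF R(3) c(1) bij f']] by simp
  show "potential n S h s' = potential n S h s"
    unfolding potential_def tl tk ..
qed

lemma refining_done:
  assumes ref: "refining B n a p q S0 f0 S h P s" and "P \<subseteq> P' \<union> {i} \<times> interval n S c" and "c \<in> S"
    and "uniform a (arr s a_perm i) (arr s a_perm ` interval n S c)"
  shows "refining B n a p q S0 f0 S h P' s"
proof -
  have "covered n a S (arr s a_perm) (P \<union> pending h s)"
    using ref unfolding refining_def by blast
  then have "covered n a S (arr s a_perm) (P' \<union> pending h s)"
    by (rule covered_done[where i = i and c = c]) (use assms in auto)
  then show ?thesis using ref unfolding refining_def by simp
qed

text \<open>71 is the cost of a body that cuts, apart from the iterations of the partition loop: 4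
  for the guard of \<open>part_loop\<close>, 19 for the assignments, 4 for the last guard of the
  partition loop, 4 for the test, 38 for \<open>push_tasks\<close> and 2 for the last assignment.
  Every position of the cell but the first adds only 32, so 71 units per position suffice. The
  \<open>+ 4\<close> on the credits stands for the guard of \<open>part_loop\<close>, which has been
  paid already.\<close>

lemma run_part_body:
  assumes ref: "refining B n a p q S0 f0 S h ({i} \<times> {c..<d} \<union> R) s"
    and c: "c \<in> S" "c < d" "d \<in> S \<or> d = n" "p \<le> c" "d \<le> q"
    and i: "i < n" "i \<notin> {c..<d}" "\<And>i j. (i, j) \<in> R \<Longrightarrow> i \<notin> {c..<d}"
    and r: "reg s r_low = c" "reg s r_elem = arr s a_perm i" "reg s r_target_end = d"
    and k: "potential n S h s + 71 * (d - c) + r \<le> k + 4"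
    and Q: "\<And>k' s' S'. bounded B s' \<Longrightarrow> agree part_body s s' \<Longrightarrow> c < reg s' r_low \<Longrightarrow>
      reg s' r_low \<le> d \<Longrightarrow> reg s' r_low \<in> S' \<or> reg s' r_low = d \<Longrightarrow>
      refining B n a p q S0 f0 S' h ({i} \<times> {reg s' r_low..<d} \<union> R) s' \<Longrightarrow>
      S \<subseteq> S' \<Longrightarrow> arr s' a_perm i = arr s a_perm i \<Longrightarrow>
      potential n S' h s' + 71 * (d - reg s' r_low) + r \<le> k' \<Longrightarrow> Q k' s'"
  shows "run B part_body k s Q"
proof -
  note A = ref[unfolded refining_def]
  have A1: "refined n a p q S0 f0 S (arr s a_perm)" using A by blast
  note D = refinedD[OF A1]
  define e where "e = next_start n S c"
  have cn: "c < n" using D(3) c(1) by auto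
  have ce: "c < e" "e \<le> n" "e \<in> S \<or> e = n" using next_start[OF cn, of S] e_def by auto
  have dn: "d \<le> n" using c(3) D(3) by auto
  have ed: "e \<le> d" using next_start_le[OF c(2,3)] e_def by simp
  define x where "x = arr s a_perm i"
  have xn: "x < n" using bij_betw_lessThan[OF D(4) i(1)] x_def by simp
  have fc: "arr s a_perm c < n" using bij_betw_lessThan[OF D(4) cn] .
  have nB: "2 * n + 2 \<le> B" using A by blast
  have xc: "x \<notin> arr s a_perm ` {c..<e}"
  proof
    assume "x \<in> arr s a_perm ` {c..<e}"
    then obtain j where "j \<in> {c..<e}" "arr s a_perm j = arr s a_perm i" using x_def by auto
    moreover have "j < n" using calculation ce by auto
    ultimately have "j = i" using D(4) i(1) unfolding bij_betw_def inj_on_def by auto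
    then show False using i(2) \<open>j \<in> {c..<e}\<close> ed by auto
  qed
  have mat: "matrix_in n a s" using A by blast
  have s: "reg s r_order = n" "arr s a_fin c = e" "arr s a_mat (x * n + arr s a_perm c) = a x (arr s a_perm c)"
    using A c(1) xn fc unfolding matrix_in_def e_def by auto
  define v where "v = a x (arr s a_perm c)"
  have vB: "v \<le> B" if "bounded B s"
    using bounded_arr[OF that, of a_mat "x * n + arr s a_perm c"] s v_def by simp
  have eB: "e \<le> B" "c + 1 \<le> B" using ce nB cn by auto
  have PR: "fst ` ({i} \<times> {c..<d} \<union> R) \<inter> {c..<e} = {}"
    using i ed by fastforce
  have kl: "potential n S h s + 71 * (d - e) + 71 * (e - c) + r \<le> k + 4" using k ce ed by simp
  define rest where "rest = (Cond (Less (Reg r_mid) (Reg r_high)) push_tasks Skip ;; Set r_low (Reg r_mid))"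
  have k67: "67 \<le> k" using kl ce by linarith
  have card: "card S \<le> n" using D(3) card_mono[of "{..<n}" S] by simp
  let ?s = "s\<lparr>reg := (reg s)(r_high := e, r_val := v, r_mid := c + 1, r_scan := c + 1)\<rparr>"
  have "run B partition_loop (k - 19) ?s (\<lambda>k s. run B rest k s Q)"
  proof (rule run_partition_loop)
    show "n \<le> B" "c < e" "e \<le> n" "matrix_in n a ?s" "reg ?s r_elem < n" "reg ?s r_mid = c + 1"
      "reg ?s r_scan = c + 1" "reg ?s r_high = e"
      "bij_betw (arr ?s a_perm) {..<n} {..<n}" "a (reg ?s r_elem) (arr ?s a_perm c) = reg ?s r_val"
      using nB ce mat r xn D(4) by (simp_all add: matrix_in_def x_def v_def)
    show "32 * (e - (c + 1)) + 4 \<le> k - 19"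
      using kl ce by linarith
    fix k1 s1
    assume B1: "bounded B s1" and ag1: "agree partition_loop ?s s1"
      and k1: "k - 19 \<le> k1 + (32 * (e - (c + 1)) + 4)"
      and m: "c < reg s1 r_mid" "reg s1 r_mid \<le> e"
      and bij: "bij_betw (arr s1 a_perm) {..<n} {..<n}"
      and f: "\<And>i. i \<notin> {c..<e} \<Longrightarrow> arr s1 a_perm i = arr ?s a_perm i"
        "arr s1 a_perm ` {c..<e} = arr ?s a_perm ` {c..<e}"
      and sp: "\<And>i. i \<in> {c..<reg s1 r_mid} \<Longrightarrow> a (reg ?s r_elem) (arr s1 a_perm i) = reg ?s r_val"
        "\<And>i. i \<in> {reg s1 r_mid..<e} \<Longrightarrow> a (reg ?s r_elem) (arr s1 a_perm i) \<noteq> reg ?s r_val"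
    define m where "m = reg s1 r_mid"
    note f = f[simplified] and sp = sp[simplified, unfolded r(2), folded x_def m_def]
      and m = m[folded m_def]
    have s1: "reg s1 r_high = e" "reg s1 r_low = c" "reg s1 r_elem = x" "reg s1 r_tail = reg s r_tail"
      "arr s1 a_fin = arr s a_fin" "\<And>i. task s1 i = task s i" "matrix_in n a s1" "reg s1 r_target_end = d"
      using ag1 r x_def mat unfolding agree_def partition_loop_def partition_body_def task_def matrix_in_def
      by simp_all
    have fi: "arr s1 a_perm i = x" using f(1)[of i] i ed x_def by auto
    show "run B rest k1 s1 Q"
    proof (cases "m < e")
      case False
      then have me: "m = e" using m by simp
      let ?s2 = "s1\<lparr>reg := (reg s1)(r_low := m)\<rparr>"
      have kk: "7 \<le> k1" "potential n S h s + 71 * (d - m) + r \<le> k1 - 7"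
        using k1 kl me ce by linarith+
      have "Q (k1 - 7) ?s2"
      proof (rule Q)
        show "bounded B ?s2" using B1 me eB by (simp add: bounded_def)
        show "agree part_body s ?s2"
          using ag1 unfolding agree_def part_body_def partition_loop_def partition_body_def by simp
        have ref2: "refining B n a p q S0 f0 S h ({i} \<times> {c..<d} \<union> R) ?s2"
          and pot: "potential n S h ?s2 = potential n S h s"
          by (rule refining_permute[OF ref c(1) e_def[symmetric] _ _ _ _ _ _ _ PR],
            use s1 bij f in \<open>simp_all add: matrix_in_def task_def\<close>)+
        have u: "uniform a (arr ?s2 a_perm i) (arr ?s2 a_perm ` interval n S c)"
          using sp(1) fi me unfolding uniform_def e_def[symmetric] by auto
        show "refining B n a p q S0 f0 S h ({i} \<times> {reg ?s2 r_low..<d} \<union> R) ?s2"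
          by (rule refining_done[OF ref2 _ c(1) u]) (use me e_def in auto)
        show "potential n S h ?s2 + 71 * (d - reg ?s2 r_low) + r \<le> k1 - 7"
          using kk pot by simp
      qed (use me ce ed dn c fi x_def in auto)
      then show ?thesis
        unfolding rest_def
        by (intro run_intros) (use s1 me kk eB in \<open>simp_all add: word_def m_def[symmetric]\<close>)
    next
      case True
      \<comment> \<open>The scanning budget gives up only the \<open>71 * u\<close> units of the
        first half, as the second half is scanned again; the surplus of \<open>142 * (u * w)\<close>
        units from the weight covers the rest.\<close>
      define u where "u = m - c"
      define w where "w = e - m"
      have uw: "m = c + u" "e = c + u + w" "1 \<le> u" "1 \<le> w"
        using m True unfolding u_def w_def by auto
      have uw': "u \<le> u * w" "w \<le> u * w" using uw by simp_all
      have kl': "potential n S h s + 71 * (d - e) + 71 * u + 71 * w + r \<le> k + 4"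
        using kl uw by simp
      have k1': "k \<le> k1 + 32 * u + 32 * w - 9" using k1 uw k67 by simp
      have k1'': "44 \<le> k1" using kl' k1 uw by simp
      have "run B push_tasks (k1 - 4) s1 (\<lambda>k s. run B (Set r_low (Reg r_mid)) k s Q)"
      proof (rule run_push_tasks[where c = c and m = m and e = e])
        show "reg s1 r_tail + 2 \<le> B" using A card s1 nB by simp
        show "38 \<le> k1 - 4" using k1'' by simp
        show "reg s1 r_low = c" "reg s1 r_mid = m" "reg s1 r_high = e"
          using s1 m_def by simp_all
        fix k2 s2
        assume B2: "bounded B s2" and ag2: "agree push_tasks s1 s2" and k2: "k1 - 4 \<le> k2 + 38"
          and fin2: "arr s2 a_fin = (arr s1 a_fin)(c := m, m := e)"
          and tl2: "reg s2 r_tail = reg s1 r_tail + 2"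
          and tk2: "\<And>i. task s2 i = (if i = reg s1 r_tail then (c, m, m, e)
            else if i = reg s1 r_tail + 1 then (m, e, c, m) else task s1 i)"
        let ?s3 = "s2\<lparr>reg := (reg s2)(r_low := m)\<rparr>"
        have s2: "arr s2 a_perm = arr s1 a_perm" "matrix_in n a s2" "reg s2 r_mid = m"
          using ag2 s1 m_def unfolding agree_def push_tasks_def push_task_def matrix_in_def by simp_all
        have "Q (k2 - 2) ?s3"
        proof (rule Q)
          show "bounded B ?s3" using B2 m True eB by (simp add: bounded_def)
          show "agree part_body s ?s3"
            using ag1 ag2 unfolding agree_def part_body_def partition_loop_def partition_body_def
              push_tasks_def push_task_def by simp
          have m': "m < next_start n S c" "e \<le> q" using True e_def c ed by simp_all
          have 3: "matrix_in n a ?s3" "arr ?s3 a_fin = (arr s a_fin)(c := m, m := e)"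
            "reg ?s3 r_tail = reg s r_tail + 2" "bij_betw (arr ?s3 a_perm) {..<n} {..<n}"
            "arr ?s3 a_perm ` {c..<e} = arr s a_perm ` {c..<e}"
            using s2 s1 fin2 tl2 bij f(2) by (simp_all add: matrix_in_def)
          have tk3: "task ?s3 i = (if i = reg s r_tail then (c, m, m, e)
            else if i = reg s r_tail + 1 then (m, e, c, m) else task s i)" for i
            using tk2[of i] s1 by (simp add: task_def)
          have f3: "\<And>i. i \<notin> {c..<e} \<Longrightarrow> arr ?s3 a_perm i = arr s a_perm i"
            "\<And>i. i \<in> {c..<m} \<Longrightarrow> a x (arr ?s3 a_perm i) = v"
            "\<And>i. i \<in> {m..<e} \<Longrightarrow> a x (arr ?s3 a_perm i) \<noteq> v"
            using s2(1) f(1) sp v_def by simp_all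
          note split = refining_split[OF ref refl c(1) m(1) m'(1) e_def[symmetric] c(4) m'(2)
              3(1,2,3) tk3 3(4) f3(1) 3(5) xn xc f3(2,3) PR]
          note S = split(1)
          show "refining B n a p q S0 f0 (insert m S) h ({i} \<times> {reg ?s3 r_low..<d} \<union> R) ?s3"
          proof (rule refining_done[OF S, where i = i and c = c])
            have "next_start n (insert m S) c = m"
              using next_start_insert[OF cn, of m S] m True ce e_def by simp
            then show "uniform a (arr ?s3 a_perm i) (arr ?s3 a_perm ` interval n (insert m S) c)"
              "{i} \<times> {c..<d} \<union> R \<subseteq> {i} \<times> {reg ?s3 r_low..<d} \<union> R \<union> {i} \<times> interval n (insert m S) c"
              using sp(1) fi s2 unfolding uniform_def by auto
            show "c \<in> insert m S" using c(1) by simp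
          qed
          have "potential n (insert m S) h ?s3 + 142 * (u * w) = potential n S h s"
            using split(2) unfolding u_def w_def mult.assoc .
          moreover have "d - m = d - e + w" using ed uw by simp
          ultimately have "potential n (insert m S) h ?s3 + 71 * (d - m) + r \<le> k2 - 2"
            using kl' k1' k2 k1'' uw(3,4) uw' by linarith
          then show "potential n (insert m S) h ?s3 + 71 * (d - reg ?s3 r_low) + r \<le> k2 - 2"
            by simp
        qed (use m True ed c fi x_def s2 in auto)
        then show "run B (Set r_low (Reg r_mid)) k2 s2 Q"
          by (intro run_Set) (use s2 k2 k1'' m eB in \<open>simp_all add: bounded_reg\<close>)
      qed
      then show ?thesis
        unfolding rest_def
        by (intro run_Seq run_Cond) (use s1 True k1'' in \<open>simp_all add: m_def[symmetric]\<close>)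
    qed
  qed
  then show ?thesis
    unfolding part_body_def
    by (fold rest_def, intro run_Seq run_Set)
      (use s r k67 x_def v_def vB eB in \<open>simp_all add: word_def bounded_reg run_Seq\<close>)
qed

lemma run_part_loop:
  assumes ref: "refining B n a p q S0 f0 S h ({i} \<times> {c..<d} \<union> R) s"
    and c: "c \<in> S" "c < d" "d \<in> S \<or> d = n" "p \<le> c" "d \<le> q"
    and i: "i < n" "i \<notin> {c..<d}" "\<And>i j. (i, j) \<in> R \<Longrightarrow> i \<notin> {c..<d}"
    and r: "reg s r_low = c" "reg s r_elem = arr s a_perm i" "reg s r_target_end = d"
    and k: "potential n S h s + 71 * (d - c) + 4 + r \<le> k"
    and Q: "\<And>k' s' S'. bounded B s' \<Longrightarrow> agree part_loop s s' \<Longrightarrow>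
      refining B n a p q S0 f0 S' h R s' \<Longrightarrow> S \<subseteq> S' \<Longrightarrow> potential n S' h s' + r \<le> k' \<Longrightarrow> Q k' s'"
  shows "run B part_loop k s Q"
proof -
  define I where "I k' s' \<longleftrightarrow> (\<exists>S'. S \<subseteq> S' \<and> c \<le> reg s' r_low \<and> reg s' r_low \<le> d \<and>
      (reg s' r_low \<in> S' \<or> reg s' r_low = d) \<and>
      refining B n a p q S0 f0 S' h ({i} \<times> {reg s' r_low..<d} \<union> R) s' \<and>
      arr s' a_perm i = arr s a_perm i \<and>
      potential n S' h s' + 71 * (d - reg s' r_low) + 4 + r \<le> k')" for k' and s' :: ram
  let ?b = "Less (Reg r_low) (Reg r_target_end)"
  show ?thesis
    unfolding part_loop_def
  proof (rule run_While[where I = I])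
    show "I k s"
      unfolding I_def using assms by (intro exI[of _ S]) simp
    fix k' s'
    assume ag: "agree part_body s s'" and B: "bounded B s'" and I: "I k' s'"
    obtain S' where S': "S \<subseteq> S'" "c \<le> reg s' r_low" "reg s' r_low \<le> d"
      "reg s' r_low \<in> S' \<or> reg s' r_low = d"
      "refining B n a p q S0 f0 S' h ({i} \<times> {reg s' r_low..<d} \<union> R) s'"
      "arr s' a_perm i = arr s a_perm i"
      "potential n S' h s' + 71 * (d - reg s' r_low) + 4 + r \<le> k'"
      using I unfolding I_def by blast
    show "cost ?b + 1 \<le> k'" using S'(7) by simp
    have s': "reg s' r_elem = arr s a_perm i" "reg s' r_target_end = d"
      using ag r unfolding agree_def part_body_def partition_loop_def partition_body_def
        push_tasks_def push_task_def by simp_all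
    {
      assume "val s' ?b \<noteq> 0"
      then have lt: "reg s' r_low < d" using s' by (simp split: if_splits)
      show "run B part_body (k' - (cost ?b + 1)) s' I"
      proof (rule run_part_body[where r = "r + 4", OF S'(5)])
        fix k2 s2 S2
        assume "S' \<subseteq> S2" "reg s' r_low < reg s2 r_low" "reg s2 r_low \<le> d"
          "reg s2 r_low \<in> S2 \<or> reg s2 r_low = d"
          "refining B n a p q S0 f0 S2 h ({i} \<times> {reg s2 r_low..<d} \<union> R) s2"
          "arr s2 a_perm i = arr s' a_perm i"
          "potential n S2 h s2 + 71 * (d - reg s2 r_low) + (r + 4) \<le> k2"
        then show "I k2 s2"
          unfolding I_def using S' by (intro exI[of _ S2]) auto
      next
        show "(i', j) \<in> R \<Longrightarrow> i' \<notin> {reg s' r_low..<d}" for i' j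
          using i(3)[of i' j] S'(2) by auto
      qed (use S' c i lt s' in auto)
    }
    {
      assume "val s' ?b = 0"
      then have "reg s' r_low = d" using s' S' by (simp split: if_splits)
      then show "Q (k' - (cost ?b + 1)) s'"
        using S' ag B by (intro Q[of _ S']) (simp_all add: agree_def part_loop_def)
    }
  qed simp
qed

section \<open>From a single pivot to a whole task and the whole queue\<close>

definition pivot_body :: com where
  "pivot_body =
     Set r_elem (Cell a_perm (Reg r_pivot)) ;;
     Set r_low (Reg r_target) ;;
     part_loop ;;
     incr r_pivot"

definition pivot_loop :: com where
  "pivot_loop = While (Less (Reg r_pivot) (Reg r_pivot_end)) pivot_body"

lemmas refine_written = pivot_body_def part_loop_def part_body_def partition_loop_def
  partition_body_def push_tasks_def push_task_def

lemma refining_cong: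
  assumes "reg s' r_order = reg s r_order" and "reg s' r_tail = reg s r_tail" and "arr s' = arr s"
  shows "refining B n a p q S0 f0 S h P s' \<longleftrightarrow> refining B n a p q S0 f0 S h P s"
    and "potential n S h s' = potential n S h s"
  using assms unfolding refining_def potential_def pending_def task_def matrix_in_def by simp_all

text \<open>A pivot spends 71 units per target position and 17 on guards and assignments, hence at
  most 88 per pair, the target being non-empty. The pivots are disjoint from the target, so cutting
  the target does not move them.\<close>

lemma run_pivot_loop:
  assumes ref: "refining B n a p q S0 f0 S h (task_pairs (i, i', c, d)) s"
    and ok: "task_ok n p q S (i, i', c, d)" and q: "q \<le> n"
    and r: "reg s r_pivot = i" "reg s r_pivot_end = i'" "reg s r_target = c" "reg s r_target_end = d"
    and k: "potential n S h s + 88 * task_weight (i, i', c, d) + 4 + r \<le> k"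
    and Q: "\<And>k' s' S'. bounded B s' \<Longrightarrow> agree pivot_loop s s' \<Longrightarrow>
      refining B n a p q S0 f0 S' h {} s' \<Longrightarrow> potential n S' h s' + r \<le> k' \<Longrightarrow> Q k' s'"
  shows "run B pivot_loop k s Q"
proof -
  define I where "I k' s' \<longleftrightarrow> (\<exists>S'. S \<subseteq> S' \<and> i \<le> reg s' r_pivot \<and> reg s' r_pivot \<le> i' \<and>
      refining B n a p q S0 f0 S' h (task_pairs (reg s' r_pivot, i', c, d)) s' \<and>
      potential n S' h s' + 88 * task_weight (reg s' r_pivot, i', c, d) + 4 + r \<le> k')" for k' and s' :: ram
  let ?b = "Less (Reg r_pivot) (Reg r_pivot_end)"
  show ?thesis
    unfolding pivot_loop_def
  proof (rule run_While[where I = I])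
    show "I k s"
      unfolding I_def using assms by (intro exI[of _ S]) simp
    fix k' s'
    assume ag: "agree pivot_body s s'" and B: "bounded B s'" and I: "I k' s'"
    define j where "j = reg s' r_pivot"
    obtain S' where S': "S \<subseteq> S'" "i \<le> j" "j \<le> i'"
      "refining B n a p q S0 f0 S' h (task_pairs (j, i', c, d)) s'"
      "potential n S' h s' + 88 * task_weight (j, i', c, d) + 4 + r \<le> k'"
      using I unfolding I_def j_def by blast
    show "cost ?b + 1 \<le> k'" using S'(5) by simp
    have s': "reg s' r_pivot_end = i'" "reg s' r_target = c" "reg s' r_target_end = d"
      using ag r unfolding agree_def refine_written by simp_all
    have ok': "task_ok n p q S' (i, i', c, d)" using task_ok_mono[OF ok S'(1)] .
    have nB: "2 * n + 2 \<le> B" using ref unfolding refining_def by blast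
    {
      assume "val s' ?b \<noteq> 0"
      then have lt: "j < i'" using s' by (simp add: j_def split: if_splits)
      then obtain l where l: "i' = j + 1 + l" using le_Suc_ex[of "j + 1" i'] by auto
      define t where "t = d - c"
      have t: "1 \<le> t" using ok unfolding t_def by simp linarith
      let ?s = "s'\<lparr>reg := (reg s')(r_elem := arr s' a_perm j, r_low := c)\<rparr>"
      have pairs: "task_pairs (j, i', c, d) = {j} \<times> {c..<d} \<union> task_pairs (j + 1, i', c, d)"
        using l by auto
      have k': "potential n S' h s' + 71 * t + 17 + 88 * (l * t) + 4 + r \<le> k'"
        using S'(5) t unfolding l by (simp add: t_def[symmetric] algebra_simps)
      have "run B part_loop (k' - 9) ?s (\<lambda>k s. run B (incr r_pivot) k s I)"
      proof (rule run_part_loop[where S = S' and c = c and d = d and i = j and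
            R = "task_pairs (j + 1, i', c, d)" and r = "88 * (l * t) + 8 + r"])
        show "refining B n a p q S0 f0 S' h ({j} \<times> {c..<d} \<union> task_pairs (j + 1, i', c, d)) ?s"
          using S'(4) unfolding pairs by (subst refining_cong(1)) simp_all
        show "potential n S' h ?s + 71 * (d - c) + 4 + (88 * (l * t) + 8 + r) \<le> k' - 9"
          using k' by (subst refining_cong(2)[of _ s']) (simp_all add: t_def)
        show "i'' \<notin> {c..<d}" if "(i'', j') \<in> task_pairs (j + 1, i', c, d)" for i'' j'
          using that ok S'(2) by auto
      next
        fix k2 s2 S2
        assume B2: "bounded B s2" and ag2: "agree part_loop ?s s2"
          and S2: "refining B n a p q S0 f0 S2 h (task_pairs (j + 1, i', c, d)) s2"
            "S' \<subseteq> S2" "potential n S2 h s2 + (88 * (l * t) + 8 + r) \<le> k2"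
        have j2: "reg s2 r_pivot = j"
          using ag2 unfolding agree_def refine_written j_def by simp
        let ?s3 = "s2\<lparr>reg := (reg s2)(r_pivot := j + 1)\<rparr>"
        have "I (k2 - 4) ?s3"
          unfolding I_def
        proof (intro exI[of _ S2] conjI)
          show "refining B n a p q S0 f0 S2 h (task_pairs (reg ?s3 r_pivot, i', c, d)) ?s3"
            using S2(1) by (subst refining_cong(1)[of _ s2]) simp_all
          show "potential n S2 h ?s3 + 88 * task_weight (reg ?s3 r_pivot, i', c, d) + 4 + r \<le> k2 - 4"
            using S2(3) by (subst refining_cong(2)[of _ s2]) (simp_all add: l t_def)
        qed (use S' S2 lt in auto)
        then show "run B (incr r_pivot) k2 s2 I"
          by (intro run_Set) (use j2 S2 lt ok q nB in \<open>simp_all add: word_def bounded_reg\<close>)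
      qed (use S' ok' ok lt q s' in \<open>auto simp: j_def\<close>)
      moreover have "c \<le> B" using ok q nB by simp
      ultimately show "run B pivot_body (k' - (cost ?b + 1)) s' I"
        unfolding pivot_body_def
        by (intro run_Seq run_Set)
          (use s' k' in \<open>simp_all add: bounded_reg bounded_arr j_def[symmetric]\<close>)
    }
    {
      assume "val s' ?b = 0"
      then have "j = i'" using s' S' by (simp add: j_def split: if_splits)
      then show "Q (k' - (cost ?b + 1)) s'"
        using S' ag B by (intro Q[of _ S']) (simp_all add: agree_def pivot_loop_def)
    }
  qed simp
qed

definition refine_body :: com where
  "refine_body =
     Set r_pivot (Cell a_pivot (Reg r_head)) ;;
     Set r_pivot_end (Cell a_pivot_end (Reg r_head)) ;;
     Set r_target (Cell a_target (Reg r_head)) ;;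
     Set r_target_end (Cell a_target_end (Reg r_head)) ;;
     pivot_loop ;;
     incr r_head"

definition refine_loop :: com where
  "refine_loop = While (Less (Reg r_head) (Reg r_tail)) refine_body"

text \<open>Fetching a task, advancing the queue and the last guard of \<open>pivot_loop\<close>
  cost 24 units. As a task has at least one pair, they raise the 88 units per pair to the 112 of
  \<open>potential\<close>. At the end no task is left, and what remains of the potential is the
  weight, from which later levels are paid.\<close>

lemma run_refine_loop:
  assumes ref: "refining B n a p q S0 f0 S (reg s r_head) {} s" and q: "q \<le> n"
    and k: "potential n S (reg s r_head) s + 4 + r \<le> k"
    and Q: "\<And>k' s' S'. bounded B s' \<Longrightarrow> agree refine_loop s s' \<Longrightarrow>
      reg s' r_head = reg s' r_tail \<Longrightarrow>
      refining B n a p q S0 f0 S' (reg s' r_head) {} s' \<Longrightarrow> 183 * square_weight n S' + r \<le> k' \<Longrightarrow> Q k' s'"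
  shows "run B refine_loop k s Q"
proof -
  define I where "I k' s' \<longleftrightarrow> (\<exists>S'. refining B n a p q S0 f0 S' (reg s' r_head) {} s' \<and>
      potential n S' (reg s' r_head) s' + 4 + r \<le> k')" for k' and s' :: ram
  let ?b = "Less (Reg r_head) (Reg r_tail)"
  show ?thesis
    unfolding refine_loop_def
  proof (rule run_While[where I = I])
    show "I k s"
      unfolding I_def using assms by (intro exI[of _ S]) simp
    fix k' s'
    assume ag: "agree refine_body s s'" and B: "bounded B s'" and I: "I k' s'"
    define h where "h = reg s' r_head"
    obtain S' where S': "refining B n a p q S0 f0 S' h {} s'" "potential n S' h s' + 4 + r \<le> k'"
      using I unfolding I_def h_def by blast
    note A = S'(1)[unfolded refining_def]
    show "cost ?b + 1 \<le> k'" using S'(2) by simp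
    {
      assume "val s' ?b \<noteq> 0"
      then have lt: "h < reg s' r_tail" by (simp add: h_def split: if_splits)
      then have iv: "{h..<reg s' r_tail} = insert h {h + 1..<reg s' r_tail}" by auto
      obtain i i' c d where t: "task s' h = (i, i', c, d)" by (cases "task s' h")
      then have t': "arr s' a_pivot h = i" "arr s' a_pivot_end h = i'" "arr s' a_target h = c"
        "arr s' a_target_end h = d"
        unfolding task_def by simp_all
      have ok: "task_ok n p q S' (i, i', c, d)" using A lt t by (metis atLeastLessThan_iff order_refl)
      let ?s = "s'\<lparr>reg := (reg s')(r_pivot := i, r_pivot_end := i', r_target := c, r_target_end := d)\<rparr>"
      define w where "w = task_weight (i, i', c, d)"
      have "0 < w" using ok unfolding w_def by simp
      then have w: "1 \<le> w" by linarith
      have pot: "potential n S' h s' = potential n S' (h + 1) s' + 112 * w"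
        unfolding potential_def iv by (simp add: t w_def)
      have pend: "pending h s' = task_pairs (i, i', c, d) \<union> pending (h + 1) s'"
        unfolding pending_def iv by (simp add: t)
      have ref': "refining B n a p q S0 f0 S' (h + 1) (task_pairs (i, i', c, d)) s'"
        using A lt unfolding refining_def pend by simp
      have "run B pivot_loop (k' - 16) ?s (\<lambda>k s. run B (incr r_head) k s I)"
      proof (rule run_pivot_loop[where S = S' and h = "h + 1" and i = i and i' = i' and c = c and d = d and
            r = "8 + r", OF _ ok q])
        show "refining B n a p q S0 f0 S' (h + 1) (task_pairs (i, i', c, d)) ?s"
          using ref' by (subst refining_cong(1)[of _ s']) simp_all
        show "potential n S' (h + 1) ?s + 88 * task_weight (i, i', c, d) + 4 + (8 + r) \<le> k' - 16"
          using S'(2) pot w by (subst refining_cong(2)[of _ s']) (simp_all add: w_def)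
      next
        fix k2 s2 S2
        assume B2: "bounded B s2" and ag2: "agree pivot_loop ?s s2"
          and S2: "refining B n a p q S0 f0 S2 (h + 1) {} s2" "potential n S2 (h + 1) s2 + (8 + r) \<le> k2"
        have h2: "reg s2 r_head = h"
          using ag2 unfolding agree_def pivot_loop_def refine_written h_def by simp
        let ?s3 = "s2\<lparr>reg := (reg s2)(r_head := h + 1)\<rparr>"
        have "I (k2 - 4) ?s3"
          unfolding I_def
        proof (intro exI[of _ S2] conjI)
          show "refining B n a p q S0 f0 S2 (reg ?s3 r_head) {} ?s3"
            using S2(1) by (subst refining_cong(1)[of _ s2]) simp_all
          show "potential n S2 (reg ?s3 r_head) ?s3 + 4 + r \<le> k2 - 4"
            using S2(2) by (subst refining_cong(2)[of _ s2]) simp_all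
        qed
        moreover have "h + 1 \<le> reg s2 r_tail" using S2(1) unfolding refining_def by blast
        then have "bounded B s2 \<Longrightarrow> h + 1 \<le> B" using bounded_reg le_trans by blast
        ultimately show "run B (incr r_head) k2 s2 I"
          by (intro run_Set) (use h2 S2 in \<open>simp_all add: word_def bounded_reg\<close>)
      qed simp_all
      moreover have "20 \<le> k'" using S'(2) pot w by simp
      moreover have "i \<le> B" "i' \<le> B" "c \<le> B" "d \<le> B" using bounded_arr[OF B] t' by blast+
      ultimately show "run B refine_body (k' - (cost ?b + 1)) s' I"
        unfolding refine_body_def
        by (intro run_Seq run_Set)
          (use t' in \<open>simp_all add: h_def[symmetric]\<close>)
    }
    {
      assume "val s' ?b = 0"
      moreover have "h \<le> reg s' r_tail" using A by blast
      ultimately have "h = reg s' r_tail" by (simp add: h_def split: if_splits)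
      then show "Q (k' - (cost ?b + 1)) s'"
        using S' ag B unfolding h_def
        by (intro Q[of _ S']) (simp_all add: agree_def refine_loop_def potential_def)
    }
  qed simp
qed


section \<open>Strong components and chains of closed sets\<close>

definition closed_in :: "nat \<Rightarrow> (nat \<Rightarrow> nat \<Rightarrow> bool) \<Rightarrow> nat set \<Rightarrow> bool" where
  "closed_in m E C \<longleftrightarrow> C \<subseteq> {..<m} \<and> (\<forall>j\<in>C. \<forall>l<m. E j l \<longrightarrow> l \<in> C)"

text \<open>
  \<open>lv j\<close> is \<open>0\<close> if \<open>j\<close> has been
  output, it is \<open>m + 1\<close> if \<open>j\<close> has not been reached, and otherwise \<open>j\<close> belongs to the block
  \<open>lv j\<close> on a stack of \<open>k\<close> blocks, every closed set that meets a block containing this block and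
  all blocks above it. Row \<open>i\<close> collects the successors of block \<open>i\<close>; row \<open>0\<close> belongs to a
  virtual block with arcs to all vertices. The number \<open>ot j\<close> tells when \<open>j\<close> was output.
\<close>

definition search_inv ::
  "nat \<Rightarrow> (nat \<Rightarrow> nat \<Rightarrow> bool) \<Rightarrow> nat \<Rightarrow> (nat \<Rightarrow> nat) \<Rightarrow> (nat \<Rightarrow> nat \<Rightarrow> nat) \<Rightarrow> nat \<Rightarrow> nat \<Rightarrow> (nat \<Rightarrow> nat) \<Rightarrow> bool"
  where
  "search_inv m E b lv row k N ot \<longleftrightarrow>
     (\<forall>j<m. lv j \<le> k \<or> lv j = m + 1) \<and>
     card {j. j < m \<and> lv j = m + 1} + k \<le> m \<and>
     (\<forall>i\<in>{1..k}. \<exists>j<m. lv j = i) \<and>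
     (\<forall>i\<in>{1..k}. \<forall>l<m. row i l \<noteq> 0 \<longleftrightarrow> (\<exists>j<m. lv j = i \<and> E j l)) \<and>
     (\<forall>l<m. row 0 l \<noteq> 0) \<and>
     closed_in m E {j. j < m \<and> lv j = 0} \<and>
     (\<forall>C j j'. closed_in m E C \<longrightarrow> j \<in> C \<longrightarrow> j' < m \<longrightarrow> 1 \<le> lv j \<longrightarrow> lv j \<le> lv j' \<longrightarrow>
       lv j' \<le> k \<longrightarrow> j' \<in> C) \<and>
     b \<le> N \<and> N \<le> b + card {j. j < m \<and> lv j = 0} \<and>
     (\<forall>j<m. lv j = 0 \<longrightarrow> b < ot j \<and> ot j \<le> N) \<and>
     (\<forall>t. b < t \<longrightarrow> t \<le> N \<longrightarrow> (\<exists>j<m. lv j = 0 \<and> ot j = t)) \<and>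
     (\<forall>t. b \<le> t \<longrightarrow> t \<le> N \<longrightarrow> closed_in m E {j. j < m \<and> lv j = 0 \<and> ot j \<le> t}) \<and>
     (\<forall>S. closed_in m E S \<longrightarrow> (\<forall>C. closed_in m E C \<longrightarrow> C \<subseteq> S \<or> S \<subseteq> C) \<longrightarrow>
       {j. j < m \<and> lv j = 0} \<subseteq> S \<or>
       (\<exists>t. b \<le> t \<and> t \<le> N \<and> S = {j. j < m \<and> lv j = 0 \<and> ot j \<le> t}))"

lemmas search_invD =
  search_inv_def[THEN iffD1, THEN conjunct1, rule_format]
  search_inv_def[THEN iffD1, THEN conjunct2, THEN conjunct1, rule_format]
  search_inv_def[THEN iffD1, THEN conjunct2, THEN conjunct2, THEN conjunct1, rule_format]
  search_inv_def[THEN iffD1, THEN conjunct2, THEN conjunct2, THEN conjunct2, THEN conjunct1, rule_format]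
  search_inv_def[THEN iffD1, THEN conjunct2, THEN conjunct2, THEN conjunct2, THEN conjunct2, THEN conjunct1, rule_format]
  search_inv_def[THEN iffD1, THEN conjunct2, THEN conjunct2, THEN conjunct2, THEN conjunct2, THEN conjunct2, THEN conjunct1, rule_format]
  search_inv_def[THEN iffD1, THEN conjunct2, THEN conjunct2, THEN conjunct2, THEN conjunct2, THEN conjunct2, THEN conjunct2, THEN conjunct1, rule_format]
  search_inv_def[THEN iffD1, THEN conjunct2, THEN conjunct2, THEN conjunct2, THEN conjunct2, THEN conjunct2, THEN conjunct2, THEN conjunct2, THEN conjunct1, rule_format]
  search_inv_def[THEN iffD1, THEN conjunct2, THEN conjunct2, THEN conjunct2, THEN conjunct2, THEN conjunct2, THEN conjunct2, THEN conjunct2, THEN conjunct2, THEN conjunct1, rule_format]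
  search_inv_def[THEN iffD1, THEN conjunct2, THEN conjunct2, THEN conjunct2, THEN conjunct2, THEN conjunct2, THEN conjunct2, THEN conjunct2, THEN conjunct2, THEN conjunct2, THEN conjunct1, rule_format]
  search_inv_def[THEN iffD1, THEN conjunct2, THEN conjunct2, THEN conjunct2, THEN conjunct2, THEN conjunct2, THEN conjunct2, THEN conjunct2, THEN conjunct2, THEN conjunct2, THEN conjunct2, THEN conjunct1, rule_format]
  search_inv_def[THEN iffD1, THEN conjunct2, THEN conjunct2, THEN conjunct2, THEN conjunct2, THEN conjunct2, THEN conjunct2, THEN conjunct2, THEN conjunct2, THEN conjunct2, THEN conjunct2, THEN conjunct2, THEN conjunct1, rule_format]
  search_inv_def[THEN iffD1, THEN conjunct2, THEN conjunct2, THEN conjunct2, THEN conjunct2, THEN conjunct2, THEN conjunct2, THEN conjunct2, THEN conjunct2, THEN conjunct2, THEN conjunct2, THEN conjunct2, THEN conjunct2, rule_format]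

lemma search_inv_init:
  assumes "\<And>j. j < m \<Longrightarrow> lv j = m + 1" and "\<And>l. l < m \<Longrightarrow> row 0 l \<noteq> 0"
  shows "search_inv m E b lv row 0 b ot"
proof -
  have *: "{j. j < m \<and> lv j = 0} = {}" "\<And>t. {j. j < m \<and> lv j = 0 \<and> ot j \<le> t} = {}"
    using assms(1) by auto
  have "{j. j < m \<and> lv j = m + 1} = {..<m}" using assms(1) by auto
  moreover have "closed_in m E C \<Longrightarrow> j \<in> C \<Longrightarrow> j' < m \<Longrightarrow> 1 \<le> lv j \<Longrightarrow> lv j \<le> lv j' \<Longrightarrow> lv j' \<le> 0 \<Longrightarrow> j' \<in> C"
    for C j j' by linarith
  ultimately show ?thesis
    unfolding search_inv_def * using assms by (auto simp: closed_in_def)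
qed

text \<open>A closed set that meets any block on the stack contains the whole top block, and an arc
  leads from the top block to \<open>w\<close>; so it contains \<open>w\<close>, and
  \<open>w\<close> may become the new top. With an empty stack the arc comes from the virtual block
  and this condition is vacuous.\<close>

lemma search_inv_push:
  assumes inv: "search_inv m E b lv row k N ot"
    and w: "w < m" "lv w = m + 1" "row k w \<noteq> 0"
    and lv': "\<And>j. j < m \<Longrightarrow> lv' j = (if j = w then k + 1 else lv j)"
    and row': "\<And>l. l < m \<Longrightarrow> row' (k + 1) l \<noteq> 0 \<longleftrightarrow> E w l" "\<And>i l. i \<le> k \<Longrightarrow> l < m \<Longrightarrow> row' i l = row i l"
  shows "search_inv m E b lv' row' (k + 1) N ot"
    and "card {j. j < m \<and> lv' j = m + 1} + 1 = card {j. j < m \<and> lv j = m + 1}"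
proof -
  note I = inv[unfolded search_inv_def] and D = search_invD[OF inv]
  have set_w: "{j. j < m \<and> lv j = m + 1} = insert w {j. j < m \<and> lv j = m + 1 \<and> j \<noteq> w}"
    using w by auto
  have kcard: "card {j. j < m \<and> lv j = m + 1 \<and> j \<noteq> w} + 1 + k \<le> m"
    using I unfolding set_w by simp
  have set': "{j. j < m \<and> lv' j = m + 1} = {j. j < m \<and> lv j = m + 1 \<and> j \<noteq> w}"
    using lv' kcard by (auto split: if_splits)
  show "card {j. j < m \<and> lv' j = m + 1} + 1 = card {j. j < m \<and> lv j = m + 1}"
    unfolding set_w set' by simp
  have F: "{j. j < m \<and> lv' j = 0} = {j. j < m \<and> lv j = 0}"
    "\<And>t. {j. j < m \<and> lv' j = 0 \<and> ot j \<le> t} = {j. j < m \<and> lv j = 0 \<and> ot j \<le> t}"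
    using lv' w by (auto split: if_splits)
  have lv0: "lv' j = 0 \<longleftrightarrow> lv j = 0" if "j < m" for j using lv'[OF that] w by simp
  have le: "lv j \<le> k" if "j < m" "lv j \<noteq> m + 1" for j using D(1)[OF that(1)] that(2) by blast
  have c1: "\<forall>j<m. lv' j \<le> k + 1 \<or> lv' j = m + 1"
  proof (intro allI impI)
    fix j assume "j < m"
    then show "lv' j \<le> k + 1 \<or> lv' j = m + 1" using le[of j] lv'[of j] by auto
  qed
  have c3: "\<exists>j<m. lv' j = i" if "i \<in> {1..k + 1}" for i
  proof (cases "i = k + 1")
    case False
    then have "i \<in> {1..k}" using that by auto
    then obtain j where j: "j < m" "lv j = i" using D(3) by blast
    have "j \<noteq> w" using j w \<open>i \<in> {1..k}\<close> kcard by auto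
    then show ?thesis using j lv' by auto
  qed (use w lv' in auto)
  have c4: "row' i l \<noteq> 0 \<longleftrightarrow> (\<exists>j<m. lv' j = i \<and> E j l)" if "i \<in> {1..k + 1}" "l < m" for i l
  proof (cases "i = k + 1")
    case True
    have "j = w" if "j < m" "lv' j = k + 1" for j
      using that lv'[of j] le[of j] kcard by (cases "lv j = m + 1") (auto split: if_splits)
    then have "(\<exists>j<m. lv' j = k + 1 \<and> E j l) \<longleftrightarrow> E w l" using w(1) lv'[OF w(1)] by metis
    then show ?thesis using row'(1)[OF that(2)] True by simp
  next
    case False
    then have i: "i \<in> {1..k}" using that by auto
    have "lv' j = i \<longleftrightarrow> lv j = i" if "j < m" for j
      using lv'[OF that] i w kcard by auto
    then show ?thesis using D(4)[OF i that(2)] i that row'(2)[of i l] by auto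
  qed
  have c7: "j' \<in> C" if C: "closed_in m E C" and j: "j \<in> C" "j' < m" "1 \<le> lv' j" "lv' j \<le> lv' j'" "lv' j' \<le> k + 1"
    for C j j'
  proof -
    have jm: "j < m" using C j unfolding closed_in_def by auto
    show ?thesis
    proof (cases "j = w")
      case True
      then have "lv' j' = k + 1" using j lv' w by simp
      then have "j' = w"
        using j(2) lv'[of j'] le[of j'] kcard by (cases "lv j' = m + 1") (auto split: if_splits)
      then show ?thesis using True j by simp
    next
      case False
      then have lvj: "1 \<le> lv j" "lv j = lv' j" using j lv' jm by auto
      show ?thesis
      proof (cases "j' = w")
        case False
        have "lv' j' \<noteq> m + 1" using j kcard by linarith
        then have "lv j' \<le> k" "lv j' = lv' j'" using le[of j'] j lv' False by auto
        then show ?thesis using D(7)[OF C j(1,2) lvj(1)] lvj j by simp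
      next
        case True
        have k: "lv j \<le> k" using lvj j lv'[of j'] True w le[OF jm] kcard by (cases "lv j = m + 1") auto
        then have "1 \<le> k" using lvj by linarith
        then have "k \<in> {1..k}" by simp
        then obtain i where i: "i < m" "lv i = k" "E i w" using D(4)[of k w] w by blast
        have "i \<in> C" using D(7)[OF C j(1) i(1) lvj(1)] k i by simp
        then show ?thesis using C i w True unfolding closed_in_def by blast
      qed
    qed
  qed
  have i3: "\<forall>i\<in>{1..k + 1}. \<exists>j<m. lv' j = i" using c3 by blast
  have i4: "\<forall>i\<in>{1..k + 1}. \<forall>l<m. row' i l \<noteq> 0 \<longleftrightarrow> (\<exists>j<m. lv' j = i \<and> E j l)"
    by (intro ballI allI impI) (rule c4)
  have i7: "\<forall>C j j'. closed_in m E C \<longrightarrow> j \<in> C \<longrightarrow> j' < m \<longrightarrow> 1 \<le> lv' j \<longrightarrow> lv' j \<le> lv' j' \<longrightarrow>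
       lv' j' \<le> k + 1 \<longrightarrow> j' \<in> C"
    by (intro allI impI) (rule c7)
  have i10: "\<forall>j<m. lv' j = 0 \<longrightarrow> b < ot j \<and> ot j \<le> N" using D(10) lv0 by simp
  have i11: "\<forall>t. b < t \<longrightarrow> t \<le> N \<longrightarrow> (\<exists>j<m. lv' j = 0 \<and> ot j = t)" using D(11) lv0 by metis
  have i13: "\<forall>S. closed_in m E S \<longrightarrow> (\<forall>C. closed_in m E C \<longrightarrow> C \<subseteq> S \<or> S \<subseteq> C) \<longrightarrow>
       {j. j < m \<and> lv j = 0} \<subseteq> S \<or>
       (\<exists>t. b \<le> t \<and> t \<le> N \<and> S = {j. j < m \<and> lv j = 0 \<and> ot j \<le> t})"
    and i12: "\<forall>t. b \<le> t \<longrightarrow> t \<le> N \<longrightarrow> closed_in m E {j. j < m \<and> lv j = 0 \<and> ot j \<le> t}"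
    using D(12,13) by simp_all
  have i2: "card {j. j < m \<and> lv j = m + 1 \<and> j \<noteq> w} + (k + 1) \<le> m" using kcard by simp
  have i5: "\<forall>l<m. row' 0 l \<noteq> 0" using row'(2)[of 0] D(5) by simp
  show "search_inv m E b lv' row' (k + 1) N ot"
    unfolding search_inv_def F set'
    using c1 i2 i3 i4 i5 D(6) i7 D(8,9) i10 i11 i12 i13 by (intro conjI)
qed

text \<open>An arc leads from the top block to \<open>w\<close> in a lower block, so a closed set
  that meets the top block contains \<open>w\<close> and with it all blocks from that of
  \<open>w\<close> upwards. Hence the top two blocks lie in the same closed sets. The merged block
  keeps the arc, which causes further merges until the block of \<open>w\<close> is on top.\<close>

lemma search_inv_merge:
  assumes inv: "search_inv m E b lv row k N ot"
    and w: "w < m" "1 \<le> lv w" "lv w < k" "row k w \<noteq> 0"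
    and lv': "\<And>j. j < m \<Longrightarrow> lv' j = (if lv j = k then k - 1 else lv j)"
    and row': "\<And>l. l < m \<Longrightarrow> row' (k - 1) l \<noteq> 0 \<longleftrightarrow> row (k - 1) l \<noteq> 0 \<or> row k l \<noteq> 0"
      "\<And>i l. i < k - 1 \<Longrightarrow> l < m \<Longrightarrow> row' i l = row i l"
  shows "search_inv m E b lv' row' (k - 1) N ot"
    and "card {j. j < m \<and> lv' j = m + 1} = card {j. j < m \<and> lv j = m + 1}"
proof -
  note I = inv[unfolded search_inv_def] and D = search_invD[OF inv]
  have k: "2 \<le> k" "k \<le> m" using w I by linarith+
  have set': "{j. j < m \<and> lv' j = m + 1} = {j. j < m \<and> lv j = m + 1}"
    using lv' k by (auto split: if_splits)
  then show "card {j. j < m \<and> lv' j = m + 1} = card {j. j < m \<and> lv j = m + 1}" by simp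
  have lv0: "lv' j = 0 \<longleftrightarrow> lv j = 0" if "j < m" for j using lv'[OF that] k by auto
  have F: "{j. j < m \<and> lv' j = 0} = {j. j < m \<and> lv j = 0}"
    "\<And>t. {j. j < m \<and> lv' j = 0 \<and> ot j \<le> t} = {j. j < m \<and> lv j = 0 \<and> ot j \<le> t}"
    using lv0 by auto
  have le: "lv j \<le> k" if "j < m" "lv j \<noteq> m + 1" for j using D(1)[OF that(1)] that(2) by blast
  have c1: "\<forall>j<m. lv' j \<le> k - 1 \<or> lv' j = m + 1"
  proof (intro allI impI)
    fix j assume "j < m"
    then show "lv' j \<le> k - 1 \<or> lv' j = m + 1" using le[of j] lv'[of j] by auto
  qed
  have c3: "\<exists>j<m. lv' j = i" if "i \<in> {1..k - 1}" for i
  proof -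
    have "i \<in> {1..k}" using that by auto
    then obtain j where j: "j < m" "lv j = i" using D(3) by blast
    then show ?thesis using lv' that by (intro exI[of _ j]) auto
  qed
  have r4: "row i l \<noteq> 0 \<longleftrightarrow> (\<exists>j<m. lv j = i \<and> E j l)" if "i \<in> {1..k}" "l < m" for i l
    using D(4)[OF that] .
  have c4: "row' i l \<noteq> 0 \<longleftrightarrow> (\<exists>j<m. lv' j = i \<and> E j l)" if "i \<in> {1..k - 1}" "l < m" for i l
  proof (cases "i = k - 1")
    case True
    have "lv' j = k - 1 \<longleftrightarrow> lv j = k - 1 \<or> lv j = k" if "j < m" for j
      using lv'[OF that] by auto
    moreover have "k - 1 \<in> {1..k}" "k \<in> {1..k}" using k by auto
    ultimately show ?thesis using row'(1)[OF that(2)] True r4[OF _ that(2)] by auto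
  next
    case False
    then have i: "i \<in> {1..k}" "i < k - 1" using that by auto
    have "lv' j = i \<longleftrightarrow> lv j = i" if "j < m" for j
      using lv'[OF that] i by auto
    then show ?thesis using r4[OF i(1) that(2)] that row'(2)[of i l] i by auto
  qed
  have r0: "\<forall>l<m. row' 0 l \<noteq> 0" using row'(2)[of 0] D(5) k by simp
  have c7: "j' \<in> C" if C: "closed_in m E C" and j: "j \<in> C" "j' < m" "1 \<le> lv' j" "lv' j \<le> lv' j'" "lv' j' \<le> k - 1"
    for C j j'
  proof -
    have jm: "j < m" using C j unfolding closed_in_def by auto
    have P: "i' \<in> C" if "i \<in> C" "i' < m" "1 \<le> lv i" "lv i \<le> lv i'" "lv i' \<le> k" for i i'
      using D(7)[OF C that] .
    have lj: "1 \<le> lv j" using j lv'[OF jm] k by (auto split: if_splits)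
    have lj': "lv j' \<le> k" using j lv'[of j'] k by (auto split: if_splits)
    show ?thesis
    proof (cases "lv j \<le> lv j'")
      case True
      then show ?thesis using P[OF j(1,2) lj _ lj'] by blast
    next
      case False
      then have e: "lv j = k" "lv j' = k - 1"
        using j lv'[OF jm] lv'[OF j(2)] lj' by (auto split: if_splits)
      have "k \<in> {1..k}" using k by simp
      then obtain i where i: "i < m" "lv i = k" "E i w" using r4 w by blast
      have "i \<in> C" using P[OF j(1) i(1) lj] e i by simp
      then have "w \<in> C" using C i w unfolding closed_in_def by blast
      then show ?thesis using P[OF _ j(2) w(2)] e w by auto
    qed
  qed
  have i3: "\<forall>i\<in>{1..k - 1}. \<exists>j<m. lv' j = i" using c3 by blast
  have i4: "\<forall>i\<in>{1..k - 1}. \<forall>l<m. row' i l \<noteq> 0 \<longleftrightarrow> (\<exists>j<m. lv' j = i \<and> E j l)"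
    by (intro ballI allI impI) (rule c4)
  have i7: "\<forall>C j j'. closed_in m E C \<longrightarrow> j \<in> C \<longrightarrow> j' < m \<longrightarrow> 1 \<le> lv' j \<longrightarrow> lv' j \<le> lv' j' \<longrightarrow>
       lv' j' \<le> k - 1 \<longrightarrow> j' \<in> C"
    by (intro allI impI) (rule c7)
  have i10: "\<forall>j<m. lv' j = 0 \<longrightarrow> b < ot j \<and> ot j \<le> N" using D(10) lv0 by simp
  have i11: "\<forall>t. b < t \<longrightarrow> t \<le> N \<longrightarrow> (\<exists>j<m. lv' j = 0 \<and> ot j = t)" using D(11) lv0 by metis
  have i13: "\<forall>S. closed_in m E S \<longrightarrow> (\<forall>C. closed_in m E C \<longrightarrow> C \<subseteq> S \<or> S \<subseteq> C) \<longrightarrow>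
       {j. j < m \<and> lv j = 0} \<subseteq> S \<or>
       (\<exists>t. b \<le> t \<and> t \<le> N \<and> S = {j. j < m \<and> lv j = 0 \<and> ot j \<le> t})"
    and i12: "\<forall>t. b \<le> t \<longrightarrow> t \<le> N \<longrightarrow> closed_in m E {j. j < m \<and> lv j = 0 \<and> ot j \<le> t}"
    using D(12,13) by simp_all
  have i2: "card {j. j < m \<and> lv j = m + 1} + (k - 1) \<le> m" using D(2) by simp
  show "search_inv m E b lv' row' (k - 1) N ot"
    unfolding search_inv_def F set'
    using c1 i2 i3 i4 r0 D(6) i7 D(8,9) i10 i11 i12 i13 by (intro conjI)
qed

text \<open>All arcs of the top block end in itself or in the output, so the output stays closed.
  Let \<open>S\<close> be comparable with all closed sets and properly contain the old output. If
  \<open>S\<close> lies in the new output, it meets the top block and therefore contains it;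
  otherwise comparability says that \<open>S\<close> contains the new output. Either way the prefix
  property persists.\<close>

lemma search_inv_pop:
  assumes inv: "search_inv m E b lv row k N ot"
    and k: "1 \<le> k" and none: "\<And>j. j < m \<Longrightarrow> lv j \<noteq> 0 \<Longrightarrow> lv j \<noteq> k \<Longrightarrow> row k j = 0"
    and lv': "\<And>j. j < m \<Longrightarrow> lv' j = (if lv j = k then 0 else lv j)"
    and ot': "\<And>j. j < m \<Longrightarrow> ot' j = (if lv j = k then N + 1 else ot j)"
  shows "search_inv m E b lv' row (k - 1) (N + 1) ot'"
    and "card {j. j < m \<and> lv' j = m + 1} = card {j. j < m \<and> lv j = m + 1}"
proof -
  note I = inv[unfolded search_inv_def] and D = search_invD[OF inv]
  have km: "k \<le> m" using I by linarith
  define F where "F = {j. j < m \<and> lv j = 0}"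
  define D' where "D' = {j. j < m \<and> lv j = k}"
  have set': "{j. j < m \<and> lv' j = m + 1} = {j. j < m \<and> lv j = m + 1}"
    using lv' km by (auto split: if_splits)
  then show "card {j. j < m \<and> lv' j = m + 1} = card {j. j < m \<and> lv j = m + 1}" by simp
  have le: "lv j \<le> k" if "j < m" "lv j \<noteq> m + 1" for j using D(1)[OF that(1)] that(2) by blast
  have kk: "k \<in> {1..k}" using k by simp
  have F': "{j. j < m \<and> lv' j = 0} = F \<union> D'" unfolding F_def D'_def using lv' by auto
  have otF: "b < ot j \<and> ot j \<le> N" if "j \<in> F" for j using D(10)[of j] that unfolding F_def by simp
  have Ft: "{j. j < m \<and> lv' j = 0 \<and> ot' j \<le> t} = {j. j < m \<and> lv j = 0 \<and> ot j \<le> t}" if "t \<le> N" for t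
    using lv' ot' that k by (auto split: if_splits)
  have FN: "{j. j < m \<and> lv j = 0 \<and> ot j \<le> N} = F" using otF unfolding F_def by auto
  have FN': "{j. j < m \<and> lv' j = 0 \<and> ot' j \<le> N + 1} = F \<union> D'"
    using otF lv' ot' unfolding F_def D'_def by fastforce
  obtain j0 where j0: "j0 \<in> D'" using D(3)[OF kk] unfolding D'_def by blast
  have dis: "F \<inter> D' = {}" unfolding F_def D'_def using k by auto
  have fin: "finite F" "finite D'" unfolding F_def D'_def by simp_all
  have closedF: "closed_in m E F" using D(6) unfolding F_def .
  have closedFD: "closed_in m E (F \<union> D')"
    unfolding closed_in_def
  proof (intro conjI ballI allI impI)
    show "F \<union> D' \<subseteq> {..<m}" unfolding F_def D'_def by auto
    fix j l assume j: "j \<in> F \<union> D'" and l: "l < m" "E j l"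
    show "l \<in> F \<union> D'"
    proof (cases "j \<in> F")
      case True
      then show ?thesis using closedF l unfolding closed_in_def by blast
    next
      case False
      then have "j < m" "lv j = k" using j unfolding D'_def by auto
      then have "row k l \<noteq> 0" using D(4)[OF kk l(1)] l by blast
      then have "lv l = 0 \<or> lv l = k" using none[OF l(1)] by auto
      then show ?thesis using l(1) unfolding F_def D'_def by simp
    qed
  qed
  have c1: "\<forall>j<m. lv' j \<le> k - 1 \<or> lv' j = m + 1"
  proof (intro allI impI)
    fix j assume "j < m"
    then show "lv' j \<le> k - 1 \<or> lv' j = m + 1" using le[of j] lv'[of j] by auto
  qed
  have lvi: "lv' j = i \<longleftrightarrow> lv j = i" if "j < m" "i \<in> {1..k - 1}" for i j
    using lv'[OF that(1)] that(2) by auto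
  have c3: "\<exists>j<m. lv' j = i" if "i \<in> {1..k - 1}" for i
  proof -
    have "i \<in> {1..k}" using that by auto
    then show ?thesis using D(3) lvi that by blast
  qed
  have c4: "row i l \<noteq> 0 \<longleftrightarrow> (\<exists>j<m. lv' j = i \<and> E j l)" if "i \<in> {1..k - 1}" "l < m" for i l
  proof -
    have "i \<in> {1..k}" using that by auto
    then have "row i l \<noteq> 0 \<longleftrightarrow> (\<exists>j<m. lv j = i \<and> E j l)" using D(4)[OF _ that(2)] by blast
    then show ?thesis using lvi that(1) by blast
  qed
  have c7: "j' \<in> C" if C: "closed_in m E C" and j: "j \<in> C" "j' < m" "1 \<le> lv' j" "lv' j \<le> lv' j'" "lv' j' \<le> k - 1"
    for C j j'
  proof -
    have jm: "j < m" using C j unfolding closed_in_def by auto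
    have "lv j = lv' j" "lv j' = lv' j'"
      using j lv'[OF jm] lv'[of j'] by (auto split: if_splits)
    moreover have "lv' j' \<le> k" using j by simp
    ultimately show ?thesis using D(7)[OF C j(1,2)] j by simp
  qed
  have c8: "N + 1 \<le> b + card (F \<union> D')"
  proof -
    have "1 \<le> card D'" using j0 fin by (metis One_nat_def Suc_leI card_gt_0_iff empty_iff)
    moreover have "N \<le> b + card F" using D(9) unfolding F_def .
    ultimately show ?thesis using card_Un_disjoint[OF fin dis] by linarith
  qed
  have c9: "\<forall>j<m. lv' j = 0 \<longrightarrow> b < ot' j \<and> ot' j \<le> N + 1"
  proof (intro allI impI)
    fix j assume j: "j < m" "lv' j = 0"
    have "b \<le> N" using D(8) .
    then show "b < ot' j \<and> ot' j \<le> N + 1"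
      using j lv'[OF j(1)] ot'[OF j(1)] otF[of j] unfolding F_def by (auto split: if_splits)
  qed
  have c10: "\<exists>j<m. lv' j = 0 \<and> ot' j = t" if "b < t" "t \<le> N + 1" for t
  proof (cases "t = N + 1")
    case True
    then show ?thesis using j0 lv' ot' unfolding D'_def by auto
  next
    case False
    then have t: "b < t" "t \<le> N" using that by linarith+
    obtain j where "j < m" "lv j = 0" "ot j = t" using D(11)[OF t] by blast
    then show ?thesis using lv'[of j] ot'[of j] k by (intro exI[of _ j]) auto
  qed
  have c11: "closed_in m E {j. j < m \<and> lv' j = 0 \<and> ot' j \<le> t}" if "b \<le> t" "t \<le> N + 1" for t
  proof (cases "t = N + 1")
    case True
    show ?thesis using closedFD unfolding True FN' .
  next
    case False
    then have t: "t \<le> N" using that by linarith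
    have "\<forall>t. b \<le> t \<longrightarrow> t \<le> N \<longrightarrow> closed_in m E {j. j < m \<and> lv j = 0 \<and> ot j \<le> t}"
      using D(12) by simp
    then show ?thesis unfolding Ft[OF t] using that(1) t by simp
  qed
  have c12: "F \<union> D' \<subseteq> S \<or> (\<exists>t. b \<le> t \<and> t \<le> N + 1 \<and> S = {j. j < m \<and> lv' j = 0 \<and> ot' j \<le> t})"
    if S: "closed_in m E S" and strong: "\<forall>C. closed_in m E C \<longrightarrow> C \<subseteq> S \<or> S \<subseteq> C" for S
  proof -
    have "F \<subseteq> S \<or> (\<exists>t. b \<le> t \<and> t \<le> N \<and> S = {j. j < m \<and> lv j = 0 \<and> ot j \<le> t})"
      using D(13)[of S] S strong unfolding F_def by simp
    then show ?thesis
    proof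
      assume FS: "F \<subseteq> S"
      show ?thesis
      proof (cases "S = F")
        case True
        then have "S = {j. j < m \<and> lv' j = 0 \<and> ot' j \<le> N}" using Ft[of N] FN by simp
        moreover have "b \<le> N" using D(8) .
        ultimately show ?thesis by (intro disjI2 exI[of _ N]) simp
      next
        case False
        consider "F \<union> D' \<subseteq> S" | "S \<subseteq> F \<union> D'" using strong closedFD by blast
        then show ?thesis
        proof cases
          case 2
          then obtain j where j: "j \<in> S" "j \<in> D'" using FS False by blast
          have "D' \<subseteq> S"
          proof
            fix j' assume "j' \<in> D'"
            then show "j' \<in> S"
              using D(7)[OF S j(1), of j'] j k unfolding D'_def by simp
          qed
          then show ?thesis using FS by blast
        qed blast
      qed
    next
      assume "\<exists>t. b \<le> t \<and> t \<le> N \<and> S = {j. j < m \<and> lv j = 0 \<and> ot j \<le> t}"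
      then obtain t where t: "b \<le> t" "t \<le> N" "S = {j. j < m \<and> lv j = 0 \<and> ot j \<le> t}" by blast
      then show ?thesis using Ft[OF t(2)] by (intro disjI2 exI[of _ t]) simp
    qed
  qed
  have i3: "\<forall>i\<in>{1..k - 1}. \<exists>j<m. lv' j = i" using c3 by blast
  have i4: "\<forall>i\<in>{1..k - 1}. \<forall>l<m. row i l \<noteq> 0 \<longleftrightarrow> (\<exists>j<m. lv' j = i \<and> E j l)"
    by (intro ballI allI impI) (rule c4)
  have i7: "\<forall>C j j'. closed_in m E C \<longrightarrow> j \<in> C \<longrightarrow> j' < m \<longrightarrow> 1 \<le> lv' j \<longrightarrow> lv' j \<le> lv' j' \<longrightarrow>
       lv' j' \<le> k - 1 \<longrightarrow> j' \<in> C"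
    by (intro allI impI) (rule c7)
  have i2: "card {j. j < m \<and> lv j = m + 1} + (k - 1) \<le> m" using D(2) by simp
  have i5: "\<forall>l<m. row 0 l \<noteq> 0" using D(5) by simp
  have i8: "b \<le> N + 1" using D(8) by simp
  have i11: "\<forall>t. b < t \<longrightarrow> t \<le> N + 1 \<longrightarrow> (\<exists>j<m. lv' j = 0 \<and> ot' j = t)"
    and i12: "\<forall>t. b \<le> t \<longrightarrow> t \<le> N + 1 \<longrightarrow> closed_in m E {j. j < m \<and> lv' j = 0 \<and> ot' j \<le> t}"
    and i13: "\<forall>S. closed_in m E S \<longrightarrow> (\<forall>C. closed_in m E C \<longrightarrow> C \<subseteq> S \<or> S \<subseteq> C) \<longrightarrow>
       F \<union> D' \<subseteq> S \<or>
       (\<exists>t. b \<le> t \<and> t \<le> N + 1 \<and> S = {j. j < m \<and> lv' j = 0 \<and> ot' j \<le> t})"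
    using c10 c11 c12 by simp_all
  show "search_inv m E b lv' row (k - 1) (N + 1) ot'"
    unfolding search_inv_def F' set'
    using c1 i2 i3 i4 i5 closedFD i7 i8 c8 c9 i11 i12 i13 by (intro conjI)
qed

text \<open>Row \<open>0\<close> is nowhere zero, so the lack of a candidate on the empty stack
  means that every vertex has been output. The sets of vertices with number at most \<open>t\<close>
  are then the wanted chain.\<close>

lemma search_inv_finish:
  assumes inv: "search_inv m E b lv row 0 N ot"
    and none: "\<forall>j<m. lv j \<noteq> 0 \<longrightarrow> row 0 j = 0"
  shows "\<And>j. j < m \<Longrightarrow> b < ot j \<and> ot j \<le> N" and "b \<le> N" and "N \<le> b + m"
    and "\<And>t. b < t \<Longrightarrow> t \<le> N \<Longrightarrow> \<exists>j<m. ot j = t"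
    and "\<And>t. b \<le> t \<Longrightarrow> t \<le> N \<Longrightarrow> closed_in m E {j. j < m \<and> ot j \<le> t}"
    and "\<And>S. closed_in m E S \<Longrightarrow> (\<forall>C. closed_in m E C \<longrightarrow> C \<subseteq> S \<or> S \<subseteq> C) \<Longrightarrow>
       \<exists>t. b \<le> t \<and> t \<le> N \<and> S = {j. j < m \<and> ot j \<le> t}"
proof -
  have z: "lv j = 0" if "j < m" for j using none search_invD(5)[OF inv that] that by auto
  have F: "{j. j < m \<and> lv j = 0} = {..<m}"
    "\<And>t. {j. j < m \<and> lv j = 0 \<and> ot j \<le> t} = {j. j < m \<and> ot j \<le> t}" using z by auto
  note D = search_invD[OF inv, unfolded F]
  show o: "b < ot j \<and> ot j \<le> N" if "j < m" for j using D(10)[OF that z[OF that]] .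
  show bN: "b \<le> N" using D(8) by blast
  show "N \<le> b + m" using D(9) by simp
  show "\<exists>j<m. ot j = t" if "b < t" "t \<le> N" for t using D(11)[OF that] by auto
  show "closed_in m E {j. j < m \<and> ot j \<le> t}" if "b \<le> t" "t \<le> N" for t using D(12)[OF that] .
  show "\<exists>t. b \<le> t \<and> t \<le> N \<and> S = {j. j < m \<and> ot j \<le> t}"
    if S: "closed_in m E S" "\<forall>C. closed_in m E C \<longrightarrow> C \<subseteq> S \<or> S \<subseteq> C" for S
  proof -
    have "{..<m} \<subseteq> S \<or> (\<exists>t. b \<le> t \<and> t \<le> N \<and> S = {j. j < m \<and> ot j \<le> t})"
      using D(13)[of S] S by blast
    moreover have "S = {j. j < m \<and> ot j \<le> N}" if "{..<m} \<subseteq> S"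
      using that S(1) o unfolding closed_in_def by auto
    ultimately show ?thesis using bN by blast
  qed
qed


section \<open>Computing a chain of closed sets\<close>

abbreviation (input) "r_count \<equiv> 18 :: nat"
abbreviation (input) "r_level \<equiv> 19 :: nat"
abbreviation (input) "r_found \<equiv> 20 :: nat"
abbreviation (input) "r_j \<equiv> 21 :: nat"
abbreviation (input) "r_run \<equiv> 22 :: nat"
abbreviation (input) "r_center \<equiv> 23 :: nat"
abbreviation (input) "r_new \<equiv> 24 :: nat"

abbreviation (input) "a_att \<equiv> 8 :: nat"
abbreviation (input) "a_start \<equiv> 9 :: nat"
abbreviation (input) "a_row \<equiv> 10 :: nat"
abbreviation (input) "a_lev \<equiv> 11 :: nat"

abbreviation row_addr :: "expr \<Rightarrow> expr" where
  "row_addr e \<equiv> Add (Mul e (Reg r_order)) (Reg r_j)"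

abbreviation for_j :: "com \<Rightarrow> com" where
  "for_j c \<equiv> Set r_j (Lit 0) ;; While (Less (Reg r_j) (Reg r_count)) (c ;; incr r_j)"

text \<open>Each iteration has an overhead of 8 units, 4 for the guard and 4 for the increment; the
  constant 6 covers the initialisation and the last guard. \<open>I (j + 1)\<close> is asserted of
  the state whose counter has already been increased.\<close>

lemma run_for_j:
  assumes c: "r_j \<notin> written_regs c" "r_count \<notin> written_regs c"
    and m: "reg s r_count = m" and k: "m * (t + 8) + 6 \<le> k"
    and init: "I 0 (s\<lparr>reg := (reg s)(r_j := 0)\<rparr>)"
    and step: "\<And>j k' s'. bounded B s' \<Longrightarrow> j < m \<Longrightarrow> reg s' r_j = j \<Longrightarrow> reg s' r_count = m \<Longrightarrow>
      agree (c ;; incr r_j) s s' \<Longrightarrow> I j s' \<Longrightarrow> t \<le> k' \<Longrightarrow>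
      run B c k' s' (\<lambda>k'' s''. I (j + 1) (s''\<lparr>reg := (reg s'')(r_j := j + 1)\<rparr>) \<and> k' \<le> k'' + t)"
    and exit: "\<And>k' s'. bounded B s' \<Longrightarrow> reg s' r_count = m \<Longrightarrow> reg s' r_j = m \<Longrightarrow>
      agree (c ;; incr r_j) s s' \<Longrightarrow> I m s' \<Longrightarrow> k \<le> k' + (m * (t + 8) + 6) \<Longrightarrow> Q k' s'"
  shows "run B (for_j c) k s Q"
proof -
  let ?b = "Less (Reg r_j) (Reg r_count)"
  define J where "J k' s' \<longleftrightarrow> reg s' r_j \<le> m \<and> I (reg s' r_j) s' \<and>
    k \<le> k' + reg s' r_j * (t + 8) + 2" for k' and s' :: ram
  let ?s = "s\<lparr>reg := (reg s)(r_j := 0)\<rparr>"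
  have "run B (While ?b (c ;; incr r_j)) (k - 2) ?s Q"
  proof (rule run_While[where I = J])
    show "J (k - 2) ?s" using init k unfolding J_def by simp
    fix k' s'
    assume B: "bounded B s'" and ag: "agree (c ;; incr r_j) ?s s'" and J: "J k' s'"
    have ag': "agree (c ;; incr r_j) s s'" using ag unfolding agree_def by simp
    have m': "reg s' r_count = m" using ag' m c unfolding agree_def by simp
    define j where "j = reg s' r_j"
    have J': "j \<le> m" "I j s'" "k \<le> k' + j * (t + 8) + 2"
      using J unfolding J_def j_def by blast+
    have "j * (t + 8) \<le> m * (t + 8)" using J'(1) by simp
    then have "4 \<le> k'" using J'(3) k by linarith
    then show c4: "cost ?b + 1 \<le> k'" by simp
    {
      assume "val s' ?b \<noteq> 0"
      then have lt: "j < m" using m' by (simp add: j_def split: if_splits)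
      then have "(j + 1) * (t + 8) \<le> m * (t + 8)" by (intro mult_right_mono) auto
      then have "j * (t + 8) + (t + 8) \<le> m * (t + 8)" by (simp add: algebra_simps)
      moreover define X Y where "X = j * (t + 8)" and "Y = m * (t + 8)"
      ultimately have k': "t + 8 \<le> k'" using J'(3) k by linarith
      have "run B c (k' - 4) s' (\<lambda>k s. run B (incr r_j) k s J)"
      proof (rule run_mono[OF step[OF B lt j_def[symmetric] m' ag' J'(2), of "k' - 4"]])
        fix k2 s2
        assume B2: "bounded B s2" and ag2: "agree c s' s2"
          and I2: "I (j + 1) (s2\<lparr>reg := (reg s2)(r_j := j + 1)\<rparr>) \<and> k' - 4 \<le> k2 + t"
        have j2: "reg s2 r_j = j" "reg s2 r_count = m" using ag2 c m' unfolding agree_def j_def by simp_all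
        have step_eq: "(j + 1) * (t + 8) = j * (t + 8) + (t + 8)" by (simp add: algebra_simps)
        have "m \<le> B" using B2 j2(2) bounded_reg by blast
        moreover have "4 \<le> k2" using I2 k' by linarith
        moreover have "J (k2 - 4) (s2\<lparr>reg := (reg s2)(r_j := j + 1)\<rparr>)"
          unfolding J_def using I2 lt J'(3) k' step_eq by simp linarith
        ultimately show "run B (incr r_j) k2 s2 J"
          by (intro run_Set) (use j2 lt I2 k' in \<open>simp_all add: word_def\<close>)
      qed (use k' in simp)
      then show "run B (c ;; incr r_j) (k' - (cost ?b + 1)) s' J"
        by (intro run_Seq) simp
    }
    {
      assume "val s' ?b = 0"
      then have "j = m" using J'(1) m' by (simp add: j_def split: if_splits)
      then show "Q (k' - (cost ?b + 1)) s'"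
        using J' c4 by (intro exit B m' ag') (simp_all add: j_def)
    }
  qed simp
  then show ?thesis
    by (intro run_Seq run_Set) (use k in \<open>simp_all add: word_def\<close>)
qed

text \<open>Conjunction is coded as a product and negation as subtraction from 1. The scan does not
  stop at a hit, so the last candidate wins, and \<open>r_found = r_count\<close> reports that there
  is none. On the empty stack level \<open>0\<close> addresses the row of the virtual block, so that
  any unreached vertex is found.\<close>

definition scan :: com where
  "scan =
     Set r_found (Reg r_count) ;;
     for_j
       (Cond (Mul (Mul (Less (Lit 0) (Cell a_lev (Reg r_j)))
                 (Sub (Lit 1) (Eq (Cell a_lev (Reg r_j)) (Reg r_level))))
               (Cell a_row (row_addr (Reg r_level))))
         (Set r_found (Reg r_j)) Skip)"

text \<open>Arcs are not stored in advance: the row of a block is computed from two matrix entries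
  per vertex when the block is created.\<close>

definition push_block :: com where
  "push_block =
     incr r_level ;;
     Store a_lev (Reg r_found) (Reg r_level) ;;
     Set r_new (Cell a_perm (Cell a_start (Reg r_found))) ;;
     for_j
       (Store a_row (row_addr (Reg r_level))
         (Sub (Lit 1)
           (Eq (mat (Cell a_perm (Cell a_start (Reg r_j))) (Reg r_center))
             (mat (Cell a_perm (Cell a_start (Reg r_j))) (Reg r_new)))))"

definition merge_block :: com where
  "merge_block =
     for_j
       (Cond (Eq (Cell a_lev (Reg r_j)) (Reg r_level))
          (Store a_lev (Reg r_j) (Sub (Reg r_level) (Lit 1))) Skip ;;
        Store a_row (row_addr (Sub (Reg r_level) (Lit 1)))
          (Less (Lit 0)
            (Add (Cell a_row (row_addr (Sub (Reg r_level) (Lit 1))))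
              (Cell a_row (row_addr (Reg r_level)))))) ;;
     Set r_level (Sub (Reg r_level) (Lit 1))"

text \<open>The parent \<open>r_nodes + 1\<close> is the next node of the chain, which does not
  exist yet; for the topmost node of the chain \<open>finish\<close> overwrites it.\<close>

definition pop_block :: com where
  "pop_block =
     incr r_nodes ;;
     Store a_par (Reg r_nodes) (Add (Reg r_nodes) (Lit 1)) ;;
     for_j
       (Cond (Eq (Cell a_lev (Reg r_j)) (Reg r_level))
          (Store a_att (Cell a_start (Reg r_j)) (Reg r_nodes) ;;
           Store a_lev (Reg r_j) (Lit 0)) Skip) ;;
     Set r_level (Sub (Reg r_level) (Lit 1))"

section \<open>The single steps of the search\<close>

definition candidate :: "ram \<Rightarrow> nat \<Rightarrow> bool" where
  "candidate s j \<longleftrightarrow> arr s a_lev j \<noteq> 0 \<and> arr s a_lev j \<noteq> reg s r_level \<and>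
     arr s a_row (reg s r_level * reg s r_order + j) \<noteq> 0"

lemma run_scan:
  assumes k: "29 * m + 8 \<le> k" and m: "reg s r_count = m" and B: "2 \<le> B"
    and Q: "\<And>k' s'. bounded B s' \<Longrightarrow> agree scan s s' \<Longrightarrow> k \<le> k' + (29 * m + 8) \<Longrightarrow>
      (reg s' r_found < m \<and> candidate s' (reg s' r_found)) \<or>
      (reg s' r_found = m \<and> (\<forall>j<m. \<not> candidate s' j)) \<Longrightarrow> Q k' s'"
  shows "run B scan k s Q"
proof -
  let ?s = "s\<lparr>reg := (reg s)(r_found := m)\<rparr>"
  let ?b = "Mul (Mul (Less (Lit 0) (Cell a_lev (Reg r_j)))
                 (Sub (Lit 1) (Eq (Cell a_lev (Reg r_j)) (Reg r_level))))
               (Cell a_row (row_addr (Reg r_level)))"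
  let ?c = "Cond ?b (Set r_found (Reg r_j)) Skip"
  let ?I = "\<lambda>j s'. (reg s' r_found < m \<and> candidate s' (reg s' r_found)) \<or>
        (reg s' r_found = m \<and> (\<forall>i<j. \<not> candidate s' i))"
  have "run B (for_j ?c) (k - 2) ?s Q"
  proof (rule run_for_j[where m = m and t = 21 and I = ?I], goal_cases)
    case (6 j k' s')
    have nv: "candidate (s'\<lparr>reg := (reg s')(r_j := x, r_found := y)\<rparr>) i \<longleftrightarrow> candidate s' i"
      "candidate (s'\<lparr>reg := (reg s')(r_j := x)\<rparr>) i \<longleftrightarrow> candidate s' i"
      "candidate (s'\<lparr>reg := (reg s')(r_found := y, r_j := x)\<rparr>) i \<longleftrightarrow> candidate s' i" for x y i
      unfolding candidate_def by simp_all
    have all: "(\<forall>i<j + 1. \<not> candidate s' i) \<longleftrightarrow> (\<forall>i<j. \<not> candidate s' i) \<and> \<not> candidate s' j"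
      by (auto simp: less_Suc_eq simp flip: Suc_eq_plus1)
    have val: "val s' ?b \<noteq> 0 \<longleftrightarrow> candidate s' j"
      using 6(3) unfolding candidate_def by simp
    show ?case
    proof (rule run_Cond)
      assume "val s' ?b \<noteq> 0"
      then have "candidate s' j" using val by simp
      then show "run B (Set r_found (Reg r_j)) (k' - (cost ?b + 1)) s'
          (\<lambda>k'' s''. ?I (j + 1) (s''\<lparr>reg := (reg s'')(r_j := j + 1)\<rparr>) \<and> k' \<le> k'' + 21)"
        by (intro run_intros) (use 6 bounded_reg[of B s' r_j] in \<open>simp_all add: bounded_reg nv\<close>)
    next
      assume "val s' ?b = 0"
      then have "\<not> candidate s' j" using val by simp
      then show "run B Skip (k' - (cost ?b + 1)) s'
          (\<lambda>k'' s''. ?I (j + 1) (s''\<lparr>reg := (reg s'')(r_j := j + 1)\<rparr>) \<and> k' \<le> k'' + 21)"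
        by (intro run_intros) (use 6 all in \<open>simp_all add: bounded_reg nv\<close>)
    qed (use 6 B in \<open>simp_all add: word_def\<close>)
  next
    case (7 k' s')
    then show ?case
      by (intro Q) (auto simp: agree_def scan_def)
  qed (use m k in simp_all)
  moreover have "m \<le> B" if "bounded B s" using bounded_reg[OF that, of r_count] m by simp
  moreover define body where "body = for_j ?c"
  ultimately show ?thesis
    unfolding scan_def
    by (fold body_def, intro run_Seq run_Set) (use m k in \<open>simp_all add: bounded_reg\<close>)
qed

lemma addr_eq_iff: "j < n \<Longrightarrow> j' < n \<Longrightarrow> i * n + j = i' * n + j' \<longleftrightarrow> i = i' \<and> j = j'"
  for n :: nat
proof
  assume j: "j < n" "j' < n" and eq: "i * n + j = i' * n + j'"
  have "i = (i * n + j) div n" "i' = (i' * n + j') div n" using j by auto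
  then have "i = i'" using eq by simp
  then show "i = i' \<and> j = j'" using eq by simp
qed simp

lemma run_push_block:
  assumes k: "33 * m + 17 \<le> c" and m: "reg s r_count = m" "m \<le> n" and mat: "matrix_in n a s"
    and w: "reg s r_found = w" "w < m" and l: "reg s r_level = k" "k + 1 \<le> B"
    and st: "\<And>j. j < m \<Longrightarrow> arr s a_start j < n" and bij: "bij_betw (arr s a_perm) {..<n} {..<n}"
    and v: "reg s r_center = v" "v < n"
    and r: "\<And>j. r j = arr s a_perm (arr s a_start j)"
    and Q: "\<And>c' s'. bounded B s' \<Longrightarrow> agree push_block s s' \<Longrightarrow> c \<le> c' + (33 * m + 17) \<Longrightarrow>
      reg s' r_level = k + 1 \<Longrightarrow> arr s' a_lev = (arr s a_lev)(w := k + 1) \<Longrightarrow>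
      (\<And>l. l < m \<Longrightarrow> arr s' a_row ((k + 1) * n + l) \<noteq> 0 \<longleftrightarrow> a (r l) v \<noteq> a (r l) (r w)) \<Longrightarrow>
      (\<And>i l. i \<le> k \<Longrightarrow> l < m \<Longrightarrow> arr s' a_row (i * n + l) = arr s a_row (i * n + l)) \<Longrightarrow> Q c' s'"
  shows "run B push_block c s Q"
proof -
  let ?st = "Store a_row (row_addr (Reg r_level))
         (Sub (Lit 1)
           (Eq (mat (Cell a_perm (Cell a_start (Reg r_j))) (Reg r_center))
             (mat (Cell a_perm (Cell a_start (Reg r_j))) (Reg r_new))))"
  let ?s = "s\<lparr>arr := (arr s)(a_lev := (arr s a_lev)(w := k + 1)), reg := (reg s)(r_level := k + 1, r_new := r w)\<rparr>"
  define I where "I j s' \<longleftrightarrow>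
    (\<forall>l<j. arr s' a_row ((k + 1) * n + l) \<noteq> 0 \<longleftrightarrow> a (r l) v \<noteq> a (r l) (r w)) \<and>
    (\<forall>i l. i \<le> k \<longrightarrow> l < m \<longrightarrow> arr s' a_row (i * n + l) = arr s a_row (i * n + l))" for j :: nat and s' :: ram
  have rn: "r j < n" if "j < m" for j
    using bij_betw_lessThan[OF bij st[OF that]] r by simp
  have "run B (for_j ?st) (c - 11) ?s Q"
  proof (rule run_for_j[where m = m and t = 25 and I = I], goal_cases)
    case (5)
    then show ?case unfolding I_def by simp
  next
    case (6 j c' s')
    have s': "reg s' r_level = k + 1" "reg s' r_new = r w" "reg s' r_center = v" "reg s' r_order = n"
      "arr s' a_perm = arr s a_perm" "arr s' a_start = arr s a_start" "arr s' a_mat = arr s a_mat"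
      using 6(5) mat v unfolding agree_def matrix_in_def by simp_all
    have av: "arr s a_mat (r j * n + v) = a (r j) v" "arr s a_mat (r j * n + r w) = a (r j) (r w)"
      using mat rn[OF 6(2)] rn[OF w(2)] v unfolding matrix_in_def by simp_all
    let ?x = "1 - of_bool (a (r j) v = a (r j) (r w)) :: nat"
    have I': "I (j + 1) (s'\<lparr>arr := (arr s')(a_row := (arr s' a_row)((k + 1) * n + j := ?x)),
        reg := (reg s')(r_j := j + 1)\<rparr>)"
      unfolding I_def
    proof (intro conjI allI impI)
      fix l assume "l < j + 1"
      then consider "l < j" | "l = j" by linarith
      then show "arr (s'\<lparr>arr := (arr s')(a_row := (arr s' a_row)((k + 1) * n + j := ?x)),
        reg := (reg s')(r_j := j + 1)\<rparr>) a_row ((k + 1) * n + l) \<noteq> 0 \<longleftrightarrow> a (r l) v \<noteq> a (r l) (r w)"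
        using 6(6) unfolding I_def by cases simp_all
    next
      fix i l assume "i \<le> k" "l < m"
      then show "arr (s'\<lparr>arr := (arr s')(a_row := (arr s' a_row)((k + 1) * n + j := ?x)),
        reg := (reg s')(r_j := j + 1)\<rparr>) a_row (i * n + l) = arr s a_row (i * n + l)"
        using 6(6) 6(2) m addr_eq_iff[of l n j i "k + 1"] unfolding I_def by simp
    qed
    have B1: "?x \<le> B" using l(2) by (simp add: of_bool_def)
    show ?case
      by (intro run_Store) (use I' B1 6 s' in \<open>simp_all add: word_def av r[symmetric]\<close>)
  next
    case (7 c' s')
    then show ?case
      using w l by (intro Q) (auto simp: agree_def push_block_def I_def)
  qed (use m k in simp_all)
  moreover have "w \<le> B" if "bounded B s" using bounded_reg[OF that, of r_found] w by simp
  moreover have "r w \<le> B" if "bounded B s"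
    using bounded_arr[OF that] r by simp
  moreover define rest where "rest = for_j ?st"
  ultimately show ?thesis
    unfolding push_block_def
    by (fold rest_def, intro run_Seq run_Set run_Store)
      (use w l k in \<open>simp_all add: word_def bounded_reg r fun_upd_twist\<close>)
qed

lemma run_merge_block:
  assumes k: "43 * m + 10 \<le> c" and m: "reg s r_count = m" "m \<le> n" and n: "reg s r_order = n"
    and l: "reg s r_level = k" "1 \<le> k" "2 \<le> B"
    and Q: "\<And>c' s'. bounded B s' \<Longrightarrow> agree merge_block s s' \<Longrightarrow> c \<le> c' + (43 * m + 10) \<Longrightarrow>
      reg s' r_level = k - 1 \<Longrightarrow>
      (\<And>j. j < m \<Longrightarrow> arr s' a_lev j = (if arr s a_lev j = k then k - 1 else arr s a_lev j)) \<Longrightarrow>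
      (\<And>l. l < m \<Longrightarrow> arr s' a_row ((k - 1) * n + l) \<noteq> 0 \<longleftrightarrow>
        arr s a_row ((k - 1) * n + l) \<noteq> 0 \<or> arr s a_row (k * n + l) \<noteq> 0) \<Longrightarrow>
      (\<And>i l. i < k - 1 \<Longrightarrow> l < m \<Longrightarrow> arr s' a_row (i * n + l) = arr s a_row (i * n + l)) \<Longrightarrow> Q c' s'"
  shows "run B merge_block c s Q"
proof -
  let ?c = "Cond (Eq (Cell a_lev (Reg r_j)) (Reg r_level))
          (Store a_lev (Reg r_j) (Sub (Reg r_level) (Lit 1))) Skip ;;
        Store a_row (row_addr (Sub (Reg r_level) (Lit 1)))
          (Less (Lit 0)
            (Add (Cell a_row (row_addr (Sub (Reg r_level) (Lit 1))))
              (Cell a_row (row_addr (Reg r_level)))))"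
  define L where "L = arr s a_lev"
  define R where "R i l = arr s a_row (i * n + l)" for i l
  define J where "J j lev row \<longleftrightarrow>
    (\<forall>i<m. lev i = (if i < j \<and> L i = k then k - 1 else L i)) \<and>
    (\<forall>l<m. row ((k - 1) * n + l) \<noteq> 0 \<longleftrightarrow> R (k - 1) l \<noteq> 0 \<or> (l < j \<and> R k l \<noteq> 0)) \<and>
    (\<forall>i l. i \<noteq> k - 1 \<longrightarrow> l < m \<longrightarrow> row (i * n + l) = R i l)" for j and lev row :: "nat \<Rightarrow> nat"
  define I where "I j s' \<longleftrightarrow> J j (arr s' a_lev) (arr s' a_row)" for j and s' :: ram
  have "run B (for_j ?c) c s (\<lambda>c s. run B (Set r_level (Sub (Reg r_level) (Lit 1))) c s Q)"
  proof (rule run_for_j[where m = m and t = 35 and I = I], goal_cases)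
    case (5)
    then show ?case unfolding I_def J_def L_def R_def by simp
  next
    case (6 j c' s')
    have s': "reg s' r_level = k" "reg s' r_order = n"
      using 6(5) n l unfolding agree_def by simp_all
    have kB: "k \<le> B" "j \<le> B" using bounded_reg[OF 6(1)] s'(1) 6(3) by metis+
    define lev row where "lev = arr s' a_lev" and "row = arr s' a_row"
    have J: "J j lev row" using 6(6) unfolding I_def lev_def row_def .
    have jm: "j < m" by fact
    have levj: "lev j = L j" using J jm unfolding J_def by simp
    have rowj: "row ((k - 1) * n + j) \<noteq> 0 \<longleftrightarrow> R (k - 1) j \<noteq> 0" "row (k * n + j) = R k j"
      using J jm l(2) unfolding J_def by auto
    let ?x = "of_bool (0 < row ((k - 1) * n + j) + row (k * n + j)) :: nat"
    have row': "row' ((k - 1) * n + l) \<noteq> 0 \<longleftrightarrow> R (k - 1) l \<noteq> 0 \<or> (l < j + 1 \<and> R k l \<noteq> 0)"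
        "i \<noteq> k - 1 \<Longrightarrow> row' (i * n + l) = R i l"
      if "l < m" "row' = row((k - 1) * n + j := ?x)" for l i row'
    proof -
      have "l \<noteq> j \<Longrightarrow> l < j + 1 \<longleftrightarrow> l < j" by linarith
      then show "row' ((k - 1) * n + l) \<noteq> 0 \<longleftrightarrow> R (k - 1) l \<noteq> 0 \<or> (l < j + 1 \<and> R k l \<noteq> 0)"
        using J that(1) m jm addr_eq_iff[of l n j "k - 1" "k - 1"] rowj
        unfolding J_def that(2) by (cases "l = j") auto
      show "i \<noteq> k - 1 \<Longrightarrow> row' (i * n + l) = R i l"
        using J that(1) m jm addr_eq_iff[of l n j i "k - 1"] unfolding J_def that(2) by auto
    qed
    have lev': "lev' i = (if i < j + 1 \<and> L i = k then k - 1 else L i)"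
      if "i < m" "lev' = (if lev j = k then lev(j := k - 1) else lev)" for i lev'
    proof -
      have "i \<noteq> j \<Longrightarrow> i < j + 1 \<longleftrightarrow> i < j" by linarith
      then show ?thesis using J that(1) levj unfolding J_def that(2) by (cases "i = j") auto
    qed
    have J1: "lev j = k \<Longrightarrow> J (j + 1) (lev(j := k - 1)) (row((k - 1) * n + j := ?x))"
      and J2: "lev j \<noteq> k \<Longrightarrow> J (j + 1) lev (row((k - 1) * n + j := ?x))"
      unfolding J_def using row' lev' by simp_all
    show ?case
      by (intro run_intros)
        (use J1 J2 kB l(3) 6 s' in \<open>simp_all add: word_def I_def flip: lev_def row_def\<close>)
  next
    case (7 c' s')
    have s': "reg s' r_level = k" using 7(4) l unfolding agree_def by simp
    have J: "J m (arr s' a_lev) (arr s' a_row)" using 7(5) unfolding I_def .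
    have kB: "k \<le> B" using bounded_reg[OF 7(1)] s'(1) by metis
    have "Q (c' - 4) (s'\<lparr>reg := (reg s')(r_level := k - 1)\<rparr>)"
      using 7 J kB k by (intro Q) (auto simp: agree_def merge_block_def J_def L_def R_def bounded_def)
    then show ?case
      by (intro run_Set) (use 7 s' k kB l in \<open>simp_all add: word_def\<close>)
  qed (use m k in simp_all)
  moreover define body where "body = for_j ?c"
  ultimately show ?thesis
    unfolding merge_block_def by (fold body_def, intro run_Seq) simp
qed

lemma run_pop_block:
  assumes k: "20 * m + 19 \<le> c" and m: "reg s r_count = m"
    and l: "reg s r_level = k" "1 \<le> k" and N: "reg s r_nodes = N" "N + 2 \<le> B"
    and inj: "inj_on (arr s a_start) {..<m}"
    and Q: "\<And>c' s'. bounded B s' \<Longrightarrow> agree pop_block s s' \<Longrightarrow> c \<le> c' + (20 * m + 19) \<Longrightarrow>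
      reg s' r_level = k - 1 \<Longrightarrow> reg s' r_nodes = N + 1 \<Longrightarrow>
      arr s' a_par = (arr s a_par)(N + 1 := N + 2) \<Longrightarrow>
      (\<And>j. j < m \<Longrightarrow> arr s' a_lev j = (if arr s a_lev j = k then 0 else arr s a_lev j)) \<Longrightarrow>
      (\<And>j. j < m \<Longrightarrow> arr s' a_att (arr s a_start j) =
        (if arr s a_lev j = k then N + 1 else arr s a_att (arr s a_start j))) \<Longrightarrow>
      (\<And>q. q \<notin> arr s a_start ` {..<m} \<Longrightarrow> arr s' a_att q = arr s a_att q) \<Longrightarrow> Q c' s'"
  shows "run B pop_block c s Q"
proof -
  let ?c = "Cond (Eq (Cell a_lev (Reg r_j)) (Reg r_level))
          (Store a_att (Cell a_start (Reg r_j)) (Reg r_nodes) ;;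
           Store a_lev (Reg r_j) (Lit 0)) Skip"
  define L where "L = arr s a_lev"
  define T where "T = arr s a_att"
  define st where "st = arr s a_start"
  define J where "J j lev att \<longleftrightarrow>
    (\<forall>i<m. lev i = (if i < j \<and> L i = k then 0 else L i)) \<and>
    (\<forall>i<m. att (st i) = (if i < j \<and> L i = k then N + 1 else T (st i))) \<and>
    (\<forall>q. q \<notin> st ` {..<m} \<longrightarrow> att q = T q)" for j and lev att :: "nat \<Rightarrow> nat"
  define I where "I j s' \<longleftrightarrow> J j (arr s' a_lev) (arr s' a_att)" for j and s' :: ram
  let ?s = "s\<lparr>reg := (reg s)(r_nodes := N + 1), arr := (arr s)(a_par := (arr s a_par)(N + 1 := N + 1 + 1))\<rparr>"
  have "run B (for_j ?c) (c - 9) ?s (\<lambda>c s. run B (Set r_level (Sub (Reg r_level) (Lit 1))) c s Q)"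
  proof (rule run_for_j[where m = m and t = 12 and I = I], goal_cases)
    case (5)
    then show ?case unfolding I_def J_def L_def T_def st_def by simp
  next
    case (6 j c' s')
    have s': "reg s' r_level = k" "reg s' r_nodes = N + 1" "arr s' a_start = st"
      using 6(5) l unfolding agree_def st_def by simp_all
    have jB: "j \<le> B" using bounded_reg[OF 6(1)] 6(3) by metis
    define lev att where "lev = arr s' a_lev" and "att = arr s' a_att"
    have J: "J j lev att" using 6(6) unfolding I_def lev_def att_def .
    have jm: "j < m" by fact
    have levj: "lev j = L j" using J jm unfolding J_def by simp
    have ij: "i < j + 1 \<longleftrightarrow> i < j" if "i \<noteq> j" for i using that by linarith
    have sti: "st i = st j \<longleftrightarrow> i = j" if "i < m" for i
      using inj that jm unfolding st_def inj_on_def by auto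
    have J1: "J (j + 1) (lev(j := 0)) (att(st j := N + 1))" if "lev j = k"
      unfolding J_def
    proof (intro conjI allI impI)
      fix i assume i: "i < m"
      show "(lev(j := 0)) i = (if i < j + 1 \<and> L i = k then 0 else L i)"
        using J i ij[of i] levj that unfolding J_def by (cases "i = j") auto
      show "(att(st j := N + 1)) (st i) = (if i < j + 1 \<and> L i = k then N + 1 else T (st i))"
        using J i ij[of i] levj that sti[OF i] unfolding J_def by (cases "i = j") auto
    next
      fix q assume "q \<notin> st ` {..<m}"
      then show "(att(st j := N + 1)) q = T q" using J jm unfolding J_def by auto
    qed
    have J2: "J (j + 1) lev att" if "lev j \<noteq> k"
      unfolding J_def
    proof (intro conjI allI impI)
      fix i assume i: "i < m"
      show "lev i = (if i < j + 1 \<and> L i = k then 0 else L i)"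
        using J i ij[of i] levj that unfolding J_def by (cases "i = j") auto
      show "att (st i) = (if i < j + 1 \<and> L i = k then N + 1 else T (st i))"
        using J i ij[of i] levj that unfolding J_def by (cases "i = j") auto
    next
      fix q assume "q \<notin> st ` {..<m}"
      then show "att q = T q" using J unfolding J_def by auto
    qed
    show ?case
      by (intro run_intros)
        (use J1 J2 N(2) jB 6 s' in \<open>simp_all add: word_def I_def flip: lev_def att_def\<close>)
  next
    case (7 c' s')
    have s': "reg s' r_level = k" using 7(4) l unfolding agree_def by simp
    have J: "J m (arr s' a_lev) (arr s' a_att)" using 7(5) unfolding I_def .
    have kB: "k \<le> B" using bounded_reg[OF 7(1)] s'(1) by metis
    have "Q (c' - 4) (s'\<lparr>reg := (reg s')(r_level := k - 1)\<rparr>)"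
      using 7 J kB k by (intro Q) (auto simp: agree_def pop_block_def J_def L_def T_def st_def bounded_def)
    then show ?case
      by (intro run_Set) (use 7 s' k kB l in \<open>simp_all add: word_def\<close>)
  qed (use m k in simp_all)
  moreover define body where "body = for_j ?c"
  ultimately show ?thesis
    unfolding pop_block_def
    by (fold body_def, intro run_Seq run_Set run_Store)
      (use N k in \<open>simp_all add: word_def\<close>)
qed

text \<open>An unreached vertex has level \<open>m + 1\<close>, above every level on the stack. So
  one comparison tells whether the candidate is to be pushed or lies in a lower block, which calls
  for a merge.\<close>

definition search_body :: com where
  "search_body =
     scan ;;
     Cond (Eq (Reg r_found) (Reg r_count))
       (Cond (Eq (Reg r_level) (Lit 0)) (Set r_run (Lit 0)) pop_block)
       (Cond (Less (Reg r_level) (Cell a_lev (Reg r_found))) push_block merge_block)"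

definition search :: com where
  "search =
     Set r_level (Lit 0) ;;
     for_j (Store a_lev (Reg r_j) (Add (Reg r_count) (Lit 1)) ;; Store a_row (Reg r_j) (Lit 1)) ;;
     Set r_run (Lit 1) ;;
     While (Reg r_run) search_body"

lemmas search_written = search_body_def scan_def push_block_def merge_block_def pop_block_def

text \<open>At most \<open>2 * white + level + 1\<close> iterations remain: a push removes an
  unreached vertex and adds a level, a merge or a pop removes a level, and the last iteration clears
  \<open>r_run\<close>. Each takes at most \<open>72 * m + 40\<close> units, where 72 is 29 for the
  scan plus 43 for the most expensive branch, the merge.\<close>

lemma run_search:
  assumes m: "reg s r_count = m" "m \<le> n" and mat: "matrix_in n a s"
    and B: "b + m + 2 \<le> B" "n + 2 \<le> B" and b: "reg s r_nodes = b"
    and st: "st = arr s a_start" "\<And>j. j < m \<Longrightarrow> st j < n" "inj_on st {..<m}"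
    and bij: "bij_betw (arr s a_perm) {..<n} {..<n}"
    and v: "reg s r_center = v" "v < n"
    and r: "\<And>j. r j = arr s a_perm (st j)"
    and E: "\<And>j l. E j l \<longleftrightarrow> a (r l) v \<noteq> a (r l) (r j)"
    and c: "(2 * m + 1) * (72 * m + 40) + 16 * m + 12 + z \<le> c"
    and Q: "\<And>c' s'. bounded B s' \<Longrightarrow> agree search s s' \<Longrightarrow> z \<le> c' \<Longrightarrow>
      search_inv m E b (arr s' a_lev) (\<lambda>i l. arr s' a_row (i * n + l)) 0 (reg s' r_nodes)
        (\<lambda>j. arr s' a_att (st j)) \<Longrightarrow>
      (\<And>j. j < m \<Longrightarrow> arr s' a_lev j \<noteq> 0 \<Longrightarrow> arr s' a_row (0 * n + j) = 0) \<Longrightarrow>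
      (\<And>q. q \<notin> st ` {..<m} \<Longrightarrow> arr s' a_att q = arr s a_att q) \<Longrightarrow>
      (\<And>u. arr s' a_par u = (if b < u \<and> u \<le> reg s' r_nodes then u + 1 else arr s a_par u)) \<Longrightarrow>
      Q c' s'"
  shows "run B search c s Q"
proof -
  define inv where "inv s' \<longleftrightarrow> search_inv m E b (arr s' a_lev) (\<lambda>i l. arr s' a_row (i * n + l))
      (reg s' r_level) (reg s' r_nodes) (\<lambda>j. arr s' a_att (st j)) \<and>
    (\<forall>q. q \<notin> st ` {..<m} \<longrightarrow> arr s' a_att q = arr s a_att q) \<and>
    (\<forall>u. arr s' a_par u = (if b < u \<and> u \<le> reg s' r_nodes then u + 1 else arr s a_par u))" for s' :: ram
  define white where "white lv = card {j. j < m \<and> lv j = m + 1}" for lv :: "nat \<Rightarrow> nat"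
  define K where "K = 72 * m + 40"
  define I where "I c' s' \<longleftrightarrow> inv s' \<and>
    (if reg s' r_run = 0
     then 2 + z \<le> c' \<and> reg s' r_level = 0 \<and> (\<forall>j<m. arr s' a_lev j \<noteq> 0 \<longrightarrow> arr s' a_row j = 0)
     else (2 * white (arr s' a_lev) + reg s' r_level + 1) * K + 2 + z \<le> c')" for c' and s' :: ram
  let ?st = "Store a_lev (Reg r_j) (Add (Reg r_count) (Lit 1)) ;; Store a_row (Reg r_j) (Lit 1)"
  have while: "run B (While (Reg r_run) search_body) c2 s2 Q"
    if I2: "I c2 s2" and ag2: "agree search s s2" for c2 s2
  proof (rule run_While[where I = I, OF I2])
    fix c3 s3
    assume B3: "bounded B s3" and ag: "agree search_body s2 s3" and I3: "I c3 s3"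
    have ag3: "agree search s s3"
      using ag ag2 unfolding agree_def search_def by simp
    have s3: "reg s3 r_count = m" "matrix_in n a s3" "arr s3 a_start = st" "reg s3 r_center = v"
      "arr s3 a_perm = arr s a_perm" "reg s3 r_order = n"
      using ag3 m mat v st unfolding agree_def search_def search_written matrix_in_def by simp_all
    show "cost (Reg r_run) + 1 \<le> c3" using I3 unfolding I_def by (auto split: if_splits)
    {
      assume run: "val s3 (Reg r_run) \<noteq> 0"
      define k where "k = reg s3 r_level"
      define W where "W = white (arr s3 a_lev)"
      have inv3: "inv s3" and c3: "(2 * W + k + 1) * K + 2 + z \<le> c3"
        using I3 run unfolding I_def W_def k_def by auto
      note si = inv3[unfolded inv_def, THEN conjunct1, folded k_def]
      have rest3: "\<forall>q. q \<notin> st ` {..<m} \<longrightarrow> arr s3 a_att q = arr s a_att q"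
        "\<forall>u. arr s3 a_par u = (if b < u \<and> u \<le> reg s3 r_nodes then u + 1 else arr s a_par u)"
        using inv3 unfolding inv_def by blast+
      have c3': "(2 * W + k) * K + K + 2 + z \<le> c3" using c3 by (simp add: algebra_simps)
      have km: "k \<le> m" using search_invD(2)[OF si] by linarith
      show "run B search_body (c3 - (cost (Reg r_run) + 1)) s3 I"
        unfolding search_body_def
      proof (rule run_Seq, rule run_scan[OF _ s3(1)])
        show "29 * m + 8 \<le> c3 - (cost (Reg r_run) + 1)"
          using c3' unfolding K_def by simp
        show "2 \<le> B" using B by simp
        fix c4 s4
        assume B4: "bounded B s4" and ag4: "agree scan s3 s4"
          and c4: "c3 - (cost (Reg r_run) + 1) \<le> c4 + (29 * m + 8)"
          and found: "(reg s4 r_found < m \<and> candidate s4 (reg s4 r_found)) \<or>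
            (reg s4 r_found = m \<and> (\<forall>j<m. \<not> candidate s4 j))"
        have s4: "reg s4 r_count = m" "matrix_in n a s4" "arr s4 a_start = st" "reg s4 r_center = v"
          "arr s4 a_perm = arr s a_perm" "reg s4 r_level = k" "arr s4 = arr s3" "reg s4 r_order = n"
          "reg s4 r_nodes = reg s3 r_nodes" "reg s4 r_run = reg s3 r_run"
          using ag4 s3 k_def unfolding agree_def scan_def matrix_in_def by (simp_all add: fun_eq_iff)
        have c4': "(2 * W + k) * K + 43 * m + 32 + z \<le> c4"
          using c4 c3' unfolding K_def by simp
        define lv where "lv = arr s3 a_lev"
        define w where "w = reg s4 r_found"
        have cand: "candidate s4 j \<longleftrightarrow> lv j \<noteq> 0 \<and> lv j \<noteq> k \<and> arr s3 a_row (k * n + j) \<noteq> 0" for j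
          unfolding candidate_def s4 lv_def ..
        have kB: "k + 1 \<le> B" using km B by simp
        have run_pop: "run B pop_block (c4 - 8) s4 I" if none: "\<forall>j<m. \<not> candidate s4 j" and k0: "k \<noteq> 0"
        proof (rule run_pop_block[OF _ s4(1,6) _ refl])
          have "1 * K \<le> (2 * W + k) * K" by (intro mult_right_mono) (use k0 in auto)
          then show "20 * m + 19 \<le> c4 - 8" using c4' unfolding K_def by linarith
          show k1: "1 \<le> k" using k0 by linarith
          have "reg s3 r_nodes \<le> b + card {j. j < m \<and> arr s3 a_lev j = 0}"
            using search_invD(9)[OF si] .
          moreover have "card {j. j < m \<and> arr s3 a_lev j = 0} \<le> m"
            using card_mono[of "{..<m}" "{j. j < m \<and> arr s3 a_lev j = 0}"] by auto
          ultimately show "reg s4 r_nodes + 2 \<le> B" using B(1) s4(9) by simp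
          show "inj_on (arr s4 a_start) {..<m}" using st s4 by simp
          fix c5 s5
          assume B5: "bounded B s5" and ag5: "agree pop_block s4 s5" and c5: "c4 - 8 \<le> c5 + (20 * m + 19)"
            and l5: "reg s5 r_level = k - 1" "reg s5 r_nodes = reg s4 r_nodes + 1"
            and par5: "arr s5 a_par = (arr s4 a_par)(reg s4 r_nodes + 1 := reg s4 r_nodes + 2)"
            and lev5: "\<And>j. j < m \<Longrightarrow> arr s5 a_lev j = (if arr s4 a_lev j = k then 0 else arr s4 a_lev j)"
            and att5: "\<And>j. j < m \<Longrightarrow> arr s5 a_att (arr s4 a_start j) =
              (if arr s4 a_lev j = k then reg s4 r_nodes + 1 else arr s4 a_att (arr s4 a_start j))"
              "\<And>q. q \<notin> arr s4 a_start ` {..<m} \<Longrightarrow> arr s5 a_att q = arr s4 a_att q"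
          have row5: "arr s5 a_row = arr s3 a_row" "reg s5 r_run = reg s3 r_run"
            using ag5 s4 unfolding agree_def pop_block_def by simp_all
          have none': "arr s3 a_row (k * n + j) = 0" if "j < m" "arr s3 a_lev j \<noteq> 0" "arr s3 a_lev j \<noteq> k" for j
            using none that cand[of j] unfolding lv_def by blast
          note pop = search_inv_pop[OF si k1 none', of "arr s5 a_lev" "\<lambda>j. arr s5 a_att (st j)"]
          have "search_inv m E b (arr s5 a_lev) (\<lambda>i l. arr s3 a_row (i * n + l)) (k - 1) (reg s3 r_nodes + 1)
              (\<lambda>j. arr s5 a_att (st j))"
            by (rule pop(1)) (use lev5 att5 s4 in simp_all)
          moreover have W5: "white (arr s5 a_lev) = W"
            unfolding white_def W_def by (rule pop(2)) (use lev5 att5 s4 in simp_all)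
          moreover have "b \<le> reg s3 r_nodes" using search_invD(8)[OF si] .
          ultimately have "inv s5"
            unfolding inv_def l5 row5 using rest3 par5 att5(2) s4 by auto
          moreover obtain k' where k': "k = k' + 1" using k1 le_Suc_ex[of 1 k] by (metis add.commute)
          have "(2 * W + k' + 1) * K + 2 + z \<le> c5"
            using c4' c5 unfolding k' K_def by (simp add: algebra_simps)
          ultimately show "I c5 s5"
            unfolding I_def using W5 l5 row5 run k' by simp
        qed
        have run_push: "run B push_block (c4 - 9) s4 I" if wm: "w < m" and wc: "candidate s4 w" and kw: "k < lv w"
        proof (rule run_push_block[OF _ s4(1) m(2) s4(2) w_def[symmetric] wm s4(6) kB, where v = v and r = r])
          have lw: "lv w = m + 1" using search_invD(1)[OF si wm] kw unfolding lv_def by linarith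
          have "W \<noteq> 0" unfolding W_def white_def using wm lw by (auto simp: card_eq_0_iff lv_def)
          then have W1: "1 \<le> W" by linarith
          have "1 * K \<le> (2 * W + k) * K" by (intro mult_right_mono) (use W1 in auto)
          then show "33 * m + 17 \<le> c4 - 9" using c4' unfolding K_def by linarith
          show "arr s4 a_start j < n" if "j < m" for j using st that s4 by simp
          show "bij_betw (arr s4 a_perm) {..<n} {..<n}" using bij s4 by simp
          show "reg s4 r_center = v" "v < n" by (fact s4(4) v(2))+
          show "r j = arr s4 a_perm (arr s4 a_start j)" for j using r s4 by simp
          fix c5 s5
          assume B5: "bounded B s5" and ag5: "agree push_block s4 s5" and c5: "c4 - 9 \<le> c5 + (33 * m + 17)"
            and l5: "reg s5 r_level = k + 1" and lev5: "arr s5 a_lev = (arr s4 a_lev)(w := k + 1)"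
            and row5: "\<And>l. l < m \<Longrightarrow> arr s5 a_row ((k + 1) * n + l) \<noteq> 0 \<longleftrightarrow> a (r l) v \<noteq> a (r l) (r w)"
              "\<And>i l. i \<le> k \<Longrightarrow> l < m \<Longrightarrow> arr s5 a_row (i * n + l) = arr s4 a_row (i * n + l)"
          have s5: "arr s5 a_att = arr s3 a_att" "arr s5 a_par = arr s3 a_par" "reg s5 r_run = reg s3 r_run"
            "reg s5 r_nodes = reg s3 r_nodes"
            using ag5 s4 unfolding agree_def push_block_def by simp_all
          have rw: "arr s3 a_row (k * n + w) \<noteq> 0" using wc cand by simp
          note push = search_inv_push[OF si wm lw[unfolded lv_def] rw, of "arr s5 a_lev"
              "\<lambda>i l. arr s5 a_row (i * n + l)"]
          have "search_inv m E b (arr s5 a_lev) (\<lambda>i l. arr s5 a_row (i * n + l)) (k + 1) (reg s3 r_nodes)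
              (\<lambda>j. arr s3 a_att (st j))"
            by (rule push(1)) (use lev5 row5 s4 E in simp_all)
          moreover have W5: "white (arr s5 a_lev) + 1 = W"
            unfolding white_def W_def by (rule push(2)) (use lev5 row5 s4 E in simp_all)
          ultimately have "inv s5"
            unfolding inv_def l5 s5 using rest3 by auto
          moreover have "(2 * white (arr s5 a_lev) + (k + 1) + 1) * K + 2 + z \<le> c5"
            using c4' c5 unfolding W5[symmetric] K_def by (simp add: algebra_simps)
          ultimately show "I c5 s5"
            unfolding I_def using l5 s5 run by simp
        qed
        have run_merge: "run B merge_block (c4 - 9) s4 I" if wm: "w < m" and wc: "candidate s4 w" and kw: "\<not> k < lv w"
        proof (rule run_merge_block[OF _ s4(1) m(2) s4(8) s4(6)])
          have lw: "1 \<le> lv w" "lv w < k" using kw wc cand[of w] by linarith+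
          have "1 * K \<le> (2 * W + k) * K" by (intro mult_right_mono) (use lw in auto)
          then show "43 * m + 10 \<le> c4 - 9" using c4' unfolding K_def by linarith
          show "1 \<le> k" "2 \<le> B" using lw B by linarith+
          fix c5 s5
          assume B5: "bounded B s5" and ag5: "agree merge_block s4 s5" and c5: "c4 - 9 \<le> c5 + (43 * m + 10)"
            and l5: "reg s5 r_level = k - 1"
            and lev5: "\<And>j. j < m \<Longrightarrow> arr s5 a_lev j = (if arr s4 a_lev j = k then k - 1 else arr s4 a_lev j)"
            and row5: "\<And>l. l < m \<Longrightarrow> arr s5 a_row ((k - 1) * n + l) \<noteq> 0 \<longleftrightarrow>
                arr s4 a_row ((k - 1) * n + l) \<noteq> 0 \<or> arr s4 a_row (k * n + l) \<noteq> 0"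
              "\<And>i l. i < k - 1 \<Longrightarrow> l < m \<Longrightarrow> arr s5 a_row (i * n + l) = arr s4 a_row (i * n + l)"
          have s5: "arr s5 a_att = arr s3 a_att" "arr s5 a_par = arr s3 a_par" "reg s5 r_run = reg s3 r_run"
            "reg s5 r_nodes = reg s3 r_nodes"
            using ag5 s4 unfolding agree_def merge_block_def by simp_all
          have rw: "arr s3 a_row (k * n + w) \<noteq> 0" using wc cand by simp
          note merge = search_inv_merge[OF si wm lw[unfolded lv_def] rw, of "arr s5 a_lev"
              "\<lambda>i l. arr s5 a_row (i * n + l)"]
          have "search_inv m E b (arr s5 a_lev) (\<lambda>i l. arr s5 a_row (i * n + l)) (k - 1) (reg s3 r_nodes)
              (\<lambda>j. arr s3 a_att (st j))"
            by (rule merge(1)) (use lev5 row5 s4 in simp_all)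
          moreover have W5: "white (arr s5 a_lev) = W"
            unfolding white_def W_def by (rule merge(2)) (use lev5 row5 s4 in simp_all)
          ultimately have "inv s5"
            unfolding inv_def l5 s5 using rest3 by auto
          moreover obtain k' where k': "k = k' + 1" using lw(2) le_Suc_ex[of 1 k] by (metis add.commute less_one linorder_not_le not_less0)
          have "(2 * W + k' + 1) * K + 2 + z \<le> c5"
            using c4' c5 unfolding k' K_def by (simp add: algebra_simps)
          ultimately show "I c5 s5"
            unfolding I_def using l5 s5 run W5 k' by simp
        qed
        show "run B (Cond (Eq (Reg r_found) (Reg r_count))
            (Cond (Eq (Reg r_level) (Lit 0)) (Set r_run (Lit 0)) pop_block)
            (Cond (Less (Reg r_level) (Cell a_lev (Reg r_found))) push_block merge_block)) c4 s4 I"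
        proof (intro run_Cond, goal_cases)
          case 5
          have none: "\<forall>j<m. \<not> candidate s4 j" using 5 found s4 by (simp split: if_splits)
          have k0: "k = 0" using 5 s4 by (simp split: if_splits)
          have "I (c4 - 10) (s4\<lparr>reg := (reg s4)(r_run := 0)\<rparr>)"
            unfolding I_def inv_def
            using si rest3 none cand k0 s4 c4' by (auto simp: lv_def)
          then show ?case
            by (intro run_Set) (use c4' in \<open>simp_all add: word_def\<close>)
        next
          case 6
          then show ?case using run_pop found s4 by (simp split: if_splits)
        next
          case 9
          then show ?case using run_push found s4 by (simp add: lv_def w_def split: if_splits)
        next
          case 10
          then show ?case using run_merge found s4 by (simp add: lv_def w_def split: if_splits)
        qed (use c4' in \<open>simp_all add: word_def\<close>)
      qed
    }
    {
      assume "val s3 (Reg r_run) = 0"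
      then show "Q (c3 - (cost (Reg r_run) + 1)) s3"
        using I3 unfolding I_def inv_def by (intro Q B3 ag3) auto
    }
  qed simp
  define J where "J j s' \<longleftrightarrow> (\<forall>i<j. arr s' a_lev i = m + 1 \<and> arr s' a_row i = 1)" for j and s' :: ram
  let ?s = "s\<lparr>reg := (reg s)(r_level := 0)\<rparr>"
  have "run B (for_j ?st) (c - 2) ?s (\<lambda>c s. run B (Set r_run (Lit 1) ;; While (Reg r_run) search_body) c s Q)"
  proof (rule run_for_j[where m = m and t = 8 and I = J], goal_cases)
    case (4)
    then show ?case using c by simp
  next
    case (5)
    then show ?case unfolding J_def by simp
  next
    case (6 j c' s')
    have jB: "j \<le> B" using bounded_reg[OF 6(1)] 6(3) by metis
    have J1: "J (j + 1) (s'\<lparr>arr := (arr s')(a_lev := (arr s' a_lev)(j := m + 1), a_row := (arr s' a_row)(j := 1)),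
        reg := (reg s')(r_j := j + 1)\<rparr>)"
      unfolding J_def
    proof (intro allI impI)
      fix i assume "i < j + 1"
      then consider "i < j" | "i = j" by linarith
      then show "arr (s'\<lparr>arr := (arr s')(a_lev := (arr s' a_lev)(j := m + 1), a_row := (arr s' a_row)(j := 1)),
          reg := (reg s')(r_j := j + 1)\<rparr>) a_lev i = m + 1 \<and>
        arr (s'\<lparr>arr := (arr s')(a_lev := (arr s' a_lev)(j := m + 1), a_row := (arr s' a_row)(j := 1)),
          reg := (reg s')(r_j := j + 1)\<rparr>) a_row i = 1"
        using 6(6) unfolding J_def by cases simp_all
    qed
    show ?case
      by (intro run_Seq run_Store) (use J1 jB B m 6 in \<open>simp_all add: word_def\<close>)
  next
    case (7 c' s')
    let ?s2 = "s'\<lparr>reg := (reg s')(r_run := 1)\<rparr>"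
    have s': "reg s' r_nodes = b" "arr s' a_att = arr s a_att" "arr s' a_par = arr s a_par" "reg s' r_level = 0"
      using 7(4) b unfolding agree_def by simp_all
    have J: "arr s' a_lev i = m + 1" "arr s' a_row i = 1" if "i < m" for i
      using 7(5) that unfolding J_def by blast+
    have "search_inv m E b (arr s' a_lev) (\<lambda>i l. arr s' a_row (i * n + l)) 0 b (\<lambda>j. arr s' a_att (st j))"
      by (rule search_inv_init) (use J in simp_all)
    then have "inv ?s2"
      unfolding inv_def using s' by simp
    moreover have "{j. j < m \<and> arr s' a_lev j = m + 1} = {..<m}" using J by auto
    then have "white (arr s' a_lev) = m" unfolding white_def by simp
    moreover have c': "(2 * m + 1) * K + 4 + z \<le> c'" using 7(6) c unfolding K_def by simp
    ultimately have "I (c' - 2) ?s2" unfolding I_def using s' by simp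
    moreover have "agree search s ?s2"
      using 7(4) unfolding agree_def search_def by simp
    ultimately have "run B (While (Reg r_run) search_body) (c' - 2) ?s2 Q"
      by (rule while)
    then show ?case
      by (intro run_Seq run_Set) (use c' B in \<open>simp_all add: word_def\<close>)
  qed (use m in simp_all)
  moreover define body where "body = for_j ?st"
  moreover define rest where "rest = (Set r_run (Lit 1) ;; While (Reg r_run) search_body)"
  ultimately show ?thesis
    unfolding search_def
    by (fold body_def rest_def, intro run_Seq run_Set)
      (use c in \<open>simp_all add: word_def\<close>)
qed


section \<open>Chains of modules around a center\<close>

definition good_matrix :: "nat \<Rightarrow> (nat \<Rightarrow> nat \<Rightarrow> nat) \<Rightarrow> bool" where
  "good_matrix n a \<longleftrightarrow> (\<forall>M. matrix_module n a M \<longrightarrow>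
     (\<forall>x\<in>M. \<forall>y\<in>M. \<forall>s\<in>{..<n} - M. \<forall>t\<in>{..<n} - M. a x s = a x t \<longleftrightarrow> a y s = a y t))"

definition strong_matrix_module :: "nat \<Rightarrow> (nat \<Rightarrow> nat \<Rightarrow> nat) \<Rightarrow> nat set \<Rightarrow> bool" where
  "strong_matrix_module n a M \<longleftrightarrow>
     matrix_module n a M \<and> (\<forall>N. matrix_module n a N \<longrightarrow> \<not> overlap M N)"

lemma matrix_moduleD: "matrix_module n a M \<Longrightarrow> x < n \<Longrightarrow> x \<notin> M \<Longrightarrow> y \<in> M \<Longrightarrow> z \<in> M \<Longrightarrow> a x y = a x z"
  unfolding matrix_module_def uniform_def by blast

text \<open>\<open>E j l\<close> says that a module containing \<open>v\<close> and
  \<open>r j\<close> must contain \<open>r l\<close>, which would distinguish them from outside.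
  Closedness is thus necessary for modules around \<open>v\<close> made of whole parts; goodness
  makes it sufficient.\<close>

locale center =
  fixes n :: nat and a :: "nat \<Rightarrow> nat \<Rightarrow> nat" and P :: "nat set" and v m :: nat
    and Q :: "nat \<Rightarrow> nat set" and r :: "nat \<Rightarrow> nat" and E :: "nat \<Rightarrow> nat \<Rightarrow> bool"
  assumes good: "good_matrix n a"
    and P: "matrix_module n a P" "P = insert v (\<Union>j<m. Q j)"
    and Q: "j < m \<Longrightarrow> matrix_module n a (Q j)" "j < m \<Longrightarrow> r j \<in> Q j" "j < m \<Longrightarrow> v \<notin> Q j"
    and disjoint: "i < m \<Longrightarrow> j < m \<Longrightarrow> i \<noteq> j \<Longrightarrow> Q i \<inter> Q j = {}"
    and E: "E j l \<longleftrightarrow> a (r l) v \<noteq> a (r l) (r j)"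
begin

lemma bounds: "v < n" "j < m \<Longrightarrow> Q j \<subseteq> {..<n}" "P \<subseteq> {..<n}"
  using P Q(1) unfolding matrix_module_def by auto

text \<open>A point \<open>x\<close> outside of \<open>P\<close> is handled by the module
  \<open>P\<close>. If \<open>x\<close> lies in a part \<open>Q l\<close> outside of the set, the
  missing arc says that \<open>r l\<close> does not distinguish \<open>v\<close> from
  \<open>r j\<close>; goodness for the module \<open>Q l\<close> carries this from
  \<open>r l\<close> to \<open>x\<close>, and the module \<open>Q j\<close> carries it from
  \<open>r j\<close> to all of \<open>Q j\<close>.\<close>

lemma module_of_closed:
  assumes C: "closed_in m E C"
  shows "matrix_module n a (insert v (\<Union>j\<in>C. Q j))"
proof -
  let ?M = "insert v (\<Union>j\<in>C. Q j)"
  have Cm: "C \<subseteq> {..<m}" using C unfolding closed_in_def by blast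
  have sub: "?M \<subseteq> P" using Cm P(2) by auto
  have eq: "a x y = a x v" if x: "x < n" "x \<notin> ?M" and y: "y \<in> ?M" for x y
  proof (cases "x \<in> P")
    case False
    then show ?thesis using matrix_moduleD[OF P(1) x(1), of y v] y sub by blast
  next
    case True
    then obtain l where l: "l < m" "x \<in> Q l" using P(2) x(2) by auto
    have lC: "l \<notin> C" using l x by blast
    show ?thesis
    proof (cases "y = v")
      case False
      then obtain j where j: "j \<in> C" "y \<in> Q j" using y by blast
      have jm: "j < m" and jl: "j \<noteq> l" using j Cm lC by auto
      have "\<not> E j l" using C j l lC unfolding closed_in_def by blast
      then have "a (r l) v = a (r l) (r j)" using E by simp
      moreover have "v \<in> {..<n} - Q l" "r j \<in> {..<n} - Q l"
        using bounds(1) bounds(2)[OF jm] Q(2)[OF jm] Q(3)[OF l(1)] disjoint[OF jm l(1) jl] by blast+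
      ultimately have "a x v = a x (r j)"
        using good Q(1)[OF l(1)] Q(2)[OF l(1)] l(2) unfolding good_matrix_def by blast
      moreover have "x \<notin> Q j" using disjoint[OF jm l(1) jl] l(2) by blast
      ultimately show ?thesis
        using matrix_moduleD[OF Q(1)[OF jm] x(1) _ j(2) Q(2)[OF jm]] by simp
    qed simp
  qed
  show ?thesis
    unfolding matrix_module_def uniform_def
  proof (intro conjI ballI)
    show "?M \<subseteq> {..<n}" using sub bounds(3) by blast
    fix x y z assume "x \<in> {..<n} - ?M" "y \<in> ?M" "z \<in> ?M"
    then show "a x y = a x z" using eq[of x y] eq[of x z] by simp
  qed
qed

text \<open>\<open>S\<close> overlaps no part, and \<open>v\<close> lies in \<open>S\<close> but in
  no part; so \<open>S\<close> consists of \<open>v\<close> and whole parts. No arc leaves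
  \<open>S\<close> because it is a module. A closed set incomparable with \<open>J\<close> would
  yield, by \<open>module_of_closed\<close>, a module that overlaps \<open>S\<close>, with
  \<open>v\<close> in the intersection.\<close>

lemma strong_containing_center:
  assumes S: "strong_matrix_module n a S" "v \<in> S" "S \<subseteq> P"
  defines "J \<equiv> {j. j < m \<and> Q j \<subseteq> S}"
  shows "S = insert v (\<Union>j\<in>J. Q j)" and "closed_in m E J"
    and "closed_in m E C \<Longrightarrow> C \<subseteq> J \<or> J \<subseteq> C"
proof -
  have mS: "matrix_module n a S" and nov: "\<And>M. matrix_module n a M \<Longrightarrow> \<not> overlap S M"
    using S(1) unfolding strong_matrix_module_def by blast+
  have Qs: "Q j \<subseteq> S \<or> Q j \<inter> S = {}" if "j < m" for j
    using nov[OF Q(1)[OF that]] Q(3)[OF that] S(2) unfolding overlap_def by blast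
  show eq: "S = insert v (\<Union>j\<in>J. Q j)"
  proof
    show "S \<subseteq> insert v (\<Union>j\<in>J. Q j)"
    proof
      fix x assume x: "x \<in> S"
      show "x \<in> insert v (\<Union>j\<in>J. Q j)"
      proof (cases "x = v")
        case False
        then obtain j where "j < m" "x \<in> Q j" using x S(3) P(2) by auto
        then show ?thesis using Qs[of j] x unfolding J_def by blast
      qed simp
    qed
  qed (use S(2) in \<open>auto simp: J_def\<close>)
  show clJ: "closed_in m E J"
    unfolding closed_in_def
  proof (intro conjI ballI allI impI)
    show "J \<subseteq> {..<m}" unfolding J_def by auto
    fix j l assume j: "j \<in> J" and l: "l < m" "E j l"
    show "l \<in> J"
    proof (rule ccontr)
      assume "l \<notin> J"
      then have "r l \<notin> S" using Qs[OF l(1)] Q(2)[OF l(1)] l(1) unfolding J_def by blast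
      moreover have "r j \<in> S" using j Q(2)[of j] unfolding J_def by blast
      moreover have "r l < n" using Q(2)[OF l(1)] bounds(2)[OF l(1)] by auto
      ultimately have "a (r l) v = a (r l) (r j)" using matrix_moduleD[OF mS] S(2) by blast
      then show False using l(2) E by simp
    qed
  qed
  show "C \<subseteq> J \<or> J \<subseteq> C" if C: "closed_in m E C"
  proof (rule ccontr)
    assume "\<not> (C \<subseteq> J \<or> J \<subseteq> C)"
    then obtain i j where i: "i \<in> C" "i \<notin> J" and j: "j \<in> J" "j \<notin> C" by blast
    let ?M = "insert v (\<Union>j\<in>C. Q j)"
    have im: "i < m" using i C unfolding closed_in_def by auto
    have jm: "j < m" using j unfolding J_def by blast
    have "r i \<in> ?M - S" using i Q(2)[OF im] Qs[OF im] im unfolding J_def by blast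
    moreover have "r j \<in> S - ?M"
    proof -
      have "r j \<in> S" using j Q(2)[OF jm] unfolding J_def by blast
      moreover have "r j \<noteq> v" using Q(2,3)[OF jm] by auto
      moreover have "r j \<notin> Q l" if "l \<in> C" for l
      proof -
        have "l < m" "l \<noteq> j" using that C j unfolding closed_in_def by auto
        then show ?thesis using disjoint[of l j] jm Q(2)[OF jm] by blast
      qed
      ultimately show ?thesis by blast
    qed
    ultimately have "overlap S ?M" using S(2) unfolding overlap_def by blast
    then show False using nov[OF module_of_closed[OF C]] by blast
  qed
qed

end


section \<open>Trees of sets\<close>

text \<open>\<open>ns w\<close> is the least node set properly containing \<open>X\<close>, not
  merely a minimal one. Demanding this of every parent encodes the tree by inclusion alone, and that
  nodes do not overlap is implicit in it.\<close>

definition tight :: "nat set \<Rightarrow> (nat \<Rightarrow> nat set) \<Rightarrow> nat set \<Rightarrow> nat \<Rightarrow> bool" where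
  "tight V ns X w \<longleftrightarrow> w \<in> V \<and> X \<subset> ns w \<and> (\<forall>w'\<in>V. X \<subset> ns w' \<longrightarrow> ns w \<subseteq> ns w')"

text \<open>A new node can compete with the present parent only if it properly contains the
  set.\<close>

lemma tight_extend:
  assumes "tight V ns X w" and "V \<subseteq> V'" and "\<And>u. u \<in> V \<Longrightarrow> ns' u = ns u"
    and "\<And>u. u \<in> V' - V \<Longrightarrow> \<not> X \<subset> ns' u"
  shows "tight V' ns' X w"
  unfolding tight_def
proof (intro conjI ballI impI)
  show "w \<in> V'" "X \<subset> ns' w" using assms unfolding tight_def by auto
  fix u assume u: "u \<in> V'" "X \<subset> ns' u"
  then have "u \<in> V" using assms(4) by blast
  then show "ns' w \<subseteq> ns' u" using assms u unfolding tight_def by simp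
qed

text \<open>Nodes are numbered from 1 as in the output and elements from 0 as in the array, so leaf
  \<open>i\<close> carries \<open>{i - 1}\<close>.\<close>

locale set_tree =
  fixes V :: "nat set" and X :: "nat \<Rightarrow> nat set" and N n root :: nat and par :: "nat \<Rightarrow> nat"
  assumes V: "V = {1..N}" and n: "n \<le> N" and root: "root \<in> V" "X root = {..<n}"
    and leaf: "\<And>i. i \<in> {1..n} \<Longrightarrow> X i = {i - 1}"
    and ne: "\<And>u. u \<in> V \<Longrightarrow> X u \<noteq> {}" and sub: "\<And>u. u \<in> V \<Longrightarrow> X u \<subseteq> {..<n}"
    and inj: "inj_on X V"
    and par: "\<And>u. u \<in> V - {root} \<Longrightarrow> tight V X (X u) (par u)"
begin

lemma edges_mono: "(u, w) \<in> (tree_edges V root par)\<^sup>* \<Longrightarrow> X u \<subseteq> X w"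
proof (induction rule: rtrancl_induct)
  case (step y z)
  then have "y \<in> V - {root}" "z = par y" unfolding tree_edges_def by auto
  then have "X y \<subseteq> X z" using par[of y] unfolding tight_def by auto
  then show ?case using step.IH by blast
qed simp

text \<open>By minimality the set of the parent of \<open>u\<close> lies between \<open>X u\<close>
  and \<open>X w\<close>, so the difference shrinks on the way up.\<close>

lemma edges_if_subset:
  "u \<in> V \<Longrightarrow> w \<in> V \<Longrightarrow> X u \<subseteq> X w \<Longrightarrow> (u, w) \<in> (tree_edges V root par)\<^sup>*"
proof (induction "card (X w - X u)" arbitrary: u rule: less_induct)
  case less
  show ?case
  proof (cases "u = w")
    case False
    then have ss: "X u \<subset> X w" using less.prems inj unfolding inj_on_def by blast
    then have "u \<noteq> root" using root(2) sub[OF less.prems(2)] by blast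
    then have t: "tight V X (X u) (par u)" using par less.prems by blast
    then have "par u \<in> V" "X u \<subset> X (par u)" "X (par u) \<subseteq> X w"
      using ss less.prems unfolding tight_def by blast+
    moreover have "card (X w - X (par u)) < card (X w - X u)"
      using calculation sub[OF less.prems(2)] finite_subset[of "X w" "{..<n}"]
      by (intro psubset_card_mono) auto
    ultimately have "(par u, w) \<in> (tree_edges V root par)\<^sup>*" using less.hyps less.prems by blast
    moreover have "(u, par u) \<in> tree_edges V root par"
      using less.prems \<open>u \<noteq> root\<close> unfolding tree_edges_def by blast
    ultimately show ?thesis by simp
  qed simp
qed

lemma rooted_tree_of_sets: "rooted_tree V root par"
  unfolding rooted_tree_def
proof (intro conjI ballI)
  show "finite V" "root \<in> V" using V root by simp_all
  show "par v \<in> V" if "v \<in> V - {root}" for v using par[OF that] unfolding tight_def by blast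
  show "(v, root) \<in> (tree_edges V root par)\<^sup>*" if "v \<in> V" for v
    using edges_if_subset[OF that root(1)] sub[OF that] root(2) by simp
qed

text \<open>An inner node has an element, whose leaf reaches the node and differs from it; the last
  edge of that path gives a child. A singleton has no non-empty proper subset, so a leaf has no
  child.\<close>

lemma leaves_of_sets: "leaves V root par = {1..n}"
proof -
  have "(\<forall>u. (u, v) \<notin> tree_edges V root par) \<longleftrightarrow> v \<le> n" if v: "v \<in> V" for v
  proof
    assume nc: "\<forall>u. (u, v) \<notin> tree_edges V root par"
    show "v \<le> n"
    proof (rule ccontr)
      assume vn: "\<not> v \<le> n"
      obtain i where i: "i \<in> X v" using ne[OF v] by blast
      then have "i < n" using sub[OF v] by blast
      then have i': "i + 1 \<in> {1..n}" "i + 1 \<in> V" using V n by auto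
      then have "(i + 1, v) \<in> (tree_edges V root par)\<^sup>*"
        using edges_if_subset[OF _ v] leaf i by simp
      moreover have "i + 1 \<noteq> v" using i' vn by auto
      ultimately show False using nc by (meson rtranclE)
    qed
  next
    assume "v \<le> n"
    then have Xv: "X v = {v - 1}" using leaf v V by auto
    show "\<forall>u. (u, v) \<notin> tree_edges V root par"
    proof (intro allI notI)
      fix u assume "(u, v) \<in> tree_edges V root par"
      then have u: "u \<in> V - {root}" "v = par u" unfolding tree_edges_def by auto
      then have "X u \<subset> X v" using par[of u] unfolding tight_def by blast
      then have "X u = {}" unfolding Xv by auto
      then show False using ne u by blast
    qed
  qed
  then have "v \<in> leaves V root par \<longleftrightarrow> v \<in> V \<and> v \<le> n" for v
    unfolding leaves_def mem_Collect_eq by (cases "v \<in> V") (simp_all only: simp_thms)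
  then have "leaves V root par = {v. v \<in> V \<and> v \<le> n}" by blast
  also have "{v. v \<in> V \<and> v \<le> n} = {1..n}" unfolding V using n by auto
  finally show ?thesis .
qed

lemma leaves_below_of_sets:
  assumes "v \<in> V"
  shows "leaves_below V root par v = {i \<in> {1..n}. i - 1 \<in> X v}"
proof -
  have "(l, v) \<in> (tree_edges V root par)\<^sup>* \<longleftrightarrow> l - 1 \<in> X v" if l: "l \<in> {1..n}" for l
  proof
    assume "(l, v) \<in> (tree_edges V root par)\<^sup>*"
    then show "l - 1 \<in> X v" using edges_mono leaf[OF l] by blast
  next
    assume "l - 1 \<in> X v"
    moreover have "l \<in> V" using l V n by auto
    ultimately show "(l, v) \<in> (tree_edges V root par)\<^sup>*" using edges_if_subset[OF _ assms] leaf[OF l] by simp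
  qed
  then show ?thesis unfolding leaves_below_def leaves_of_sets by blast
qed

end


section \<open>The growing decomposition tree\<close>

abbreviation cell :: "nat \<Rightarrow> nat set \<Rightarrow> (nat \<Rightarrow> nat) \<Rightarrow> nat \<Rightarrow> nat set" where
  "cell n S f s \<equiv> f ` interval n S s"

text \<open>
  The inner nodes are \<open>n + 1, \<dots>, N\<close>, and the additional node \<open>0\<close> with the set \<open>{..n}\<close>
  serves as a parent of the root. The leaves at positions below \<open>p\<close> have been attached; the cells
  at later positions are going to become subtrees below the nodes \<open>att s\<close>.
\<close>

definition tree_inv ::
  "nat \<Rightarrow> (nat \<Rightarrow> nat \<Rightarrow> nat) \<Rightarrow> nat set \<Rightarrow> (nat \<Rightarrow> nat) \<Rightarrow> nat \<Rightarrow> nat \<Rightarrow> nat \<Rightarrow> (nat \<Rightarrow> nat) \<Rightarrow>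
    (nat \<Rightarrow> nat) \<Rightarrow> (nat \<Rightarrow> nat set) \<Rightarrow> bool" where
  "tree_inv n a S f p N rt par att ns \<longleftrightarrow>
     n \<le> N \<and>
     (\<forall>u\<in>{n<..N}. matrix_module n a (ns u)) \<and> (\<forall>u\<in>{n<..N}. ns u \<noteq> {}) \<and>
     inj_on ns {n<..N} \<and>
     ns 0 = {..n} \<and>
     (\<forall>u\<in>{n<..N}. \<forall>s\<in>S. cell n S f s \<subset> ns u \<or> cell n S f s \<inter> ns u = {}) \<and>
     (\<forall>u\<in>{n<..N}. tight (insert 0 {n<..N}) ns (ns u) (par u)) \<and>
     (\<forall>s\<in>S. p \<le> s \<longrightarrow> tight (insert 0 {n<..N}) ns (cell n S f s) (att s)) \<and>
     (\<forall>i<p. tight (insert 0 {n<..N}) ns {f i} (par (f i + 1))) \<and>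
     (\<forall>M. strong_matrix_module n a M \<longrightarrow> M \<noteq> {} \<longrightarrow>
       M \<in> ns ` {n<..N} \<or> (\<exists>s\<in>S. M \<subseteq> cell n S f s)) \<and>
     (if N = n then S = {0} \<and> rt = 1 else rt \<in> {n<..N} \<and> ns rt = {..<n})"

lemma tree_invI:
  assumes "n \<le> N" and "\<And>u. u \<in> {n<..N} \<Longrightarrow> matrix_module n a (ns u)"
    and "\<And>u. u \<in> {n<..N} \<Longrightarrow> ns u \<noteq> {}"
    and "inj_on ns {n<..N}" and "ns 0 = {..n}"
    and "\<And>u s. u \<in> {n<..N} \<Longrightarrow> s \<in> S \<Longrightarrow> cell n S f s \<subset> ns u \<or> cell n S f s \<inter> ns u = {}"
    and "\<And>u. u \<in> {n<..N} \<Longrightarrow> tight (insert 0 {n<..N}) ns (ns u) (par u)"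
    and "\<And>s. s \<in> S \<Longrightarrow> p \<le> s \<Longrightarrow> tight (insert 0 {n<..N}) ns (cell n S f s) (att s)"
    and "\<And>i. i < p \<Longrightarrow> tight (insert 0 {n<..N}) ns {f i} (par (f i + 1))"
    and "\<And>M. strong_matrix_module n a M \<Longrightarrow> M \<noteq> {} \<Longrightarrow>
       M \<in> ns ` {n<..N} \<or> (\<exists>s\<in>S. M \<subseteq> cell n S f s)"
    and "if N = n then S = {0} \<and> rt = 1 else rt \<in> {n<..N} \<and> ns rt = {..<n}"
  shows "tree_inv n a S f p N rt par att ns"
  unfolding tree_inv_def
  by (intro conjI ballI allI impI assms)

lemmas tree_invD =
  tree_inv_def[THEN iffD1, THEN conjunct1, rule_format]
  tree_inv_def[THEN iffD1, THEN conjunct2, THEN conjunct1, rule_format]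
  tree_inv_def[THEN iffD1, THEN conjunct2, THEN conjunct2, THEN conjunct1, rule_format]
  tree_inv_def[THEN iffD1, THEN conjunct2, THEN conjunct2, THEN conjunct2, THEN conjunct1, rule_format]
  tree_inv_def[THEN iffD1, THEN conjunct2, THEN conjunct2, THEN conjunct2, THEN conjunct2, THEN conjunct1, rule_format]
  tree_inv_def[THEN iffD1, THEN conjunct2, THEN conjunct2, THEN conjunct2, THEN conjunct2, THEN conjunct2, THEN conjunct1, rule_format]
  tree_inv_def[THEN iffD1, THEN conjunct2, THEN conjunct2, THEN conjunct2, THEN conjunct2, THEN conjunct2, THEN conjunct2, THEN conjunct1, rule_format]
  tree_inv_def[THEN iffD1, THEN conjunct2, THEN conjunct2, THEN conjunct2, THEN conjunct2, THEN conjunct2, THEN conjunct2, THEN conjunct2, THEN conjunct1, rule_format]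
  tree_inv_def[THEN iffD1, THEN conjunct2, THEN conjunct2, THEN conjunct2, THEN conjunct2, THEN conjunct2, THEN conjunct2, THEN conjunct2, THEN conjunct2, THEN conjunct1, rule_format]
  tree_inv_def[THEN iffD1, THEN conjunct2, THEN conjunct2, THEN conjunct2, THEN conjunct2, THEN conjunct2, THEN conjunct2, THEN conjunct2, THEN conjunct2, THEN conjunct2, THEN conjunct1, rule_format]
  tree_inv_def[THEN iffD1, THEN conjunct2, THEN conjunct2, THEN conjunct2, THEN conjunct2, THEN conjunct2, THEN conjunct2, THEN conjunct2, THEN conjunct2, THEN conjunct2, THEN conjunct2, rule_format]

text \<open>The leaf of the element \<open>f p\<close> is node \<open>f p + 1\<close>, and it
  receives the parent kept for its cell. Leaf numbers are at most \<open>n\<close>, so the parents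
  of inner nodes are untouched.\<close>

lemma tree_inv_leaf:
  assumes inv: "tree_inv n a S f p N rt par att ns" and p: "p \<in> S" "p < n" "next_start n S p = p + 1"
    and bij: "bij_betw f {..<n} {..<n}"
  shows "tree_inv n a S f (p + 1) N rt (par(f p + 1 := att p)) att ns"
proof (rule tree_invI)
  note D = tree_invD[OF inv]
  have fp: "f p < n" using bij_betw_lessThan[OF bij p(2)] .
  show "tight (insert 0 {n<..N}) ns (ns u) ((par(f p + 1 := att p)) u)" if "u \<in> {n<..N}" for u
    using D(7)[OF that] that fp by auto
  show "tight (insert 0 {n<..N}) ns {f i} ((par(f p + 1 := att p)) (f i + 1))" if "i < p + 1" for i
  proof (cases "i = p")
    case True
    have "interval n S p = {p}" using p(3) by auto
    then show ?thesis using D(8)[OF p(1)] True by simp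
  next
    case False
    then have ip: "i < p" using that by linarith
    have "f i \<noteq> f p" using bij ip p(2) unfolding bij_betw_def inj_on_def by auto
    then show ?thesis using D(9)[OF ip] by simp
  qed
qed (use tree_invD[OF inv] in auto)

text \<open>
  The step in which the cell at \<open>p\<close> is replaced by a chain of inner nodes, the cells into which it
  has been divided being attached to the node given by \<open>att'\<close>.
\<close>

lemma tree_inv_level:
  assumes inv: "tree_inv n a S f p N rt par att ns" and good: "good_matrix n a"
    and S: "S \<subseteq> {..<n}" and p: "p \<in> S" "next_start n S p = e" "p + 1 < e"
    and bij: "bij_betw f {..<n} {..<n}" and mod: "\<And>s. s \<in> S \<Longrightarrow> matrix_module n a (cell n S f s)"
    and before: "\<And>s. s \<in> S \<Longrightarrow> s < p \<Longrightarrow> next_start n S s = s + 1" and S0: "0 \<in> S"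
    and ref: "refined n a p e (insert (p + 1) S) f S' f'"
    and mod': "\<And>s. s \<in> S' \<Longrightarrow> matrix_module n a (cell n S' f' s)"
    and st: "bij_betw st {..<m} (S' \<inter> {p + 1..<e})"
    and E: "\<And>j l. E j l \<longleftrightarrow> a (f' (st l)) (f' p) \<noteq> a (f' (st l)) (f' (st j))"
    and ot: "\<And>j. j < m \<Longrightarrow> N < att' (st j) \<and> att' (st j) \<le> N'" "N \<le> N'"
      "\<And>t. N < t \<Longrightarrow> t \<le> N' \<Longrightarrow> \<exists>j<m. att' (st j) = t"
      "\<And>t. N \<le> t \<Longrightarrow> t \<le> N' \<Longrightarrow> closed_in m E {j. j < m \<and> att' (st j) \<le> t}"
      "\<And>C. closed_in m E C \<Longrightarrow> (\<forall>D. closed_in m E D \<longrightarrow> D \<subseteq> C \<or> C \<subseteq> D) \<Longrightarrow>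
       \<exists>t. N \<le> t \<and> t \<le> N' \<and> C = {j. j < m \<and> att' (st j) \<le> t}"
    and att': "\<And>q. q \<noteq> p \<Longrightarrow> q \<notin> st ` {..<m} \<Longrightarrow> att' q = att q" "att' p = N + 1"
    and par': "\<And>u. par' u = (if u = N' then att p else if N < u \<and> u \<le> N' then u + 1 else par u)"
    and rt': "rt' = (if N = n then N' else rt)"
  shows "\<exists>ns'. tree_inv n a S' f' p N' rt' par' att' ns'"
proof -
  note I = tree_invD[OF inv] and R = refinedD[OF ref]
  have pn: "p < n" using S p by auto
  have en: "e \<le> n" "e \<in> S \<or> e = n" using next_start[OF pn, of S] p(2) by auto
  have p1: "p + 1 \<in> insert (p + 1) S" "p + 1 < n" using p en by auto
  have nS: "next_start n (insert (p + 1) S) p = p + 1"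
    "next_start n (insert (p + 1) S) (p + 1) = e"
    using next_start_insert[OF pn p1(2), of S] next_start_insert[OF p1(2) p1(2), of S]
      next_start_interior[OF pn, of "p + 1" S] p by simp_all
  define P where "P = cell n S f p"
  define v where "v = f' p"
  define Q where "Q j = cell n S' f' (st j)" for j
  have SS': "S \<subseteq> S'" "p + 1 \<in> S'" "S' \<subseteq> {..<n}" "p \<in> S'" using R(1,3) p(1) by auto
  have S'S: "s \<in> S" if "s \<in> S'" "s \<notin> {p..<e}" for s using R(2) that p(3) by fastforce
  have stS: "st j \<in> S'" "p + 1 \<le> st j" "st j < e" if "j < m" for j
    using bij_betwE[OF st] that by auto
  have stinj: "st i = st j \<longleftrightarrow> i = j" if "i < m" "j < m" for i j
    using st that unfolding bij_betw_def inj_on_def by auto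
  have np: "next_start n S' p = p + 1"
    using SS' by (intro next_start_eqI) (auto simp: p1)
  have nse: "next_start n S' s \<le> e" if "s < e" for s
    using next_start_le[OF that, of S'] en SS' by auto
  have v: "v = f p" "f ` {p} = {v}"
  proof -
    have "p \<in> insert (p + 1) S" using p by simp
    then have "f' ` {p..<p + 1} = f ` {p..<p + 1}" using R(5)[of p] nS(1) by simp
    moreover have "{p..<p + 1} = {p}" by auto
    ultimately show "v = f p" "f ` {p} = {v}" unfolding v_def by auto
  qed
  have fim: "f' ` {p + 1..<e} = f ` {p + 1..<e}" using R(5)[OF p1(1)] nS(2) by simp
  have Peq: "P = insert v (f' ` {p + 1..<e})"
  proof -
    have "{p..<e} = insert p {p + 1..<e}" using p by auto
    then show ?thesis unfolding P_def p(2) fim using v by simp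
  qed
  have cover: "{p + 1..<e} = (\<Union>j<m. interval n S' (st j))"
  proof
    show "{p + 1..<e} \<subseteq> (\<Union>j<m. interval n S' (st j))"
    proof
      fix i assume i: "i \<in> {p + 1..<e}"
      then have "i < n" using en by simp
      then obtain s where s: "s \<in> S'" "p + 1 \<le> s" "i \<in> interval n S' s"
        using interval_cover[OF SS'(3,2), of i] i by auto
      then have "s \<in> S' \<inter> {p + 1..<e}" using i by auto
      then have "s \<in> st ` {..<m}" using st unfolding bij_betw_def by simp
      then obtain j where "j < m" "s = st j" by blast
      then show "i \<in> (\<Union>j<m. interval n S' (st j))" using s by auto
    qed
    show "(\<Union>j<m. interval n S' (st j)) \<subseteq> {p + 1..<e}"
      using stS nse by fastforce
  qed
  have PQ: "P = insert v (\<Union>j<m. Q j)" unfolding Peq cover Q_def image_UN ..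
  have injf: "f' i = f' j \<longleftrightarrow> i = j" if "i < n" "j < n" for i j
    using R(4) that unfolding bij_betw_def inj_on_def by auto
  have cell_disj: "cell n S' f' s \<inter> cell n S' f' t = {}" if "s \<in> S'" "t \<in> S'" "s \<noteq> t" for s t
  proof (rule equals0I)
    fix y assume "y \<in> cell n S' f' s \<inter> cell n S' f' t"
    then obtain i j where ij: "i \<in> interval n S' s" "j \<in> interval n S' t" "f' i = f' j" by auto
    moreover have "s < n" "t < n" using that SS' by auto
    ultimately have "i = j" using injf[of i j] next_start(3)[of s n S'] next_start(3)[of t n S'] by auto
    then show False using ij interval_disjoint[OF that, of n] by auto
  qed
  have cellp: "cell n S' f' p = {v}"
  proof -
    have "interval n S' p = {p}" unfolding np by auto
    then show ?thesis unfolding v_def by simp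
  qed
  have vQ: "v \<notin> Q j" if "j < m" for j
    using cell_disj[OF SS'(4) stS(1)[OF that]] stS(2)[OF that] cellp unfolding Q_def by auto
  have Qdis: "Q i \<inter> Q j = {}" if "i < m" "j < m" "i \<noteq> j" for i j
    unfolding Q_def using cell_disj[OF stS(1)[OF that(1)] stS(1)[OF that(2)]] stinj[OF that(1,2)] that(3)
    by blast
  have rQ: "f' (st j) \<in> Q j" if "j < m" for j
    unfolding Q_def using next_start(1)[of "st j" n S'] stS(1)[OF that] SS'(3) by auto
  interpret center n a P v m Q "\<lambda>j. f' (st j)" E
  proof
    show "matrix_module n a P" unfolding P_def by (rule mod[OF p(1)])
    show "matrix_module n a (Q j)" if "j < m" for j unfolding Q_def by (rule mod'[OF stS(1)[OF that]])
  qed (use good PQ rQ vQ Qdis E v_def in auto)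
  have m0: "0 < m"
  proof -
    have "p + 1 \<in> S' \<inter> {p + 1..<e}" using SS' p by simp
    then show ?thesis using st unfolding bij_betw_def by (cases m) auto
  qed
  have NN': "N + 1 \<le> N'" using ot(1)[OF m0] by linarith
  \<comment> \<open>\<open>C t\<close> is the set of the chain node \<open>t\<close> for
    \<open>N < t \<le> N'\<close>. At the upper end it is \<open>P\<close>; at the lower end
    \<open>C N = {v}\<close> is no inner node but the leaf of the center.\<close>
  define C where "C t = insert v (\<Union>j\<in>{j. j < m \<and> att' (st j) \<le> t}. Q j)" for t
  have Cmod: "matrix_module n a (C t)" if "N \<le> t" "t \<le> N'" for t
    unfolding C_def by (rule module_of_closed[OF ot(4)[OF that]])
  have CP: "C t \<subseteq> P" for t unfolding C_def PQ by auto
  have CN': "C N' = P"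
  proof -
    have *: "{j. j < m \<and> att' (st j) \<le> N'} = {..<m}" using ot(1) by auto
    show ?thesis unfolding C_def PQ * ..
  qed
  have Cmono: "C t \<subseteq> C t'" if "t \<le> t'" for t t' unfolding C_def using that by fastforce
  have QC: "Q j \<subseteq> C t" if "j < m" "att' (st j) \<le> t" for j t using that unfolding C_def by blast
  have QCd: "Q j \<inter> C t = {}" if "j < m" "t < att' (st j)" for j t
  proof -
    have "Q j \<inter> Q i = {}" if "i < m" "att' (st i) \<le> t" for i
      using Qdis[OF \<open>j < m\<close> that(1)] that(2) \<open>t < att' (st j)\<close> by (cases "i = j") auto
    then show ?thesis unfolding C_def using vQ[OF that(1)] by blast
  qed
  \<comment> \<open>Strict because some part is output at every number \<open>t'\<close>.\<close>
  have Cless: "C t \<subset> C t'" if "N \<le> t" "t < t'" "t' \<le> N'" for t t'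
  proof -
    have "N < t'" using that by linarith
    from ot(3)[OF this that(3)] obtain j where j: "j < m" "att' (st j) = t'" by blast
    have "f' (st j) \<in> C t'" "f' (st j) \<notin> C t"
      using QC[OF j(1), of t'] QCd[OF j(1), of t] rQ[OF j(1)] j(2) that by auto
    then show ?thesis using Cmono[of t t'] that by auto
  qed
  have CN: "C N = {v}"
  proof -
    have *: "{j. j < m \<and> att' (st j) \<le> N} = {}" using ot(1) by (auto simp: not_le)
    show ?thesis unfolding C_def * by simp
  qed
  have vC: "v \<in> C t" for t unfolding C_def by blast
  define ns' where "ns' u = (if u \<le> N then ns u else C u)" for u
  let ?V = "insert 0 {n<..N}" and ?V' = "insert 0 {n<..N'}"
  have VV': "?V \<subseteq> ?V'" using ot(2) by auto
  have old: "ns' u = ns u" if "u \<in> ?V" for u using that unfolding ns'_def by auto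
  have new: "ns' u = C u \<and> N < u \<and> u \<le> N'" if "u \<in> ?V' - ?V" for u
    using that I(1) unfolding ns'_def by auto
  have newC: "ns' u = C u" if "N < u" for u using that unfolding ns'_def by simp
  have Pne: "v \<in> P" unfolding PQ by simp
  \<comment> \<open>For node \<open>0\<close> the inclusion is proper owing to the additional
    element \<open>n\<close>.\<close>
  have Pold: "P \<subset> ns u \<or> P \<inter> ns u = {}" if "u \<in> ?V" for u
  proof (cases "u = 0")
    case True
    have "P \<subseteq> {..<n}" using mod[OF p(1)] unfolding P_def matrix_module_def by blast
    moreover have "n \<in> {..n}" "n \<notin> {..<n}" by auto
    ultimately have "P \<subset> {..n}" by auto
    then show ?thesis using I(5) True by simp
  next
    case False
    then show ?thesis using I(6)[of u p] that p(1) unfolding P_def by simp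
  qed
  have cells_out: "interval n S' s = interval n S s" "cell n S' f' s = cell n S f s" "cell n S f s \<inter> P = {}"
    if s: "s \<in> S'" "s \<notin> {p..<e}" for s
  proof -
    have sS: "s \<in> S" using S'S[OF s] .
    have sn: "s < n" using sS S by auto
    have *: "next_start n S' s = next_start n S s"
    proof (rule next_start_eqI)
      fix u assume u: "u \<in> S'" "s < u"
      show "next_start n S s \<le> u"
      proof (cases "u \<in> {p..<e}")
        case True
        then have "s < p" using s u by auto
        then have "next_start n S s \<le> p" using p(1) by (intro next_start_le) auto
        then show ?thesis using True by simp
      next
        case False
        then show ?thesis using S'S[OF u(1)] u(2) by (intro next_start_le) auto
      qed
    qed (use next_start[OF sn, of S] SS' in auto)
    then show i: "interval n S' s = interval n S s" by simp
    have *: "next_start n (insert (p + 1) S) s = next_start n S s"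
    proof -
      have "\<not> (s < p + 1 \<and> p + 1 < next_start n S s)"
        using s p interval_disjoint[OF sS p(1), of n] by fastforce
      then show ?thesis using next_start_insert[OF sn p1(2), of S] by auto
    qed
    have "s \<in> insert (p + 1) S" using sS by simp
    then show "cell n S' f' s = cell n S f s" using R(5)[of s] * i by simp
    have sp: "s \<noteq> p" using s p by auto
    show "cell n S f s \<inter> P = {}"
    proof (rule equals0I)
      fix y assume "y \<in> cell n S f s \<inter> P"
      then obtain i j where ij: "i \<in> interval n S s" "j \<in> interval n S p" "f i = f j"
        unfolding P_def by auto
      then have "i = j"
        using bij next_start(3)[OF sn, of S] next_start(3)[OF pn, of S] unfolding bij_betw_def inj_on_def by auto
      then show False using ij interval_disjoint[OF sS p(1) sp, of n] by blast
    qed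
  qed
  have cells_in: "s = p \<or> (\<exists>j<m. s = st j)" if "s \<in> S'" "s \<in> {p..<e}" for s
  proof (cases "s = p")
    case False
    then have "s \<in> S' \<inter> {p + 1..<e}" using that by auto
    then have "s \<in> st ` {..<m}" using st unfolding bij_betw_def by simp
    then show ?thesis by blast
  qed simp
  have cell_old: "cell n S f s \<noteq> {}" if "s \<in> S" for s
    using next_start(1)[of s n S] that S by auto
  have QP: "Q j \<subseteq> P" if "j < m" for j unfolding PQ using that by blast
  \<comment> \<open>New sets lie inside of \<open>P\<close>, so they never come between the parent
    and a set that avoids or contains \<open>P\<close>. This protects all old parents.\<close>
  have disjoint_new: "\<not> Y \<subset> ns' u" if "u \<in> ?V' - ?V" "Y \<noteq> {}" "Y \<inter> P = {} \<or> P \<subseteq> Y" for u Y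
  proof -
    have "ns' u \<subseteq> P" using new[OF that(1)] CP by simp
    then show ?thesis using that(2,3) by blast
  qed
  \<comment> \<open>An old node that properly contains a non-empty subset of \<open>P\<close>
    contains all of \<open>P\<close> and hence the chain; among new nodes the number
    decides.\<close>
  have inside: "ns' w \<subseteq> ns' u" if w: "w \<in> {N<..N'}" and u: "u \<in> ?V'" and Y: "Y \<subset> ns' u" "Y \<subseteq> P" "Y \<noteq> {}"
    and min: "\<And>t. N < t \<Longrightarrow> t \<le> N' \<Longrightarrow> Y \<subset> C t \<Longrightarrow> w \<le> t" for w u Y
  proof (cases "u \<in> ?V")
    case True
    then have "P \<inter> ns u \<noteq> {}" using Y old[OF True] by blast
    then have "P \<subseteq> ns' u" using Pold[OF True] old[OF True] by blast
    then show ?thesis using newC[of w] w CP by auto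
  next
    case False
    then have "ns' u = C u" "N < u" "u \<le> N'" using new[of u] u by auto
    then show ?thesis using min[of u] Y newC[of w] w Cmono[of w u] by auto
  qed
  have tight_new: "tight ?V' ns' Y w" if w: "w \<in> {N<..N'}" and Y: "Y \<subset> C w" "Y \<noteq> {}"
    and min: "\<And>t. N < t \<Longrightarrow> t \<le> N' \<Longrightarrow> Y \<subset> C t \<Longrightarrow> w \<le> t" for w Y
    unfolding tight_def
  proof (intro conjI ballI impI)
    have wC: "ns' w = C w" using newC w by simp
    show "w \<in> ?V'" using w I(1) by simp
    show "Y \<subset> ns' w" using Y wC by simp
    show "ns' w \<subseteq> ns' u" if "u \<in> ?V'" "Y \<subset> ns' u" for u
      by (rule inside[OF w that _ Y(2) min]) (use Y(1) CP in blast)+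
  qed
  have "tree_inv n a S' f' p N' rt' par' att' ns'"
  proof (rule tree_invI)
    show "n \<le> N'" using I(1) ot(2) by simp
    show "ns' 0 = {..n}" using I(5) unfolding ns'_def by simp
    show "matrix_module n a (ns' u)" if "u \<in> {n<..N'}" for u
      using I(2)[of u] Cmod[of u] that unfolding ns'_def by auto
    show "ns' u \<noteq> {}" if "u \<in> {n<..N'}" for u
      using I(3)[of u] vC[of u] that unfolding ns'_def by auto
    show "inj_on ns' {n<..N'}"
    proof (rule inj_onI)
      have eq: "u = w" if uw: "u \<in> {n<..N'}" "w \<in> {n<..N'}" "ns' u = ns' w" "u \<le> w" for u w
      proof (cases "w \<le> N")
        case True
        then show ?thesis using I(4) uw unfolding ns'_def inj_on_def by auto
      next
        case False
        then have w: "ns' w = C w" "N < w" "w \<le> N'" using newC[of w] uw by auto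
        show ?thesis
        proof (cases "u \<le> N")
          case True
          then have u: "u \<in> ?V" using uw by simp
          have "v \<in> ns u" using w uw old[OF u] vC by auto
          then have "P \<subset> ns u" using Pold[OF u] Pne by blast
          then show ?thesis using w uw old[OF u] CP[of w] by auto
        next
          case False
          then have "ns' u = C u" using newC by simp
          then show ?thesis using Cless[of u w] w uw False by fastforce
        qed
      qed
      show "u = w" if "u \<in> {n<..N'}" "w \<in> {n<..N'}" "ns' u = ns' w" for u w
        using eq[of u w] eq[of w u] that by (cases "u \<le> w") auto
    qed
    show "cell n S' f' s \<subset> ns' u \<or> cell n S' f' s \<inter> ns' u = {}" if u: "u \<in> {n<..N'}" and s: "s \<in> S'" for u s
    proof (cases "s \<in> {p..<e}")
      case False
      note co = cells_out[OF s False]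
      show ?thesis
      proof (cases "u \<le> N")
        case True
        then show ?thesis using I(6)[of u s] S'S[OF s False] u co unfolding ns'_def by simp
      next
        case False
        then show ?thesis using newC[of u] CP[of u] co by auto
      qed
    next
      case True
      have sub: "cell n S' f' s \<subseteq> P"
        using cells_in[OF s True]
      proof (elim disjE exE conjE)
        show ?thesis if "s = p" unfolding that cellp using Pne by simp
        show ?thesis if "j < m" "s = st j" for j using QP[OF that(1)] unfolding that(2) Q_def .
      qed
      show ?thesis
      proof (cases "u \<le> N")
        case True
        then have "P \<subset> ns u \<or> P \<inter> ns u = {}" using Pold[of u] u by simp
        then show ?thesis using sub True unfolding ns'_def by auto
      next
        case False
        then have nu: "ns' u = C u" "N < u" "u \<le> N'" using newC u by auto
        consider "s = p" | j where "j < m" "s = st j" using cells_in[OF s \<open>s \<in> {p..<e}\<close>] by blast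
        then show ?thesis
        proof cases
          case 1
          have "C N \<subset> C u" using Cless[of N u] nu by simp
          then show ?thesis using 1 cellp nu CN by simp
        next
          case 2
          have "Q j \<subset> C u \<or> Q j \<inter> C u = {}"
            using QC[OF 2(1), of u] QCd[OF 2(1), of u] vC[of u] vQ[OF 2(1)] by (cases "att' (st j) \<le> u") auto
          then show ?thesis using 2 nu unfolding Q_def by simp
        qed
      qed
    qed
    have attp: "tight ?V ns P (att p)" using I(8)[OF p(1)] unfolding P_def by simp
    show "tight ?V' ns' (ns' u) (par' u)" if u: "u \<in> {n<..N'}" for u
    proof (cases "u \<le> N")
      case True
      then have uV: "u \<in> ?V" "u \<in> {n<..N}" using u by auto
      have "tight ?V ns (ns u) (par u)" using I(7)[OF uV(2)] .
      moreover have "ns u \<inter> P = {} \<or> P \<subseteq> ns u" using Pold[OF uV(1)] by blast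
      ultimately have "tight ?V' ns' (ns u) (par u)"
        using disjoint_new[OF _ I(3)[OF uV(2)]] by (intro tight_extend[OF _ VV' old]) auto
      then show ?thesis using old[OF uV(1)] par'[of u] True NN' by simp
    next
      case False
      then have nu: "ns' u = C u" "N < u" "u \<le> N'" using newC u by auto
      show ?thesis
      proof (cases "u = N'")
        case True
        \<comment> \<open>The top of the chain has the set \<open>P\<close> and inherits the parent
          kept for the cell at \<open>p\<close>.\<close>
        have "tight ?V' ns' P (att p)"
          using disjoint_new[of _ P] Pne by (intro tight_extend[OF attp VV' old]) auto
        then show ?thesis using True nu CN' par'[of u] by simp
      next
        case False
        then have pu: "par' u = u + 1" "u + 1 \<in> {N<..N'}" using par'[of u] nu by auto
        have "C u \<subset> C (u + 1)" using Cless[of u "u + 1"] nu False by simp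
        moreover have "u + 1 \<le> t" if "C u \<subset> C t" for t
          using that Cmono[of t u] by (cases "t \<le> u") auto
        ultimately show ?thesis
          unfolding nu(1) pu(1) using vC[of u] by (intro tight_new[OF pu(2)]) auto
      qed
    qed
    show "tight ?V' ns' (cell n S' f' s) (att' s)" if s: "s \<in> S'" "p \<le> s" for s
    proof (cases "s \<in> {p..<e}")
      case False
      note co = cells_out[OF s(1) False] and sS = S'S[OF s(1) False]
      have "att' s = att s"
      proof (rule att'(1))
        show "s \<noteq> p" using False p(3) by auto
        have "st j \<in> {p..<e}" if "j < m" for j using stS(2,3)[OF that] by simp
        then show "s \<notin> st ` {..<m}" using False by blast
      qed
      moreover have "tight ?V' ns' (cell n S f s) (att s)"
        using disjoint_new[OF _ cell_old[OF sS]] co(3)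
        by (intro tight_extend[OF I(8)[OF sS s(2)] VV' old]) auto
      ultimately show ?thesis using co by simp
    next
      case True
      consider "s = p" | j where "j < m" "s = st j" using cells_in[OF s(1) True] by blast
      then show ?thesis
      proof cases
        case 1
        have w: "N + 1 \<in> {N<..N'}" using NN' by simp
        have "{v} \<subset> C (N + 1)" using Cless[of N "N + 1"] NN' CN by simp
        then show ?thesis
          unfolding 1 att'(2) cellp by (intro tight_new[OF w]) auto
      next
        case 2
        have w: "att' (st j) \<in> {N<..N'}" using ot(1)[OF 2(1)] by simp
        have "Q j \<subset> C (att' (st j))" using QC[OF 2(1)] vC vQ[OF 2(1)] by blast
        moreover have "att' (st j) \<le> t" if "Q j \<subset> C t" for t
          using that QCd[OF 2(1), of t] rQ[OF 2(1)] by (cases "t < att' (st j)") auto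
        ultimately show ?thesis
          unfolding 2(2) Q_def[symmetric] using rQ[OF 2(1)] by (intro tight_new[OF w]) auto
      qed
    qed
    show "tight ?V' ns' {f' i} (par' (f' i + 1))" if i: "i < p" for i
    proof -
      \<comment> \<open>Positions below \<open>p\<close> form cells of their own, so refinement has
        not moved their elements.\<close>
      have "i < n" using i pn by simp
      then obtain s where s: "s \<in> S" "i \<in> interval n S s" using interval_cover[OF S S0, of i] by auto
      have "s < p" using s i by auto
      then have "s = i" using before[OF s(1)] s(2) by auto
      then have iS: "i \<in> S" "next_start n S i = i + 1" using s before i by auto
      have iS': "i \<in> S'" "i \<notin> {p..<e}" using iS i SS' by auto
      note co = cells_out[OF iS']
      have ii: "interval n S i = {i}" unfolding iS(2) by auto
      have fi: "f' i = f i" using co(1,2) unfolding co(1) ii by simp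
      have "f i < n" using bij_betw_lessThan[OF bij \<open>i < n\<close>] .
      then have "par' (f i + 1) = par (f i + 1)" using par'[of "f i + 1"] I(1) NN' by auto
      moreover have "{f i} \<inter> P = {}" using co(3) unfolding ii by simp
      then have "tight ?V' ns' {f i} (par (f i + 1))"
        using disjoint_new[of _ "{f i}"] by (intro tight_extend[OF I(9)[OF i] VV' old]) auto
      ultimately show ?thesis unfolding fi by simp
    qed
    show "M \<in> ns' ` {n<..N'} \<or> (\<exists>s\<in>S'. M \<subseteq> cell n S' f' s)"
      if M: "strong_matrix_module n a M" "M \<noteq> {}" for M
    proof -
      consider u where "u \<in> {n<..N}" "M = ns u" | s where "s \<in> S" "M \<subseteq> cell n S f s"
        using I(10)[OF M] by blast
      then show ?thesis
      proof cases
        case 1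
        then have "M = ns' u" "u \<in> {n<..N'}" using old[of u] ot(2) by auto
        then show ?thesis by blast
      next
        case 2
        show ?thesis
        proof (cases "s = p")
          case False
          have "s \<notin> {p..<e}"
            using interval_disjoint[OF 2(1) p(1) False, of n] next_start(1)[of s n S] 2(1) S p(2) by fastforce
          moreover have "s \<in> S'" using 2(1) SS'(1) by (rule rev_subsetD)
          ultimately have "M \<subseteq> cell n S' f' s" using cells_out(2)[of s] 2(2) by simp
          then show ?thesis using \<open>s \<in> S'\<close> by (intro disjI2 bexI)
        next
          case True
          then have MP: "M \<subseteq> P" using 2 unfolding P_def by simp
          have mM: "matrix_module n a M" using M unfolding strong_matrix_module_def by blast
          show ?thesis
          proof (cases "v \<in> M")
            case False
            then have "M \<subseteq> f ` {p + 1..<e}" using MP Peq fim by auto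
            then have "\<exists>s\<in>insert (p + 1) S. M \<subseteq> f ` interval n (insert (p + 1) S) s"
              using nS(2) p1 by (intro bexI[of _ "p + 1"]) auto
            then show ?thesis using R(6)[OF mM] by blast
          next
            case True
            note sc = strong_containing_center[OF M(1) True MP]
            obtain t where t: "N \<le> t" "t \<le> N'" "{j. j < m \<and> Q j \<subseteq> M} = {j. j < m \<and> att' (st j) \<le> t}"
              using ot(5)[OF sc(2) allI[OF impI[OF sc(3)]]] by blast
            have MC: "M = C t" unfolding C_def t(3)[symmetric] by (rule sc(1))
            show ?thesis
            \<comment> \<open>\<open>t = N\<close> is the case \<open>M = {v}\<close>, which is a
              cell and not an inner node.\<close>
            proof (cases "t = N")
              case True
              then have "M \<subseteq> cell n S' f' p" using MC CN cellp by simp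
              then show ?thesis using SS'(4) by blast
            next
              case False
              then have "M = ns' t" "t \<in> {n<..N'}" using MC newC[of t] t I(1) by auto
              then show ?thesis by blast
            qed
          qed
        qed
      qed
    qed
    show "if N' = n then S' = {0} \<and> rt' = 1 else rt' \<in> {n<..N'} \<and> ns' rt' = {..<n}"
    proof (cases "N = n")
      case True
      \<comment> \<open>Before the first level the only cell consists of all elements, so the top of
        its chain is the root.\<close>
      then have "S = {0}" using I(11) by simp
      then have "p = 0" "e = n" using p(1) en(2) p(3) by auto
      then have "P = f ` {..<n}" unfolding P_def p(2) by (simp add: lessThan_atLeast0)
      then have "P = {..<n}" using bij unfolding bij_betw_def by simp
      then show ?thesis using True rt' newC[of N'] NN' CN' by simp
    next
      case False
      then have "rt \<in> {n<..N}" "ns rt = {..<n}" using I(11) by simp_all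
      then show ?thesis using False rt' NN' old[of rt] I(1) by auto
    qed
  qed
  then show ?thesis by blast
qed

section \<open>Modules versus covered partitions, and how fast the weight falls\<close>

lemma matrix_module_of_covered:
  assumes "S \<subseteq> {..<n}" "bij_betw f {..<n} {..<n}" "covered n a S f {}" "s \<in> S"
  shows "matrix_module n a (cell n S f s)"
  unfolding matrix_module_def
proof (intro conjI ballI)
  have sn: "s < n" using assms by auto
  have sub: "interval n S s \<subseteq> {..<n}" using next_start(3)[OF sn, of S] by auto
  then show "cell n S f s \<subseteq> {..<n}" using assms(2) unfolding bij_betw_def by blast
  fix x assume x: "x \<in> {..<n} - cell n S f s"
  then have "x \<in> f ` {..<n}" using assms(2) unfolding bij_betw_def by simp
  then obtain i where "i < n" "x = f i" by blast
  moreover from this have "i \<notin> interval n S s" using x by blast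
  ultimately have "uniform a x (cell n S f s) \<or> {i} \<times> interval n S s \<subseteq> {}"
    using assms(3)[unfolded covered_def, rule_format, OF assms(4), of i] by simp
  then show "uniform a x (cell n S f s)" using next_start(1)[OF sn, of S] by auto
qed

text \<open>Between cells that are modules no pair has to be processed. Hence a level starts with
  the pairs between the center and the rest of its cell only.\<close>

lemma covered_of_matrix_modules:
  assumes "S \<subseteq> {..<n}" "bij_betw f {..<n} {..<n}" "\<And>s. s \<in> S \<Longrightarrow> matrix_module n a (cell n S f s)"
  shows "covered n a S f P"
  unfolding covered_def
proof (intro ballI allI impI disjI1)
  fix s i assume s: "s \<in> S" and i: "i < n" "i \<notin> interval n S s"
  have sn: "s < n" using assms s by auto
  have sub: "interval n S s \<subseteq> {..<n}" using next_start(3)[OF sn, of S] by auto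
  have "f i \<notin> cell n S f s"
  proof
    assume "f i \<in> cell n S f s"
    then obtain j where "j \<in> interval n S s" "f i = f j" by blast
    then have "i = j" using assms(2) sub i(1) unfolding bij_betw_def inj_on_def by blast
    then show False using i(2) \<open>j \<in> interval n S s\<close> by simp
  qed
  moreover have "f i < n" using bij_betw_lessThan[OF assms(2) i(1)] .
  ultimately show "uniform a (f i) (cell n S f s)"
    using assms(3)[OF s] unfolding matrix_module_def by blast
qed

text \<open>The square of the sum exceeds the sum of the squares by the products over ordered pairs
  of distinct indices; there are \<open>card T * (card T - 1)\<close> of them, each at least
  1.\<close>

lemma sum_squares_le:
  fixes l :: "'b \<Rightarrow> nat"
  assumes "finite T" "\<And>t. t \<in> T \<Longrightarrow> 1 \<le> l t"
  shows "(\<Sum>t\<in>T. (l t)\<^sup>2) + card T * card T \<le> (\<Sum>t\<in>T. l t)\<^sup>2 + card T"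
  using assms
proof (induction T rule: finite_induct)
  case (insert x T)
  define s where "s = (\<Sum>t\<in>T. l t)"
  have "(\<Sum>t\<in>T. 1) \<le> s" unfolding s_def using insert.prems by (intro sum_mono) auto
  then have "card T * 1 \<le> s" by simp
  moreover have "1 \<le> l x" using insert.prems by simp
  ultimately have "card T * 1 \<le> s * l x" by (intro mult_mono) auto
  then show ?case
    using insert.IH insert.prems insert.hyps by (simp add: s_def[symmetric] power2_eq_square algebra_simps)
qed simp

text \<open>The cell at \<open>p\<close> becomes \<open>m + 1\<close> non-empty cells, which
  separates at least m(m + 1) \<ge> m^2 ordered pairs.\<close>

lemma square_weight_refined:
  assumes S: "S \<subseteq> {..<n}" and p: "p \<in> S" "next_start n S p = e"
    and S': "S \<subseteq> S'" "S' \<subseteq> S \<union> {p..<e}" "S' \<subseteq> {..<n}"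
    and m: "card (S' \<inter> {p + 1..<e}) = m"
  shows "square_weight n S' + m * m \<le> square_weight n S"
proof -
  let ?l = "\<lambda>s. next_start n S' s - s"
  let ?T = "S' \<inter> {p..<e}"
  have pn: "p < n" using S p by auto
  have pe: "p < e" "e \<le> n" "e \<in> S \<or> e = n" using next_start[OF pn, of S] p(2) by auto
  have fin: "finite S" "finite S'" using S S' finite_subset by blast+
  have T: "?T = insert p (S' \<inter> {p + 1..<e})" using p S'(1) pe by auto
  have cT: "card ?T = m + 1" unfolding T using m fin by simp
  have S'T: "S' - ?T = S - {p}"
  proof -
    have "s \<notin> {p..<e}" if "s \<in> S - {p}" for s
      using interval_disjoint[of s S p n] next_start(1)[of s n S] that p S by fastforce
    then show ?thesis using S'(1,2) pe p(1) by auto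
  qed
  have same: "next_start n S' s = next_start n S s" if s: "s \<in> S - {p}" for s
  proof (rule next_start_eqI)
    have sn: "s < n" using s S by auto
    note N = next_start[OF sn, of S]
    show "s < next_start n S s" "next_start n S s \<in> S' \<or> next_start n S s = n" "next_start n S s \<le> n"
      using N S' by auto
    fix u assume u: "u \<in> S'" "s < u"
    show "next_start n S s \<le> u"
    proof (cases "u \<in> {p..<e}")
      case True
      have "s \<notin> {p..<e}" using s S'T by blast
      then have "s < p" using u True by auto
      then have "next_start n S s \<le> p" using p(1) by (intro next_start_le) auto
      then show ?thesis using True by simp
    next
      case False
      then show ?thesis using u S'(2) by (intro next_start_le) auto
    qed
  qed
  have un: "{p..<e} = (\<Union>s\<in>?T. interval n S' s)"
  proof
    show "{p..<e} \<subseteq> (\<Union>s\<in>?T. interval n S' s)"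
    proof
      fix i assume i: "i \<in> {p..<e}"
      have "p \<in> S'" "i < n" using p S' i pe by auto
      then obtain s where s: "s \<in> S'" "p \<le> s" "i \<in> interval n S' s"
        using interval_cover[OF S'(3), of p i] i by auto
      then have "s \<in> ?T" using i by auto
      then show "i \<in> (\<Union>s\<in>?T. interval n S' s)" using s by blast
    qed
    have "next_start n S' s \<le> e" if "s < e" for s
      using next_start_le[OF that, of S'] pe S' by auto
    then show "(\<Union>s\<in>?T. interval n S' s) \<subseteq> {p..<e}" by fastforce
  qed
  have "card (\<Union>s\<in>?T. interval n S' s) = (\<Sum>s\<in>?T. card (interval n S' s))"
  proof (rule card_UN_disjoint)
    show "\<forall>s\<in>?T. \<forall>t\<in>?T. s \<noteq> t \<longrightarrow> interval n S' s \<inter> interval n S' t = {}"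
      using interval_disjoint[of _ S' _ n] by blast
  qed (use fin in simp_all)
  then have "card {p..<e} = (\<Sum>s\<in>?T. card (interval n S' s))" by (simp only: un[symmetric])
  then have sum: "(\<Sum>s\<in>?T. ?l s) = e - p" by simp
  have "(\<Sum>s\<in>?T. (?l s)\<^sup>2) + card ?T * card ?T \<le> (\<Sum>s\<in>?T. ?l s)\<^sup>2 + card ?T"
  proof (rule sum_squares_le)
    fix s assume "s \<in> ?T"
    then have "s < next_start n S' s" using S'(3) by (intro next_start) auto
    then show "1 \<le> ?l s" by linarith
  qed (use fin in simp)
  then have 1: "(\<Sum>s\<in>?T. (?l s)\<^sup>2) + m * m \<le> (e - p)\<^sup>2"
    unfolding sum cT by (simp add: algebra_simps)
  have "square_weight n S' = (\<Sum>s\<in>S' - ?T. (?l s)\<^sup>2) + (\<Sum>s\<in>?T. (?l s)\<^sup>2)"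
    unfolding square_weight_def by (rule sum.subset_diff) (use fin in auto)
  also have "(\<Sum>s\<in>S' - ?T. (?l s)\<^sup>2) = (\<Sum>s\<in>S - {p}. (next_start n S s - s)\<^sup>2)"
    unfolding S'T using same by simp
  finally have 2: "square_weight n S' = (\<Sum>s\<in>S - {p}. (next_start n S s - s)\<^sup>2) + (\<Sum>s\<in>?T. (?l s)\<^sup>2)" .
  have "square_weight n S = (e - p)\<^sup>2 + (\<Sum>s\<in>S - {p}. (next_start n S s - s)\<^sup>2)"
    unfolding square_weight_def p(2)[symmetric] by (rule sum.remove[OF fin(1) p(1)])
  then show ?thesis using 1 2 by simp
qed


section \<open>The program\<close>

abbreviation (input) "r_base \<equiv> 25 :: nat"

definition collect_body :: com where
  "collect_body =
     Store a_start (Reg r_count) (Reg r_low) ;; incr r_count ;; Set r_low (Cell a_fin (Reg r_low))"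

text \<open>The starts in the cell, other than that of the center, are listed by following
  \<open>a_fin\<close>: the end of a cell is the start of the next one.\<close>

definition collect :: com where
  "collect =
     Set r_center (Cell a_perm (Reg r_pos)) ;;
     Set r_count (Lit 0) ;;
     Set r_low (Add (Reg r_pos) (Lit 1)) ;;
     While (Less (Reg r_low) (Reg r_end)) collect_body"

lemma bij_betw_snoc:
  fixes c :: nat
  assumes "bij_betw f {..<c} A" "x \<notin> A"
  shows "bij_betw (f(c := x)) {..<c + 1} (insert x A)"
proof -
  have "{..<c + 1} = insert c {..<c}" by auto
  moreover have "bij_betw (f(c := x)) {..<c} A"
    using assms(1) by (rule bij_betw_cong[THEN iffD1, rotated]) simp
  ultimately show ?thesis
    using notIn_Un_bij_betw[of c "{..<c}" "f(c := x)" A] assms(2) by simp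
qed

lemma run_collect:
  assumes S: "S \<subseteq> {..<n}" "p + 1 \<in> S" "e \<in> S \<or> e = n" "p + 1 < e" "e \<le> n" and B: "n + 2 \<le> B"
    and r: "reg s r_pos = p" "reg s r_end = e"
    and fin: "\<And>t. t \<in> S \<Longrightarrow> arr s a_fin t = next_start n S t"
    and m: "card (S \<inter> {p + 1..<e}) = m" and k: "14 * m + 13 \<le> k"
    and Q: "\<And>k' s'. bounded B s' \<Longrightarrow> agree collect s s' \<Longrightarrow> k \<le> k' + (14 * m + 13) \<Longrightarrow>
      reg s' r_center = arr s a_perm p \<Longrightarrow> reg s' r_count = m \<Longrightarrow>
      bij_betw (arr s' a_start) {..<m} (S \<inter> {p + 1..<e}) \<Longrightarrow> Q k' s'"
  shows "run B collect k s Q"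
proof -
  let ?b = "Less (Reg r_low) (Reg r_end)"
  let ?s = "s\<lparr>reg := (reg s)(r_center := arr s a_perm p, r_count := 0, r_low := p + 1)\<rparr>"
  have finS: "finite S" using S finite_subset by blast
  define J where "J k' c low st \<longleftrightarrow> (low \<in> S \<or> low = e) \<and> p + 1 \<le> low \<and> low \<le> e \<and>
      bij_betw st {..<c} (S \<inter> {p + 1..<low}) \<and> k \<le> k' + 14 * c + 9" for k' c low and st :: "nat \<Rightarrow> nat"
  define I where "I k' s' \<longleftrightarrow> J k' (reg s' r_count) (reg s' r_low) (arr s' a_start)" for k' and s' :: ram
  have "run B (While ?b collect_body) (k - 9) ?s Q"
  proof (rule run_While[where I = I])
    have "{p + 1..<p + 1} = {}" by simp
    then show "I (k - 9) ?s" unfolding I_def J_def using S k by (simp add: bij_betw_def)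
    fix k' s'
    assume B': "bounded B s'" and ag: "agree collect_body ?s s'" and I': "I k' s'"
    define c low st where "c = reg s' r_count" and "low = reg s' r_low" and "st = arr s' a_start"
    have J: "J k' c low st" using I' unfolding I_def c_def low_def st_def .
    note J' = J[unfolded J_def]
    have s': "reg s' r_end = e" "arr s' a_fin = arr s a_fin" "reg s' r_center = arr s a_perm p"
      using ag r unfolding agree_def collect_body_def by simp_all
    have card: "card (S \<inter> {p + 1..<low}) = c" using J' bij_betw_same_card by fastforce
    have "card (S \<inter> {p + 1..<low}) \<le> m" unfolding m[symmetric]
      using J' by (intro card_mono) (use finS in auto)
    then have cm: "c \<le> m" using card by simp
    show "cost ?b + 1 \<le> k'" using J' cm k by simp
    {
      assume "val s' ?b \<noteq> 0"
      then have lt: "low < e" using s' by (simp add: low_def split: if_splits)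
      then have lowS: "low \<in> S" using J' by blast
      have nx: "arr s a_fin low = next_start n S low" using fin lowS by simp
      have ln: "low < n" using S lowS by auto
      note N = next_start[OF ln, of S]
      have ne: "next_start n S low \<le> e" using lt S(3) by (rule next_start_le)
      have ins: "S \<inter> {p + 1..<next_start n S low} = insert low (S \<inter> {p + 1..<low})"
      proof -
        have "u \<in> S \<Longrightarrow> u < next_start n S low \<Longrightarrow> u \<le> low" for u
          using next_start_le[of low u S n] by (cases "low < u") auto
        then show ?thesis using lowS J' N(1) by (auto simp: less_le)
      qed
      have "card (insert low (S \<inter> {p + 1..<low})) \<le> m" unfolding m[symmetric]
        using J' lowS lt by (intro card_mono) (use finS in auto)
      then have cm: "c + 1 \<le> m" using card finS by simp
      have "J k'' (c + 1) (next_start n S low) (st(c := low))" if "k' \<le> k'' + 14" for k''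
        unfolding J_def ins
      proof (intro conjI)
        show "next_start n S low \<in> S \<or> next_start n S low = e"
          using N(2) ne S(5) by auto
        show "bij_betw (st(c := low)) {..<c + 1} (insert low (S \<inter> {p + 1..<low}))"
          by (rule bij_betw_snoc) (use J' in auto)
      qed (use J' N(1) ne that in auto)
      moreover have "14 \<le> k'" using J' cm k by linarith
      moreover have "m \<le> n" using m card_mono[of "{..<n}" "S \<inter> {p + 1..<e}"] S by auto
      ultimately show "run B collect_body (k' - (cost ?b + 1)) s' I"
        unfolding collect_body_def
        by (intro run_Seq run_Store run_Set)
          (use cm B ln N nx s' in \<open>simp_all add: word_def I_def flip: c_def low_def st_def\<close>)
    }
    {
      assume "val s' ?b = 0"
      then have "low = e" using s' J' by (simp add: low_def split: if_splits)
      then have cm: "c = m" using card m by simp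
      show "Q (k' - (cost ?b + 1)) s'"
      proof (rule Q)
        show "agree collect s s'" using ag unfolding agree_def collect_def by simp
        show "k \<le> k' - (cost ?b + 1) + (14 * m + 13)" using J' cm k by simp
      qed (use B' s' J' cm \<open>low = e\<close> in \<open>simp_all flip: c_def st_def\<close>)
    }
  qed simp
  moreover have "arr s a_perm p \<le> B" if "bounded B s" using bounded_arr[OF that] .
  ultimately show ?thesis
    unfolding collect_def
    by (intro run_Seq run_Set) (use k r S B in \<open>simp_all add: word_def\<close>)
qed

text \<open>At the center \<open>a_att\<close> still holds the node kept for the whole cell. It
  becomes the parent of the top of the chain before it is replaced by \<open>r_base + 1\<close>, the
  bottom of the chain, below which the leaf of the center will hang. \<open>r_base = r_order\<close>
  marks the first level, whose top is the root.\<close>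

definition finish :: com where
  "finish =
     Store a_par (Reg r_nodes) (Cell a_att (Reg r_pos)) ;;
     Store a_att (Reg r_pos) (Add (Reg r_base) (Lit 1)) ;;
     Cond (Eq (Reg r_base) (Reg r_order)) (Set r_root (Reg r_nodes)) Skip"

text \<open>The registers are set as if a pivot had just cut the cell into its first position and
  the rest, so \<open>push_tasks\<close> separates the center. The center keeps position
  \<open>r_pos\<close> as a cell of its own.\<close>

definition level :: com where
  "level =
     Set r_end (Cell a_fin (Reg r_pos)) ;;
     Set r_low (Reg r_pos) ;;
     Set r_mid (Add (Reg r_pos) (Lit 1)) ;;
     Set r_high (Reg r_end) ;;
     push_tasks ;;
     refine_loop ;;
     collect ;;
     Set r_base (Reg r_nodes) ;;
     search ;;
     finish"

text \<open>Between levels all cells are modules and the queue is empty; it is never reset, but the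
  number of starts bounds \<open>r_tail\<close>. A level creates at most as many nodes as new
  starts, which gives \<open>reg s r_nodes + 1 \<le> n + card S\<close>.\<close>

definition main_inv ::
  "nat \<Rightarrow> nat \<Rightarrow> (nat \<Rightarrow> nat \<Rightarrow> nat) \<Rightarrow> nat set \<Rightarrow> (nat \<Rightarrow> nat set) \<Rightarrow> ram \<Rightarrow> bool" where
  "main_inv B n a S ns s \<longleftrightarrow>
     2 * n + 2 \<le> B \<and> good_matrix n a \<and> matrix_in n a s \<and> S \<subseteq> {..<n} \<and> 0 \<in> S \<and>
     (reg s r_pos \<in> S \<or> reg s r_pos = n) \<and> bij_betw (arr s a_perm) {..<n} {..<n} \<and>
     (\<forall>t\<in>S. arr s a_fin t = next_start n S t) \<and>
     reg s r_head = reg s r_tail \<and> reg s r_tail + 2 \<le> 2 * card S \<and>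
     (\<forall>t\<in>S. matrix_module n a (cell n S (arr s a_perm) t)) \<and>
     (\<forall>t\<in>S. t < reg s r_pos \<longrightarrow> next_start n S t = t + 1) \<and>
     reg s r_nodes + 1 \<le> n + card S \<and>
     tree_inv n a S (arr s a_perm) (reg s r_pos) (reg s r_nodes) (reg s r_root)
       (arr s a_par) (arr s a_att) ns"

lemmas refine_loop_written = refine_loop_def refine_body_def pivot_loop_def refine_written

lemmas search_loop_written = search_def search_written

text \<open>The old cells are modules, so only the two tasks between the center and the rest of its
  cell are pending. Per position of the rest they store 2 * 112 units, while cutting off the center
  releases 2 * 183.\<close>

lemma refining_start:
  assumes B: "2 * n + 2 \<le> B" and S: "S \<subseteq> {..<n}"
    and p: "p \<in> S" "next_start n S p = e" "p + 1 < e"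
    and fin: "\<And>t. t \<in> S \<Longrightarrow> arr s a_fin t = next_start n S t"
    and tl: "reg s r_tail + 2 \<le> 2 * card S"
    and mod: "\<And>t. t \<in> S \<Longrightarrow> matrix_module n a (cell n S (arr s a_perm) t)"
    and mat: "matrix_in n a s'"
    and bij: "bij_betw (arr s a_perm) {..<n} {..<n}" "arr s' a_perm = arr s a_perm"
    and fin': "arr s' a_fin = (arr s a_fin)(p := p + 1, p + 1 := e)"
    and tl': "reg s' r_tail = reg s r_tail + 2"
    and tk': "\<And>i. task s' i = (if i = reg s r_tail then (p, p + 1, p + 1, e)
        else if i = reg s r_tail + 1 then (p + 1, e, p, p + 1) else task s i)"
  shows "refining B n a p e (insert (p + 1) S) (arr s a_perm) (insert (p + 1) S) (reg s r_tail) {} s'"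
    and "potential n (insert (p + 1) S) (reg s r_tail) s' \<le> 183 * square_weight n S"
proof -
  let ?S = "insert (p + 1) S" and ?h = "reg s r_tail"
  have pn: "p < n" using S p by auto
  have en: "e \<le> n" "e \<in> S \<or> e = n" using next_start[OF pn, of S] p(2) by auto
  have p1: "p + 1 < n" "p < p + 1" "p + 1 < next_start n S p" using p en by auto
  have pS: "p + 1 \<notin> S" using next_start_le[of p "p + 1" S n] p by auto
  have finS: "finite S" using S finite_subset by blast
  note pp = pending_push[OF order_refl tl' tk']
  have nt: "next_start n ?S t = (if t = p then p + 1 else if t = p + 1 then e else next_start n S t)" if "t \<in> ?S" for t
  proof -
    have "\<not> (t < p + 1 \<and> p + 1 < next_start n S t)" if "t \<in> S" "t \<noteq> p"
      using interval_disjoint[OF that(1) p(1) that(2), of n] p by fastforce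
    then show ?thesis
      using next_start_insert[of t n "p + 1" S] that S p1(1) p next_start_interior[OF pn p1(2,3)] by auto
  qed
  have iv: "{?h..<reg s' r_tail} = {?h, ?h + 1}" using tl' by auto
  have "covered n a ?S (arr s a_perm) (pending ?h s')"
  proof (rule covered_split[OF S p(1) p1(2,3)])
    show "covered n a S (arr s a_perm) {}" by (rule covered_of_matrix_modules[OF S bij(1) mod])
  qed (auto simp: pp(1) p(2))
  moreover have "task_ok n p e ?S (task s' k)" if "k \<in> {?h..<reg s' r_tail}" for k
    using that p en pn unfolding iv by (auto simp: tk')
  moreover have "arr s' a_fin t = next_start n ?S t" if "t \<in> ?S" for t
    using that fin nt[OF that] unfolding fin' by auto
  moreover have "reg s' r_tail + 2 \<le> 2 * card ?S" using tl tl' pS finS by simp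
  moreover have "refined n a p e ?S (arr s a_perm) ?S (arr s a_perm)"
    by (rule refined_refl) (use S p1 bij in auto)
  ultimately show "refining B n a p e ?S (arr s a_perm) ?S ?h {} s'"
    unfolding refining_def using B mat bij(2) tl' by simp
  have "(\<Sum>k\<in>{?h..<reg s' r_tail}. task_weight (task s' k)) = 2 * (p + 1 - p) * (e - (p + 1))"
    using pp(2) by simp
  then show "potential n ?S ?h s' \<le> 183 * square_weight n S"
    using square_weight_insert[OF S p(1) p1(2,3)] p(2) unfolding potential_def by simp
qed

text \<open>
  A level that divides a cell into \<open>m + 1\<close> cells lowers the square weight by at least \<open>m\<^sup>2\<close>. Besides the
  \<open>183\<close> units per square spent on refinement, it takes at most \<open>472 m\<^sup>2\<close> units, hence \<open>655\<close> in total.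
\<close>

lemma run_level:
  assumes inv: "main_inv B n a S ns s" and p: "reg s r_pos = p" "p < n" "next_start n S p \<noteq> p + 1"
    and k: "655 * square_weight n S + z \<le> k + 11"
    and Q: "\<And>k' s' S' ns'. bounded B s' \<Longrightarrow> agree level s s' \<Longrightarrow> main_inv B n a S' ns' s' \<Longrightarrow>
      655 * square_weight n S' + z \<le> k' \<Longrightarrow> Q k' s'"
  shows "run B level k s Q"
proof -
  note I = inv[unfolded main_inv_def p(1)]
  define f where "f = arr s a_perm"
  define N where "N = reg s r_nodes"
  define e where "e = next_start n S p"
  let ?S1 = "insert (p + 1) S"
  have S: "S \<subseteq> {..<n}" and B: "2 * n + 2 \<le> B" and mat: "matrix_in n a s" and S0: "0 \<in> S"
    and bij: "bij_betw f {..<n} {..<n}" and good: "good_matrix n a"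
    and fin: "\<And>t. t \<in> S \<Longrightarrow> arr s a_fin t = next_start n S t"
    and mod: "\<And>t. t \<in> S \<Longrightarrow> matrix_module n a (cell n S f t)"
    and before: "\<And>t. t \<in> S \<Longrightarrow> t < p \<Longrightarrow> next_start n S t = t + 1"
    and tl: "reg s r_head = reg s r_tail" "reg s r_tail + 2 \<le> 2 * card S"
    and Nc: "N + 1 \<le> n + card S"
    and tree: "tree_inv n a S f p N (reg s r_root) (arr s a_par) (arr s a_att) ns"
    using I unfolding f_def N_def by simp_all
  have pS: "p \<in> S" using I p(2) by simp
  have pe: "p + 1 < e" "e \<le> n" "e \<in> S \<or> e = n" using next_start[OF p(2), of S] p(3) unfolding e_def by auto
  have finS: "finite S" using S finite_subset by blast
  have cS: "card ?S1 \<le> n" using card_mono[of "{..<n}" ?S1] S pe by auto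
  have p1S: "p + 1 \<notin> S" using next_start_le[of p "p + 1" S n] pe e_def by auto
  have "card S + 1 \<le> n" using cS finS p1S by simp
  then have tlB: "reg s r_tail + 2 \<le> B" using tl B by simp
  have "square_weight n S = square_weight n ?S1 + 2 * (p + 1 - p) * (e - (p + 1))"
    using square_weight_insert[OF S pS, of "p + 1"] pe unfolding e_def by simp
  then have w1: "2 \<le> square_weight n S" using pe by simp
  define rest6 where "rest6 = finish"
  define rest5 where "rest5 = (search ;; rest6)"
  define rest4 where "rest4 = (Set r_base (Reg r_nodes) ;; rest5)"
  define rest3 where "rest3 = (collect ;; rest4)"
  define rest2 where "rest2 = (refine_loop ;; rest3)"
  define rest1 where "rest1 = (push_tasks ;; rest2)"
  let ?s1 = "s\<lparr>reg := (reg s)(r_end := e, r_low := p, r_mid := p + 1, r_high := e)\<rparr>"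
  have "run B rest1 (k - 11) ?s1 Q"
    unfolding rest1_def
  proof (rule run_Seq, rule run_push_tasks[where c = p and m = "p + 1" and e = e])
    show "reg ?s1 r_tail + 2 \<le> B" using tlB by simp
    show "38 \<le> k - 11" using k w1 by simp
    fix k2 s2
    assume B2: "bounded B s2" and ag2: "agree push_tasks ?s1 s2" and k2: "k - 11 \<le> k2 + 38"
      and fin2: "arr s2 a_fin = (arr ?s1 a_fin)(p := p + 1, p + 1 := e)"
      and tl2: "reg s2 r_tail = reg ?s1 r_tail + 2"
      and tk2: "\<And>i. task s2 i = (if i = reg ?s1 r_tail then (p, p + 1, p + 1, e)
        else if i = reg ?s1 r_tail + 1 then (p + 1, e, p, p + 1) else task ?s1 i)"
    have s2: "matrix_in n a s2" "arr s2 a_perm = f" "reg s2 r_head = reg s r_tail" "reg s2 r_pos = p"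
      "reg s2 r_end = e" "reg s2 r_nodes = N" "arr s2 a_att = arr s a_att" "arr s2 a_par = arr s a_par"
      "reg s2 r_root = reg s r_root"
      using ag2 mat tl(1) p(1) unfolding agree_def push_tasks_def push_task_def matrix_in_def f_def N_def by simp_all
    have ag2': "agree level s s2" using ag2 unfolding agree_def level_def by simp
    have tk2': "task s2 i = (if i = reg s r_tail then (p, p + 1, p + 1, e)
        else if i = reg s r_tail + 1 then (p + 1, e, p, p + 1) else task s i)" for i
      using tk2[of i] by (simp add: task_def)
    note rs = refining_start[OF B S pS e_def[symmetric] pe(1) fin tl(2) mod[unfolded f_def] s2(1)
        bij[unfolded f_def] s2(2)[unfolded f_def] _ _ tk2']
    have ref2: "refining B n a p e ?S1 f ?S1 (reg s2 r_head) {} s2"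
      and pot2: "potential n ?S1 (reg s2 r_head) s2 \<le> 183 * square_weight n S"
      unfolding f_def s2(3) using rs fin2 tl2 by simp_all
    \<comment> \<open>64 = 11 + 11 + 38 + 4: the tests of the main loop, the four assignments,
      \<open>push_tasks\<close> and the last guard of \<open>refine_loop\<close>.\<close>
    define z1 where "z1 = 472 * square_weight n S + z - 64"
    show "run B rest2 k2 s2 Q"
      unfolding rest2_def
    proof (rule run_Seq, rule run_refine_loop[OF ref2 pe(2)])
      show "potential n ?S1 (reg s2 r_head) s2 + 4 + z1 \<le> k2"
        using pot2 k2 k w1 unfolding z1_def by simp
      fix k3 s3 S'
      assume B3: "bounded B s3" and ag3: "agree refine_loop s2 s3" and h3: "reg s3 r_head = reg s3 r_tail"
        and ref3: "refining B n a p e ?S1 f S' (reg s3 r_head) {} s3"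
        and k3: "183 * square_weight n S' + z1 \<le> k3"
      have s3: "matrix_in n a s3" "reg s3 r_pos = p" "reg s3 r_end = e" "reg s3 r_nodes = N"
        "arr s3 a_att = arr s a_att" "arr s3 a_par = arr s a_par" "reg s3 r_root = reg s r_root"
        using ag3 s2 unfolding agree_def refine_loop_written matrix_in_def by simp_all
      have ag3': "agree level s s3"
        using agree_trans[OF ag2', of s3] ag3 unfolding agree_def level_def by simp
      define f' where "f' = arr s3 a_perm"
      note A3 = ref3[unfolded refining_def]
      have R: "refined n a p e ?S1 f S' f'" using A3 unfolding f'_def by blast
      note RD = refinedD[OF R]
      have S': "?S1 \<subseteq> S'" "S' \<subseteq> {..<n}" "S \<subseteq> S'" "p + 1 \<in> S'" using RD(1,3) by auto
      have S'2: "S' \<subseteq> S \<union> {p..<e}" using RD(2) pe(1) by auto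
      have cov: "covered n a S' f' {}"
        using A3 h3 unfolding f'_def pending_def by simp
      have mod': "matrix_module n a (cell n S' f' t)" if "t \<in> S'" for t
        by (rule matrix_module_of_covered[OF S'(2) RD(4) cov that])
      have fin3: "arr s3 a_fin t = next_start n S' t" if "t \<in> S'" for t using A3 that by simp
      have tl3: "reg s3 r_tail + 2 \<le> 2 * card S'" using A3 by simp
      define m where "m = card (S' \<inter> {p + 1..<e})"
      have finS': "finite S'" using S'(2) finite_subset by blast
      have "p + 1 \<in> S' \<inter> {p + 1..<e}" using S' pe by simp
      then have "m \<noteq> 0" unfolding m_def using finS' by auto
      then have m1: "1 \<le> m" by linarith
      have Sm: "S' = S \<union> (S' \<inter> {p + 1..<e})" "S \<inter> (S' \<inter> {p + 1..<e}) = {}"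
      proof -
        have "t \<notin> {p + 1..<e}" if "t \<in> S" for t
          using next_start_le[of p t S n] that unfolding e_def by auto
        then show "S \<inter> (S' \<inter> {p + 1..<e}) = {}" by blast
        have "{p..<e} = insert p {p + 1..<e}" using pe by auto
        then have "S' \<subseteq> S \<union> insert p {p + 1..<e}" using S'2 by simp
        then show "S' = S \<union> (S' \<inter> {p + 1..<e})" using S'(3) pS by blast
      qed
      have cm: "card S' = card S + m"
        unfolding m_def using card_Un_disjoint[OF finS _ Sm(2)] finS' Sm(1) by simp
      have cn: "card S' \<le> n" using card_mono[of "{..<n}" S'] S' by simp
      have w: "square_weight n S' + m * m \<le> square_weight n S"
        by (rule square_weight_refined[OF S pS e_def[symmetric] S'(3) S'2 S'(2) m_def[symmetric]])
      \<comment> \<open>15 units are reserved for \<open>finish\<close>.\<close>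
      define z2 where "z2 = 655 * square_weight n S' + z + 15"
      have mm: "m \<le> m * m" "1 \<le> m * m" using m1 mult_le_mono[OF m1 m1] by simp_all
      \<comment> \<open>Apart from refinement a level costs at most
        \<open>144 * (m * m) + 182 * m + 146\<close>, including the 64 and 15 units above. As
        \<open>1 \<le> m\<close>, this is at most \<open>472 * (m * m)\<close>, and 472 = 144 + 182
        + 146.\<close>
      have expand: "(2 * m + 1) * (72 * m + 40) = 144 * (m * m) + 152 * m + 40" by (simp add: algebra_simps)
      have k3': "(14 * m + 13) + 2 + ((2 * m + 1) * (72 * m + 40) + 16 * m + 12 + z2) \<le> k3"
        using k3 w mm w1 unfolding expand z1_def z2_def by linarith
      have e': "e \<in> S' \<or> e = n" using pe(3) S' by blast
      have nB: "n + 2 \<le> B" using B by simp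
      show "run B rest3 k3 s3 Q"
        unfolding rest3_def
      proof (rule run_Seq, rule run_collect[OF S'(2,4) e' pe(1,2) nB s3(2,3) fin3 m_def[symmetric]])
        show "14 * m + 13 \<le> k3" using k3' by linarith
        fix k4 s4
        assume B4: "bounded B s4" and ag4: "agree collect s3 s4" and k4: "k3 \<le> k4 + (14 * m + 13)"
          and s4: "reg s4 r_center = arr s3 a_perm p" "reg s4 r_count = m"
            "bij_betw (arr s4 a_start) {..<m} (S' \<inter> {p + 1..<e})"
        define st where "st = arr s4 a_start"
        have st: "bij_betw st {..<m} (S' \<inter> {p + 1..<e})" using s4(3) unfolding st_def .
        have stj: "st j \<in> S'" "st j \<noteq> p" "st j < n" if "j < m" for j
          using bij_betwE[OF st, rule_format, of j] that S'(2) by auto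
        let ?s5 = "s4\<lparr>reg := (reg s4)(r_base := N)\<rparr>"
        have s5: "matrix_in n a ?s5" "reg ?s5 r_pos = p" "reg ?s5 r_nodes = N" "reg ?s5 r_count = m"
          "arr ?s5 a_att = arr s a_att" "arr ?s5 a_par = arr s a_par" "reg ?s5 r_root = reg s r_root"
          "reg ?s5 r_base = N" "arr ?s5 a_perm = f'" "arr ?s5 a_fin = arr s3 a_fin"
          "reg ?s5 r_head = reg ?s5 r_tail" "reg ?s5 r_tail + 2 \<le> 2 * card S'" "reg ?s5 r_center = f' p"
          using ag4 s3 s4 h3 tl3 unfolding agree_def collect_def collect_body_def matrix_in_def f'_def by simp_all
        have NB: "N \<le> B" using Nc cm cn B by simp
        have N4: "reg s4 r_nodes = N" using s5(3) by simp
        have ag5: "agree level s ?s5"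
          using agree_trans[OF ag3', of s4] ag4 unfolding agree_def level_def by simp
        define E where "E j l \<longleftrightarrow> a (f' (st l)) (f' p) \<noteq> a (f' (st l)) (f' (st j))" for j l
        have "run B rest5 (k4 - 2) ?s5 Q"
          unfolding rest5_def
        proof (rule run_Seq, rule run_search[where n = n and m = m and a = a and b = N and st = st and
              v = "f' p" and r = "\<lambda>j. f' (st j)" and E = E and z = z2])
          show "reg ?s5 r_count = m" "matrix_in n a ?s5" "reg ?s5 r_nodes = N" "reg ?s5 r_center = f' p"
            by (fact s5)+
          show "m \<le> n" using cm cn by simp
          show "N + m + 2 \<le> B" "n + 2 \<le> B" using Nc cm cn B by simp_all
          show "st = arr ?s5 a_start" by (simp add: st_def)
          show "st j < n" if "j < m" for j by (rule stj(3)[OF that])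
          show "inj_on st {..<m}" using st unfolding bij_betw_def by blast
          show "bij_betw (arr ?s5 a_perm) {..<n} {..<n}" unfolding s5(9) by (rule RD(4))
          show "f' p < n" by (rule bij_betw_lessThan[OF RD(4) p(2)])
          show "f' (st j) = arr ?s5 a_perm (st j)" for j unfolding s5(9) ..
          show "E j l \<longleftrightarrow> a (f' (st l)) (f' p) \<noteq> a (f' (st l)) (f' (st j))" for j l by (rule E_def)
          show "(2 * m + 1) * (72 * m + 40) + 16 * m + 12 + z2 \<le> k4 - 2" using k3' k4 by linarith
          fix k6 s6
          assume B6: "bounded B s6" and ag6: "agree search ?s5 s6" and k6: "z2 \<le> k6"
            and si: "search_inv m E N (arr s6 a_lev) (\<lambda>i l. arr s6 a_row (i * n + l)) 0 (reg s6 r_nodes)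
              (\<lambda>j. arr s6 a_att (st j))"
            and none: "\<And>j. j < m \<Longrightarrow> arr s6 a_lev j \<noteq> 0 \<Longrightarrow> arr s6 a_row (0 * n + j) = 0"
            and att6: "\<And>q. q \<notin> st ` {..<m} \<Longrightarrow> arr s6 a_att q = arr ?s5 a_att q"
            and par6: "\<And>u. arr s6 a_par u = (if N < u \<and> u \<le> reg s6 r_nodes then u + 1 else arr ?s5 a_par u)"
          define N' where "N' = reg s6 r_nodes"
          have s6: "matrix_in n a s6" "reg s6 r_pos = p" "reg s6 r_root = reg s r_root"
            "reg s6 r_base = N" "arr s6 a_perm = f'" "arr s6 a_fin = arr s3 a_fin"
            "reg s6 r_head = reg s6 r_tail" "reg s6 r_tail + 2 \<le> 2 * card S'" "reg s6 r_order = n"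
            using ag6 s5 unfolding agree_def search_loop_written matrix_in_def by simp_all
          have ag6': "agree level s s6"
            using agree_trans[OF ag5, of s6] ag6 unfolding agree_def level_def by simp
          have "\<forall>j<m. arr s6 a_lev j \<noteq> 0 \<longrightarrow> arr s6 a_row (0 * n + j) = 0"
            using none by simp
          note SF = search_inv_finish[OF si this, folded N'_def]
          have pst: "p \<notin> st ` {..<m}" using stj(2) by auto
          define att' where "att' = (arr s6 a_att)(p := N + 1)"
          define par' where "par' = (arr s6 a_par)(N' := arr s a_att p)"
          define rt' where "rt' = (if N = n then N' else reg s r_root)"
          let ?s7 = "s6\<lparr>arr := (arr s6)(a_par := par', a_att := att')\<rparr>"
          let ?s8 = "if N = n then ?s7\<lparr>reg := (reg ?s7)(r_root := N')\<rparr> else ?s7"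
          have attst: "att' (st j) = arr s6 a_att (st j)" if "j < m" for j
            using stj(2)[OF that] unfolding att'_def by simp
          have sets: "{j. j < m \<and> att' (st j) \<le> t} = {j. j < m \<and> arr s6 a_att (st j) \<le> t}" for t
            using attst by auto
          have "\<exists>ns'. tree_inv n a S' f' p N' rt' par' att' ns'"
          proof (rule tree_inv_level[OF tree good S pS e_def[symmetric] pe(1) bij mod before S0 R mod' st E_def])
            show "N < att' (st j) \<and> att' (st j) \<le> N'" if "j < m" for j
              using SF(1)[OF that] attst[OF that] by simp
            show "N \<le> N'" by (rule SF(2))
            show "\<exists>j<m. att' (st j) = t" if "N < t" "t \<le> N'" for t
              using SF(4)[OF that] attst by auto
            show "closed_in m E {j. j < m \<and> att' (st j) \<le> t}" if "N \<le> t" "t \<le> N'" for t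
              unfolding sets by (rule SF(5)[OF that])
            show "\<exists>t. N \<le> t \<and> t \<le> N' \<and> C = {j. j < m \<and> att' (st j) \<le> t}"
              if "closed_in m E C" "\<forall>D. closed_in m E D \<longrightarrow> D \<subseteq> C \<or> C \<subseteq> D" for C
              unfolding sets by (rule SF(6)[OF that])
            show "att' q = arr s a_att q" if "q \<noteq> p" "q \<notin> st ` {..<m}" for q
              using att6[OF that(2)] that(1) s5(5) unfolding att'_def by simp
            show "att' p = N + 1" unfolding att'_def by simp
            show "par' u = (if u = N' then arr s a_att p else if N < u \<and> u \<le> N' then u + 1 else arr s a_par u)" for u
              using par6[of u] s5(6) unfolding par'_def N'_def by simp
            show "rt' = (if N = n then N' else reg s r_root)" by (rule rt'_def)
          qed
          then obtain ns' where ns': "tree_inv n a S' f' p N' rt' par' att' ns'" by blast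
          have s8: "reg ?s8 r_root = rt'" "arr ?s8 = arr ?s7"
            "\<And>x. x \<noteq> r_root \<Longrightarrow> reg ?s8 x = reg s6 x"
            using s6 unfolding rt'_def by simp_all
          have main: "main_inv B n a S' ns' ?s8"
            unfolding main_inv_def matrix_in_def
          proof (intro conjI ballI impI allI)
            show "tree_inv n a S' (arr ?s8 a_perm) (reg ?s8 r_pos) (reg ?s8 r_nodes) (reg ?s8 r_root)
                (arr ?s8 a_par) (arr ?s8 a_att) ns'"
              using ns' s8 s6 N'_def by simp
            show "next_start n S' t = t + 1" if t: "t \<in> S'" "t < reg ?s8 r_pos" for t
            proof -
              have tp: "t < p" using t s8 s6 by simp
              have tS: "t \<in> S" using S'2 t(1) tp by auto
              have "next_start n S' t \<le> t + 1"
              proof -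
                have "t + 1 \<in> S \<or> t + 1 = n" using next_start(2)[of t n S] before[OF tS tp] tS S by auto
                then show ?thesis using S'(3) by (intro next_start_le) auto
              qed
              then show ?thesis using next_start(1)[of t n S'] tS S by fastforce
            qed
            show "matrix_module n a (cell n S' (arr ?s8 a_perm) t)" if "t \<in> S'" for t
              using mod'[OF that] s8 s6 by simp
            show "reg ?s8 r_nodes + 1 \<le> n + card S'"
              using SF(3) Nc cm s8 N'_def by simp
            show "arr ?s8 a_fin t = next_start n S' t" if "t \<in> S'" for t
              using fin3[OF that] s8 s6 by simp
          qed (use B good s6 s8 S' S0 pS RD(4) in \<open>auto simp: matrix_in_def\<close>)
          have attp: "arr s6 a_att p = arr s a_att p" using att6[OF pst] s5(5) by simp
          have bnd: "arr s a_att p \<le> B" "N' \<le> B" "N + 1 \<le> B"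
            using bounded_arr[OF B6, of a_att p] attp bounded_reg[OF B6, of r_nodes] Nc cn cm B m1
            unfolding N'_def by simp_all
          have "bounded B ?s7 \<Longrightarrow> bounded B ?s8"
            using bounded_reg[OF B6, of r_nodes] unfolding bounded_def N'_def by simp
          moreover have "bounded B ?s7"
            using B6 bnd unfolding bounded_def att'_def par'_def by simp
          ultimately have B8: "bounded B ?s8" by blast
          have ag8: "agree level s ?s8"
            using ag6' unfolding agree_def level_def finish_def by simp
          have Q8: "Q k' ?s8" if "z2 \<le> k' + 15" for k'
            by (rule Q[OF B8 ag8 main]) (use that in \<open>simp add: z2_def\<close>)
          have k15: "15 \<le> k6" using k6 unfolding z2_def by simp
          show "run B rest6 k6 s6 Q"
            unfolding rest6_def finish_def
            by (intro run_intros)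
              (use k15 k6 Q8 s6 bnd attp in
                \<open>simp_all add: word_def att'_def par'_def flip: N'_def split: if_splits\<close>)
        qed
        then show "run B rest4 k4 s4 Q"
          unfolding rest4_def
          by (intro run_Seq run_Set) (use N4 NB k3' k4 in \<open>simp_all add: bounded_reg\<close>)
      qed
    qed
  qed (simp_all)
  moreover have "e \<le> B" "p \<le> B" "p + 1 \<le> B" using pe B by simp_all
  moreover have "49 \<le> k" using k w1 by simp
  moreover have "arr s a_fin p = e" using fin[OF pS] e_def by simp
  ultimately show ?thesis
    unfolding level_def
    apply (fold rest6_def, fold rest5_def, fold rest4_def, fold rest3_def, fold rest2_def, fold rest1_def)
    by (intro run_Seq run_Set) (use p(1) in \<open>simp_all add: word_def\<close>)
qed

section \<open>The loop over the positions\<close>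

definition leaf :: com where
  "leaf = Store a_par (Add (Cell a_perm (Reg r_pos)) (Lit 1)) (Cell a_att (Reg r_pos)) ;; incr r_pos"

definition main_body :: com where
  "main_body = Cond (Eq (Cell a_fin (Reg r_pos)) (Add (Reg r_pos) (Lit 1))) leaf level"

definition main_loop :: com where
  "main_loop = While (Less (Reg r_pos) (Reg r_order)) main_body"

lemma run_leaf:
  assumes inv: "main_inv B n a S ns s" and p: "reg s r_pos = p" "p < n" "next_start n S p = p + 1"
    and k: "11 \<le> k"
    and Q: "\<And>k' s'. bounded B s' \<Longrightarrow> k \<le> k' + 11 \<Longrightarrow> reg s' r_pos = p + 1 \<Longrightarrow>
      main_inv B n a S ns s' \<Longrightarrow> Q k' s'"
  shows "run B leaf k s Q"
  unfolding run_def
proof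
  assume B: "bounded B s"
  note I = inv[unfolded main_inv_def p(1)]
  define f where "f = arr s a_perm"
  have S: "S \<subseteq> {..<n}" and nB: "2 * n + 2 \<le> B" and bij: "bij_betw f {..<n} {..<n}"
    and before: "\<And>t. t \<in> S \<Longrightarrow> t < p \<Longrightarrow> next_start n S t = t + 1"
    and tree: "tree_inv n a S f p (reg s r_nodes) (reg s r_root) (arr s a_par) (arr s a_att) ns"
    using I unfolding f_def by simp_all
  have pS: "p \<in> S" using I p(2) by simp
  have fp: "f p < n" using bij_betw_lessThan[OF bij p(2)] .
  let ?s' = "s\<lparr>arr := (arr s)(a_par := (arr s a_par)(f p + 1 := arr s a_att p)), reg := (reg s)(r_pos := p + 1)\<rparr>"
  have B': "bounded B ?s'"
    using B fp p nB by (simp add: bounded_def)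
  have p1: "p + 1 \<in> S \<or> p + 1 = n" using next_start(2)[OF p(2), of S] p(3) by simp
  have main: "main_inv B n a S ns ?s'"
    unfolding main_inv_def
  proof (intro conjI ballI impI)
    show "tree_inv n a S (arr ?s' a_perm) (reg ?s' r_pos) (reg ?s' r_nodes) (reg ?s' r_root)
        (arr ?s' a_par) (arr ?s' a_att) ns"
      using tree_inv_leaf[OF tree pS p(2,3) bij] by (simp add: f_def)
    show "next_start n S t = t + 1" if "t \<in> S" "t < reg ?s' r_pos" for t
      using before[OF that(1)] that(2) p(3) by (cases "t = p") auto
  qed (use I p1 in \<open>simp_all add: matrix_in_def\<close>)
  have Qs: "Q k' ?s'" if "k \<le> k' + 11" for k'
    by (rule Q[OF B' that _ main]) simp
  have "run B leaf k s Q"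
    unfolding leaf_def
    by (intro run_intros)
      (use p k Qs fp nB in \<open>simp_all add: word_def bounded_arr bounded_reg flip: f_def\<close>)
  then show "\<exists>t s'. exec (word B) leaf s t s' \<and> t \<le> k \<and> bounded B s' \<and> Q (k - t) s'"
    using B unfolding run_def by blast
qed

text \<open>A leaf takes 22 units, 11 for the tests and 11 for its body, and advances
  \<open>r_pos\<close>. A level leaves \<open>r_pos\<close> unchanged and is paid from the
  weight.\<close>

lemma run_main_loop:
  assumes inv: "main_inv B n a S ns s" and k: "655 * square_weight n S + 22 * (n - reg s r_pos) + 4 \<le> k"
    and Q: "\<And>k' s' S' ns'. bounded B s' \<Longrightarrow> main_inv B n a S' ns' s' \<Longrightarrow> reg s' r_pos = n \<Longrightarrow> Q k' s'"
  shows "run B main_loop k s Q"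
proof -
  let ?b = "Less (Reg r_pos) (Reg r_order)"
  define I where "I k' s' \<longleftrightarrow> (\<exists>S' ns'. main_inv B n a S' ns' s' \<and>
    655 * square_weight n S' + 22 * (n - reg s' r_pos) + 4 \<le> k')" for k' and s' :: ram
  show ?thesis
    unfolding main_loop_def
  proof (rule run_While[where I = I])
    show "I k s" using assms unfolding I_def by blast
    fix k' s'
    assume B: "bounded B s'" and I: "I k' s'"
    define p where "p = reg s' r_pos"
    obtain S' ns' where inv': "main_inv B n a S' ns' s'"
      and k': "655 * square_weight n S' + 22 * (n - p) + 4 \<le> k'"
      using I unfolding I_def p_def by blast
    note M = inv'[unfolded main_inv_def, folded p_def]
    have r: "reg s' r_order = n" using M unfolding matrix_in_def by simp
    have nB: "2 * n + 2 \<le> B" and S': "S' \<subseteq> {..<n}" and pS': "p \<in> S' \<or> p = n" using M by simp_all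
    show "cost ?b + 1 \<le> k'" using k' by simp
    {
      assume "val s' ?b \<noteq> 0"
      then have pn: "p < n" using r by (simp add: p_def split: if_splits)
      then have pS: "p \<in> S'" using pS' by simp
      then have fin: "arr s' a_fin p = next_start n S' p" using M by simp
      obtain d where d: "n = p + 1 + d" using pn le_Suc_ex[of "p + 1" n] by auto
      have kd: "655 * square_weight n S' + 22 * d + 26 \<le> k'" using k' unfolding d by simp
      show "run B main_body (k' - (cost ?b + 1)) s' I"
        unfolding main_body_def
      proof (rule run_Cond)
        assume "val s' (Eq (Cell a_fin (Reg r_pos)) (Add (Reg r_pos) (Lit 1))) \<noteq> 0"
        then have nx: "next_start n S' p = p + 1" using fin by (simp add: p_def split: if_splits)
        show "run B leaf (k' - (cost ?b + 1) - (cost (Eq (Cell a_fin (Reg r_pos)) (Add (Reg r_pos) (Lit 1))) + 1)) s' I"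
        proof (rule run_leaf[OF inv' p_def[symmetric] pn nx])
          fix k2 s2
          assume "k' - (cost ?b + 1) - (cost (Eq (Cell a_fin (Reg r_pos)) (Add (Reg r_pos) (Lit 1))) + 1) \<le> k2 + 11"
            "reg s2 r_pos = p + 1" "main_inv B n a S' ns' s2"
          then show "I k2 s2"
            unfolding I_def using kd d by (intro exI[of _ S'] exI[of _ ns']) simp
        qed (use kd in simp)
      next
        assume "val s' (Eq (Cell a_fin (Reg r_pos)) (Add (Reg r_pos) (Lit 1))) = 0"
        then have nx: "next_start n S' p \<noteq> p + 1" using fin by (simp add: p_def split: if_splits)
        show "run B level (k' - (cost ?b + 1) - (cost (Eq (Cell a_fin (Reg r_pos)) (Add (Reg r_pos) (Lit 1))) + 1)) s' I"
        proof (rule run_level[OF inv' p_def[symmetric] pn nx, where z = "22 * (n - p) + 4"])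
          fix k2 s2 S2 ns2
          assume ag: "agree level s' s2" and 2: "main_inv B n a S2 ns2 s2"
            "655 * square_weight n S2 + (22 * (n - p) + 4) \<le> k2"
          have "reg s2 r_pos = p"
            using ag unfolding agree_def level_def refine_loop_written search_loop_written collect_def
              collect_body_def finish_def p_def by simp
          then show "I k2 s2"
            unfolding I_def using 2 by (intro exI[of _ S2] exI[of _ ns2]) simp
        qed (use k' in simp)
      qed (use kd pn nB in \<open>simp_all add: word_def\<close>)
    }
    {
      assume "val s' ?b = 0"
      then have "n \<le> p" using r by (simp add: p_def split: if_splits)
      then have "p = n" using pS' S' by auto
      then show "Q (k' - (cost ?b + 1)) s'"
        by (intro Q[OF B inv']) (simp add: p_def)
    }
  qed simp
qed

text \<open>\<open>a_att\<close> at \<open>0\<close> keeps its initial value \<open>0\<close>, so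
  the cell of all elements hangs below the auxiliary node \<open>0\<close>. The root is preset to 1,
  the right value for a single element, when no level is run.\<close>

definition program :: com where
  "program =
     While (Less (Reg r_pos) (Reg r_order)) (Store a_perm (Reg r_pos) (Reg r_pos) ;; incr r_pos) ;;
     Set r_pos (Lit 0) ;;
     Store a_fin (Lit 0) (Reg r_order) ;;
     Set r_nodes (Reg r_order) ;;
     Set r_root (Lit 1) ;;
     main_loop"

section \<open>The initial state and the total running time\<close>

lemma tree_inv_init:
  assumes n: "1 \<le> n" and f: "f ` {..<n} = {..<n}" and nx: "next_start n {0} 0 = n" and att: "att 0 = 0"
  shows "tree_inv n a {0} f 0 n 1 par att (\<lambda>_. {..n})"
proof (rule tree_invI)
  have c: "cell n {0} f 0 = {..<n}" using f nx by (simp add: lessThan_atLeast0)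
  show "tight (insert 0 {n<..n}) (\<lambda>_. {..n}) (cell n {0} f s) (att s)" if "s \<in> {0}" for s
  proof -
    have "n \<in> {..n}" "n \<notin> {..<n}" by auto
    then have "{..<n} \<subset> {..n}" by auto
    then show ?thesis using that att c unfolding tight_def by simp
  qed
  show "M \<in> (\<lambda>_. {..n}) ` {n<..n} \<or> (\<exists>s\<in>{0}. M \<subseteq> cell n {0} f s)"
    if "strong_matrix_module n a M" for M
    using that c unfolding strong_matrix_module_def matrix_module_def by simp
qed auto

text \<open>The term \<open>33 * n\<close> is 11 units per position for the identity permutation and
  22 for the leaves; 17 = 4 + 9 + 4 covers two last guards and the assignments between the loops.
  The bound \<open>B = 2 * n + 2\<close> has room for fewer than \<open>2 * n\<close> nodes, for the
  parent number of the last one, and for two tasks per cut.\<close>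

lemma run_program:
  assumes n: "1 \<le> n" and good: "good_matrix n a" and B: "B = 2 * n + 2"
    and a: "\<And>i j. i < n \<Longrightarrow> j < n \<Longrightarrow> a i j = A (i + 1) (j + 1)"
    and A: "\<And>i j. i \<in> {1..n} \<Longrightarrow> j \<in> {1..n} \<Longrightarrow> A i j \<le> n"
    and k: "655 * (n * n) + 33 * n + 17 \<le> k"
  obtains t s S ns where "exec (word B) program (input_state n A) t s" "t \<le> k"
    "main_inv B n a S ns s" "reg s r_pos = n"
proof -
  let ?s = "input_state n A"
  have B0: "bounded B ?s"
  proof -
    have "A (i div n + 1) (i mod n + 1) \<le> B" if "i < n * n" for i
    proof -
      have "i div n < n" "i mod n < n" using that n by (simp_all add: less_mult_imp_div_less)
      then have "i div n + 1 \<in> {1..n}" "i mod n + 1 \<in> {1..n}" by (simp_all only: atLeastAtMost_iff) linarith+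
      then have "A (i div n + 1) (i mod n + 1) \<le> n" by (rule A)
      then show ?thesis using B by simp
    qed
    then show ?thesis unfolding bounded_def input_state_def using B by simp
  qed
  have mat: "matrix_in n a ?s"
    unfolding matrix_in_def
  proof (intro conjI allI impI)
    show "reg ?s r_order = n" by (simp add: input_state_def)
    fix i j assume ij: "i < n" "j < n"
    have "i * n + j < n * n"
    proof -
      have "i * n + j < (i + 1) * n" using ij by (simp add: algebra_simps)
      also have "\<dots> \<le> n * n" using ij by (intro mult_right_mono) simp_all
      finally show ?thesis .
    qed
    moreover have "(i * n + j) div n = i" "(i * n + j) mod n = j" using ij by simp_all
    ultimately show "arr ?s a_mat (i * n + j) = a i j"
      using a[OF ij] by (simp add: input_state_def)
  qed
  let ?b = "Less (Reg r_pos) (Reg r_order)"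
  let ?c = "Store a_perm (Reg r_pos) (Reg r_pos) ;; incr r_pos"
  define Q where "Q k' s' \<longleftrightarrow> (\<exists>S ns. main_inv B n a S ns s' \<and> reg s' r_pos = n)" for k' :: nat and s'
  define rest where "rest = Set r_pos (Lit 0) ;; Store a_fin (Lit 0) (Reg r_order) ;;
     Set r_nodes (Reg r_order) ;; Set r_root (Lit 1) ;; main_loop"
  have "run B (While ?b ?c) k ?s (\<lambda>k s. run B rest k s Q)"
  proof (rule run_While[where I = "\<lambda>k' s'. reg s' r_pos \<le> n \<and>
      (\<forall>i<reg s' r_pos. arr s' a_perm i = i) \<and> k \<le> k' + 11 * reg s' r_pos"], goal_cases)
    case 1
    then show ?case by (simp add: input_state_def)
  next
    case (3 k' s')
    then show ?case using k by simp
  next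
    case (4 k' s')
    have r: "reg s' r_order = n" using 4(2) unfolding agree_def by (simp add: input_state_def)
    define p where "p = reg s' r_pos"
    have p: "p < n" using 4(4) r by (simp add: p_def split: if_splits)
    have perm: "\<forall>i<p + 1. ((arr s' a_perm)(p := p)) i = i"
      using 4(3) by (auto simp: p_def less_Suc_eq simp flip: Suc_eq_plus1)
    have "k \<le> k' + 11 * p" using 4(3) p_def by simp
    then have k': "11 \<le> k'" using k p by simp
    show ?case
      by (intro run_intros)
        (use p k' 4(3) perm B in \<open>simp_all add: bounded_reg word_def flip: p_def\<close>)
  next
    case (5 k' s')
    have r: "reg s' r_order = n" "arr s' a_mat = arr ?s a_mat"
      "\<And>x. x \<notin> {r_order, r_pos} \<Longrightarrow> reg s' x = 0" "\<And>x. x \<notin> {a_mat, a_perm} \<Longrightarrow> arr s' x = (\<lambda>_. 0)"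
      using 5(2) unfolding agree_def by (simp_all add: input_state_def)
    have p: "reg s' r_pos = n" using 5(3,4) r by (simp split: if_splits)
    have perm: "arr s' a_perm i = i" if "i < n" for i using 5(3) p that by simp
    have k': "655 * (n * n) + 22 * n + 13 \<le> k' - 4" using 5(3) p k by simp linarith
    let ?s1 = "s'\<lparr>arr := (arr s')(a_fin := (arr s' a_fin)(0 := n)),
        reg := (reg s')(r_pos := 0, r_nodes := n, r_root := 1)\<rparr>"
    have nx: "next_start n {0} 0 = n" using n by (intro next_start_eqI) auto
    have bij: "bij_betw (arr ?s1 a_perm) {..<n} {..<n}"
      using perm by (subst bij_betw_cong[where g = id]) auto
    then have im: "arr ?s1 a_perm ` {..<n} = {..<n}" unfolding bij_betw_def by blast
    have "main_inv B n a {0} (\<lambda>_. {..n}) ?s1"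
      unfolding main_inv_def
    proof (intro conjI ballI impI)
      show "tree_inv n a {0} (arr ?s1 a_perm) (reg ?s1 r_pos) (reg ?s1 r_nodes) (reg ?s1 r_root)
        (arr ?s1 a_par) (arr ?s1 a_att) (\<lambda>_. {..n})"
        using tree_inv_init[OF n im nx, of "arr ?s1 a_att"] r by simp
      show "matrix_in n a ?s1" using mat r unfolding matrix_in_def by simp
      show "bij_betw (arr ?s1 a_perm) {..<n} {..<n}" by (rule bij)
      show "matrix_module n a (cell n {0} (arr ?s1 a_perm) t)" if "t \<in> {0}" for t
        using that im nx unfolding matrix_module_def by (simp add: lessThan_atLeast0)
    qed (use B good n nx r in auto)
    then have "run B main_loop (k' - 4 - 9) ?s1 Q"
    proof (rule run_main_loop)
      show "655 * square_weight n {0} + 22 * (n - reg ?s1 r_pos) + 4 \<le> k' - 4 - 9"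
        using k' nx by (simp add: square_weight_def power2_eq_square)
    qed (auto simp: Q_def)
    then show ?case
      unfolding rest_def
      by (intro run_intros) (use k' r B in \<open>simp_all add: word_def fun_upd_twist\<close>)
  qed simp
  then have "run B program k ?s Q"
    unfolding program_def by (fold rest_def, intro run_Seq)
  then show ?thesis
    using that B0 unfolding run_def Q_def by blast
qed


section \<open>Transfer to homogeneous relations\<close>

text \<open>\<open>a\<close> and \<open>y\<close> shift the indices to start at 0, the form in which
  the program addresses matrix and permutation.\<close>

context
  fixes X :: "'a set" and H and n :: nat and x y :: "nat \<Rightarrow> 'a" and A a
  assumes hom: "homogeneous_relation X H" and rep: "matrix_representation X H n x A"
    and a: "\<And>i j. a i j = A (i + 1) (j + 1)" and y: "\<And>i. y i = x (i + 1)"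
begin

lemma bij_y: "bij_betw y {..<n} X"
proof -
  have "bij_betw x {1..n} X" using rep unfolding matrix_representation_def by blast
  moreover have "bij_betw (\<lambda>i. i + 1) {..<n} {1..n}"
    by (rule bij_betw_byWitness[where f' = "\<lambda>i. i - 1"]) auto
  moreover have "y = x \<circ> (\<lambda>i. i + 1)" by (simp add: fun_eq_iff y)
  ultimately show ?thesis using bij_betw_trans[of _ "{..<n}" "{1..n}" x X] by simp
qed

lemma y_inj: "i < n \<Longrightarrow> j < n \<Longrightarrow> y i = y j \<longleftrightarrow> i = j"
  using bij_y unfolding bij_betw_def inj_on_def by auto

text \<open>The entries are the numbers of the classes of \<open>y j\<close> and \<open>y k\<close>
  at \<open>y i\<close>, and distinct classes have distinct numbers. The conditions
  \<open>i \<noteq> j\<close> and \<open>i \<noteq> k\<close> exclude the arbitrary diagonal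
  entries.\<close>

lemma relation_iff_entries:
  assumes "i < n" "j < n" "k < n" "i \<noteq> j" "i \<noteq> k"
  shows "(y i, y j, y k) \<in> H \<longleftrightarrow> a i j = a i k"
proof -
  let ?R = "rel_at H (y i)" and ?X = "X - {y i}"
  have yX: "y i \<in> X" "y j \<in> ?X" "y k \<in> ?X"
    using assms y_inj bij_betwE[OF bij_y] by auto
  have eq: "equiv ?X ?R" using hom yX(1) unfolding homogeneous_relation_def by blast
  have i1: "i + 1 \<in> {1..n}" using assms(1) by simp
  obtain num where inj: "inj_on num (?X // ?R)"
    and num: "\<forall>j\<in>{1..n} - {i + 1}. \<forall>k. A (i + 1) j = k \<longleftrightarrow> (\<exists>C\<in>?X // ?R. num C = k \<and> x j \<in> C)"
    using rep i1 unfolding matrix_representation_def y by blast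
  have entry: "a i l = num (?R `` {y l})" if l: "l < n" "l \<noteq> i" for l
  proof -
    have "y l \<in> ?X" using l assms(1) y_inj bij_betwE[OF bij_y] by auto
    then have "?R `` {y l} \<in> ?X // ?R" "y l \<in> ?R `` {y l}"
      using equiv_class_self[OF eq] by (simp_all add: quotientI)
    moreover have "l + 1 \<in> {1..n} - {i + 1}" using l by auto
    ultimately show ?thesis using num a y by metis
  qed
  have "a i j = a i k \<longleftrightarrow> num (?R `` {y j}) = num (?R `` {y k})"
    using entry[of j] entry[of k] assms by auto
  also have "\<dots> \<longleftrightarrow> ?R `` {y j} = ?R `` {y k}"
    using inj yX by (auto simp: inj_on_eq_iff quotientI)
  also have "\<dots> \<longleftrightarrow> (y j, y k) \<in> ?R"
    using eq yX by (simp add: eq_equiv_class_iff)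
  finally show ?thesis unfolding rel_at_def by simp
qed

section \<open>Modules and strong modules as sets of indices\<close>

lemma y_image: "M \<subseteq> X \<Longrightarrow> y ` {i \<in> {..<n}. y i \<in> M} = M"
  using bij_y unfolding bij_betw_def by blast

lemma y_mem: "M \<subseteq> {..<n} \<Longrightarrow> i < n \<Longrightarrow> y i \<in> y ` M \<longleftrightarrow> i \<in> M"
  using y_inj by blast

text \<open>A module is tested only by points outside of it, so diagonal entries never
  enter.\<close>

lemma module_iff:
  assumes M: "M \<subseteq> {..<n}"
  shows "homogeneous_module X H (y ` M) \<longleftrightarrow> matrix_module n a M"
proof
  assume h: "homogeneous_module X H (y ` M)"
  show "matrix_module n a M"
    unfolding matrix_module_def uniform_def
  proof (intro conjI ballI M)
    fix i j k assume i: "i \<in> {..<n} - M" and jk: "j \<in> M" "k \<in> M"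
    have "y i \<in> X - y ` M" using i bij_betwE[OF bij_y] y_mem[OF M] by auto
    then have "(y i, y j, y k) \<in> H" using h jk unfolding homogeneous_module_def by blast
    then show "a i j = a i k" using relation_iff_entries[of i j k] i jk M by auto
  qed
next
  assume m: "matrix_module n a M"
  show "homogeneous_module X H (y ` M)"
    unfolding homogeneous_module_def
  proof (intro conjI ballI)
    show "y ` M \<subseteq> X" using M bij_betwE[OF bij_y] by blast
    fix z u w assume z: "z \<in> X - y ` M" and uw: "u \<in> y ` M" "w \<in> y ` M"
    obtain i where i: "i < n" "z = y i" using z bij_y unfolding bij_betw_def by blast
    obtain j k where jk: "j \<in> M" "k \<in> M" "u = y j" "w = y k" using uw by blast
    have "i \<notin> M" using z i by blast
    then show "(z, u, w) \<in> H"
      using matrix_moduleD[OF m i(1) _ jk(1,2)] relation_iff_entries[of i j k] i jk M by auto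
  qed
qed

lemma good_iff:
  assumes "good X H"
  shows "good_matrix n a"
  unfolding good_matrix_def
proof (intro allI impI ballI)
  fix M i j k l
  assume m: "matrix_module n a M" and ij: "i \<in> M" "j \<in> M" and kl: "k \<in> {..<n} - M" "l \<in> {..<n} - M"
  have M: "M \<subseteq> {..<n}" using m unfolding matrix_module_def by blast
  have "homogeneous_module X H (y ` M)" using module_iff[OF M] m by simp
  moreover have "y k \<in> X - y ` M" "y l \<in> X - y ` M"
    using kl bij_betwE[OF bij_y] y_mem[OF M] by auto
  ultimately have "(y i, y k, y l) \<in> H \<longleftrightarrow> (y j, y k, y l) \<in> H"
    using assms ij unfolding good_def by blast
  moreover have "(y i, y k, y l) \<in> H \<longleftrightarrow> a i k = a i l" "(y j, y k, y l) \<in> H \<longleftrightarrow> a j k = a j l"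
    using ij kl M by (intro relation_iff_entries; blast)+
  ultimately show "a i k = a i l \<longleftrightarrow> a j k = a j l" by simp
qed

lemma strong_iff:
  assumes "strong_module X H M"
  shows "strong_matrix_module n a {i \<in> {..<n}. y i \<in> M}"
proof -
  let ?M = "{i \<in> {..<n}. y i \<in> M}"
  have hM: "homogeneous_module X H M" and nov: "\<And>N. homogeneous_module X H N \<Longrightarrow> \<not> overlap M N"
    using assms unfolding strong_module_def by blast+
  have "M \<subseteq> X" using hM unfolding homogeneous_module_def by blast
  then have yM: "y ` ?M = M" by (rule y_image)
  have sub: "?M \<subseteq> {..<n}" by blast
  have "matrix_module n a ?M" using module_iff[OF sub] yM hM by simp
  moreover have "\<not> overlap ?M N" if N: "matrix_module n a N" for N
  proof
    assume ov: "overlap ?M N"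
    have Nn: "N \<subseteq> {..<n}" using N unfolding matrix_module_def by blast
    have "\<not> overlap M (y ` N)" using nov module_iff[OF Nn] N by blast
    moreover have "overlap M (y ` N)"
    proof -
      obtain i j k where "i \<in> ?M \<inter> N" "j \<in> ?M - N" "k \<in> N - ?M"
        using ov unfolding overlap_def by blast
      then have "y i \<in> M \<inter> y ` N" "y j \<in> M - y ` N" "y k \<in> y ` N - M"
        using y_mem[OF Nn, of j] Nn by auto
      then show ?thesis unfolding overlap_def by blast
    qed
    ultimately show False by blast
  qed
  ultimately show ?thesis unfolding strong_matrix_module_def by blast
qed

text \<open>With \<open>r_pos = n\<close> every cell is a single position, so all leaves are
  attached, and the leaves together with the inner nodes form an instance of
  \<open>set_tree\<close>.\<close>

lemma outputs_tree_of_main_inv: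
  assumes inv: "main_inv B n a S ns s" and p: "reg s r_pos = n" and n: "1 \<le> n"
  shows "outputs_tree X H n x s"
proof -
  note I = inv[unfolded main_inv_def p]
  define f N rt par where "f = arr s a_perm" and "N = reg s r_nodes" and "rt = reg s r_root"
    and "par = arr s a_par"
  have bij: "bij_betw f {..<n} {..<n}" and Sn: "S \<subseteq> {..<n}" and S0: "0 \<in> S"
    and nx: "\<And>t. t \<in> S \<Longrightarrow> next_start n S t = t + 1"
    and tree: "tree_inv n a S f n N rt par (arr s a_att) ns"
    using I unfolding f_def N_def rt_def par_def by auto
  note D = tree_invD[OF tree]
  have "i < n \<Longrightarrow> i \<in> S" for i
  proof (induction i)
    case (Suc i)
    then have "i + 1 \<in> S \<or> i + 1 = n" using next_start(2)[of i n S] nx[of i] by simp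
    then show ?case using Suc.prems unfolding Suc_eq_plus1 by simp
  qed (use S0 in simp)
  then have S: "S = {..<n}" using Sn by blast
  have cell: "cell n S f i = {f i}" if "i < n" for i
  proof -
    have "interval n S i = {i}" using nx[of i] that S by auto
    then show ?thesis by simp
  qed
  have fsurj: "\<exists>i<n. f i = j" if "j < n" for j
  proof -
    have "j \<in> f ` {..<n}" using bij that unfolding bij_betw_def by simp
    then show ?thesis by blast
  qed
  define Y where "Y v = (if v \<le> n then {v - 1} else ns v)" for v
  let ?V = "{1..N}" and ?W = "insert 0 {n<..N}"
  have nN: "n \<le> N" by (rule D(1))
  have nsn: "ns v \<subseteq> {..<n}" if "v \<in> {n<..N}" for v
    using D(2)[OF that] unfolding matrix_module_def by blast
  \<comment> \<open>Without inner nodes the only cell is that of all elements, and it is a single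
    position.\<close>
  have n1: "n = 1" if "N = n"
  proof -
    have "{..<n} = {0}" using D(11) that S by simp
    then have "card {..<n} = 1" by simp
    then show ?thesis by simp
  qed
  have root: "rt \<in> ?V" "Y rt = {..<n}"
  proof -
    show "rt \<in> ?V"
    proof (cases "N = n")
      case True
      then have "rt = 1" using D(11) by simp
      have "1 \<le> N" using n nN by linarith
      then show ?thesis unfolding atLeastAtMost_iff \<open>rt = 1\<close> by (intro conjI order_refl)
    next
      case False
      then have "rt \<in> {n<..N}" using D(11) by simp
      then show ?thesis by simp
    qed
    show "Y rt = {..<n}"
    proof (cases "N = n")
      case True
      then show ?thesis using D(11) n1 unfolding Y_def by auto
    next
      case False
      then have "rt \<in> {n<..N}" "ns rt = {..<n}" using D(11) by simp_all
      then show ?thesis unfolding Y_def by simp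
    qed
  qed
  have ne: "Y v \<noteq> {}" and sub: "Y v \<subseteq> {..<n}" if "v \<in> ?V" for v
    using that D(3)[of v] nsn[of v] unfolding Y_def by auto
  \<comment> \<open>A cell that meets an inner node is a proper subset of it; so an inner node
    cannot coincide with a leaf.\<close>
  have notsing: "ns v \<noteq> {j}" if v: "v \<in> {n<..N}" for v j
  proof
    assume e: "ns v = {j}"
    then have "j < n" using nsn[OF v] by simp
    then obtain i where "i < n" "f i = j" using fsurj by blast
    then show False using D(6)[OF v, of i] cell[of i] e S by auto
  qed
  have inj: "inj_on Y ?V"
  proof (rule inj_onI)
    fix u v assume uv: "u \<in> ?V" "v \<in> ?V" "Y u = Y v"
    show "u = v"
    proof (cases "u \<le> n"; cases "v \<le> n")
      assume "u \<le> n" "v \<le> n"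
      then have "u - 1 = v - 1" using uv unfolding Y_def by simp
      moreover have "1 \<le> u" "1 \<le> v" using uv by simp_all
      ultimately show "u = v" by linarith
    next
      assume "u \<le> n" "\<not> v \<le> n"
      then show "u = v" using uv notsing[of v "u - 1"] unfolding Y_def by simp
    next
      assume "\<not> u \<le> n" "v \<le> n"
      then show "u = v" using uv notsing[of u "v - 1"] unfolding Y_def by simp
    next
      assume "\<not> u \<le> n" "\<not> v \<le> n"
      then show "u = v" using uv D(4) unfolding Y_def inj_on_def by simp
    qed
  qed
  have par: "tight ?V Y (Y u) (par u)" if u: "u \<in> ?V - {rt}" for u
  proof -
    have uV: "u \<in> ?V" using u by blast
    have Nn: "N \<noteq> n"
    proof
      assume "N = n"
      then have "N = 1" "rt = 1" using n1 D(11) by simp_all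
      then show False using u by auto
    qed
    then have rt: "rt \<in> {n<..N}" "ns rt = {..<n}" using D(11) by simp_all
    have t: "tight ?W ns (Y u) (par u)"
    proof (cases "u \<le> n")
      case True
      then have "u - 1 < n" using u n by auto
      then obtain i where i: "i < n" "f i = u - 1" using fsurj by blast
      then show ?thesis using D(9)[OF i(1)] True uV unfolding Y_def by simp
    next
      case False
      then show ?thesis using D(7)[of u] u unfolding Y_def by simp
    qed
    \<comment> \<open>A node other than the root lies properly inside of it, so its least superset
      lies within the root and cannot be node \<open>0\<close>, whose set contains
      \<open>n\<close>.\<close>
    have "Y u \<noteq> {..<n}" using inj_onD[OF inj _ uV root(1)] u root(2) by auto
    then have "Y u \<subset> ns rt" using sub[OF uV] rt by blast
    then have sr: "ns (par u) \<subseteq> ns rt" using t rt(1) unfolding tight_def by blast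
    have "par u \<noteq> 0"
    proof
      assume "par u = 0"
      then have "n \<in> {..<n}" using sr D(5) rt(2) by auto
      then show False by simp
    qed
    moreover have "par u \<in> ?W" using t unfolding tight_def by (rule conjunct1)
    ultimately have pu: "par u \<in> {n<..N}" by simp
    then have Yp: "Y (par u) = ns (par u)" unfolding Y_def by simp
    show ?thesis
      unfolding tight_def Yp
    proof (intro conjI ballI impI)
      show "par u \<in> ?V" using pu by simp
      show "Y u \<subset> ns (par u)" using t unfolding tight_def by blast
      fix w assume w: "w \<in> ?V" "Y u \<subset> Y w"
      have "\<not> w \<le> n"
      proof
        assume "w \<le> n"
        then have "Y w = {w - 1}" unfolding Y_def by simp
        then have "Y u = {}" using w(2) by auto
        then show False using ne[OF uV] by simp
      qed
      then have "w \<in> {n<..N}" "Y w = ns w" using w(1) unfolding Y_def by simp_all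
      then show "ns (par u) \<subseteq> Y w" using t w(2) unfolding tight_def by simp
    qed
  qed
  have leafY: "Y i = {i - 1}" if "i \<in> {1..n}" for i using that unfolding Y_def by simp
  interpret set_tree ?V Y N n rt par
    by unfold_locales (fact refl nN root leafY ne sub inj par)+
  have below: "x ` leaves_below ?V rt par v = y ` Y v" if v: "v \<in> ?V" for v
  proof -
    have "x ` leaves_below ?V rt par v = x ` {i \<in> {1..n}. i - 1 \<in> Y v}" using leaves_below_of_sets[OF v] by simp
    also have "{i \<in> {1..n}. i - 1 \<in> Y v} = (\<lambda>i. i + 1) ` Y v"
    proof
      show "{i \<in> {1..n}. i - 1 \<in> Y v} \<subseteq> (\<lambda>i. i + 1) ` Y v"
      proof
        fix i assume "i \<in> {i \<in> {1..n}. i - 1 \<in> Y v}"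
        then have "i - 1 \<in> Y v" "i = (i - 1) + 1" by auto
        then show "i \<in> (\<lambda>i. i + 1) ` Y v" by blast
      qed
      show "(\<lambda>i. i + 1) ` Y v \<subseteq> {i \<in> {1..n}. i - 1 \<in> Y v}" using sub[OF v] by auto
    qed
    finally show ?thesis by (simp add: image_image y)
  qed
  have "super_modular_decomposition_tree X H ?V rt par x"
    unfolding super_modular_decomposition_tree_def
  proof (intro conjI ballI allI impI)
    show "rooted_tree ?V rt par" by (rule rooted_tree_of_sets)
    show "bij_betw x (leaves ?V rt par) X"
      using rep leaves_of_sets unfolding matrix_representation_def by simp
    show "inj_on (\<lambda>v. x ` leaves_below ?V rt par v) ?V"
    proof (rule inj_onI)
      fix u v assume uv: "u \<in> ?V" "v \<in> ?V" "x ` leaves_below ?V rt par u = x ` leaves_below ?V rt par v"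
      then have "y ` Y u = y ` Y v" using below by simp
      then have "Y u = Y v"
        using inj_on_image_eq_iff[OF bij_betw_imp_inj_on[OF bij_y]] sub uv by blast
      then show "u = v" using inj uv unfolding inj_on_def by blast
    qed
    show "homogeneous_module X H (x ` leaves_below ?V rt par v)" if v: "v \<in> ?V" for v
    proof -
      have "matrix_module n a (Y v)"
      proof (cases "v \<le> n")
        case True
        then have Yv: "Y v = {v - 1}" unfolding Y_def by simp
        show ?thesis using sub[OF v] unfolding matrix_module_def uniform_def Yv by simp
      next
        case False
        then show ?thesis using D(2)[of v] v unfolding Y_def by simp
      qed
      then show ?thesis using below[OF v] module_iff[OF sub[OF v]] by simp
    qed
    show "\<exists>v\<in>?V. M = x ` leaves_below ?V rt par v" if M: "strong_module X H M \<and> M \<noteq> {}" for M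
    proof -
      let ?M = "{i \<in> {..<n}. y i \<in> M}"
      have "M \<subseteq> X" using M unfolding strong_module_def homogeneous_module_def by blast
      then have yM: "y ` ?M = M" by (rule y_image)
      then have "?M \<noteq> {}" using M by auto
      then consider v where "v \<in> {n<..N}" "?M = ns v" | i where "i \<in> S" "?M \<subseteq> cell n S f i"
        using D(10)[OF strong_iff] M by blast
      then obtain v where v: "v \<in> ?V" "?M = Y v"
      proof cases
        case 1
        then show ?thesis using that[of v] unfolding Y_def by simp
      next
        case 2
        then have i: "i < n" "?M \<subseteq> {f i}" using S cell by auto
        then have "?M = {f i}" using \<open>?M \<noteq> {}\<close> by blast
        moreover have "f i < n" using bij_betw_lessThan[OF bij i(1)] .
        ultimately show ?thesis using that[of "f i + 1"] nN unfolding Y_def by simp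
      qed
      then show ?thesis using below[OF v(1)] yM by (intro bexI[of _ v]) auto
    qed
  qed
  then show ?thesis
    unfolding outputs_tree_def using leaves_of_sets by (simp add: N_def rt_def par_def)
qed

end

theorem theorem10:
  "\<exists>(p :: com) (T :: nat \<Rightarrow> nat) (W :: nat \<Rightarrow> nat) (k :: nat).
     (\<lambda>n. real (T n)) \<in> O(\<lambda>n. real n ^ 2) \<and>
     (\<lambda>n. real (W n)) \<in> O(\<lambda>n. real n ^ k) \<and>
     (\<forall>(X :: 'a set) H x A.
        finite X \<longrightarrow> X \<noteq> {} \<longrightarrow> homogeneous_relation X H \<longrightarrow> good X H \<longrightarrow>
        matrix_representation X H (card X) x A \<longrightarrow>
        (\<exists>t s. exec (W (card X)) p (input_state (card X) A) t s \<and> t \<le> T (card X) \<and>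
               outputs_tree X H (card X) x s))"
proof -
  define T where "T n = 655 * (n * n) + 33 * n + 17" for n :: nat
  define W where "W n = word (2 * n + 2)" for n :: nat
  have "(\<lambda>n. real (T n)) \<in> O(\<lambda>n. real n ^ 2)"
  proof (rule bigoI)
    \<comment> \<open>705 = 655 + 33 + 17, as \<open>n\<close> and 1 are at most
      \<open>n * n\<close>; likewise 26 = 4 + 12 + 10 for the word bound.\<close>
    show "\<forall>\<^sub>F n in at_top. norm (real (T n)) \<le> 705 * norm (real n ^ 2)"
      using eventually_ge_at_top[of 1]
    proof eventually_elim
      case (elim n)
      then have "n * 1 \<le> n * n" "1 * 1 \<le> n * n" by (intro mult_le_mono; simp)+
      then have "T n \<le> 705 * (n * n)" unfolding T_def by linarith
      then have "real (T n) \<le> real (705 * (n * n))" by (rule of_nat_mono)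
      then show ?case by (simp add: power2_eq_square)
    qed
  qed
  moreover have "(\<lambda>n. real (W n)) \<in> O(\<lambda>n. real n ^ 2)"
  proof (rule bigoI)
    show "\<forall>\<^sub>F n in at_top. norm (real (W n)) \<le> 26 * norm (real n ^ 2)"
      using eventually_ge_at_top[of 1]
    proof eventually_elim
      case (elim n)
      then have "n * 1 \<le> n * n" "1 * 1 \<le> n * n" by (intro mult_le_mono; simp)+
      moreover have "W n = 4 * (n * n) + 12 * n + 10" unfolding W_def word_def by (simp add: algebra_simps)
      ultimately have "W n \<le> 26 * (n * n)" by linarith
      then have "real (W n) \<le> real (26 * (n * n))" by (rule of_nat_mono)
      then show ?case by (simp add: power2_eq_square)
    qed
  qed
  moreover have "\<exists>t s. exec (W (card X)) program (input_state (card X) A) t s \<and> t \<le> T (card X) \<and>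
      outputs_tree X H (card X) x s"
    if X: "finite X" "X \<noteq> {}" and hom: "homogeneous_relation X H" and good: "good X H"
      and rep: "matrix_representation X H (card X) x A" for X :: "'a set" and H x A
  proof -
    define a where "a i j = A (i + 1) (j + 1)" for i j
    define y where "y i = x (i + 1)" for i
    have n: "1 \<le> card X" using X by (simp add: Suc_leI card_gt_0_iff One_nat_def)
    have A: "A i j \<le> card X" if "i \<in> {1..card X}" "j \<in> {1..card X}" for i j
    proof -
      have "\<forall>i\<in>{1..card X}. \<forall>j\<in>{1..card X}. A i j \<in> {1..card X}"
        using rep unfolding matrix_representation_def by (elim conjE)
      then show ?thesis using that by simp
    qed
    obtain t s S ns where "exec (word (2 * card X + 2)) program (input_state (card X) A) t s"
      "t \<le> T (card X)" and main: "main_inv (2 * card X + 2) (card X) a S ns s" "reg s r_pos = card X"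
      by (rule run_program[OF n good_iff[OF hom rep a_def y_def good] refl a_def A, of "T (card X)"])
        (simp_all add: T_def)
    moreover have "outputs_tree X H (card X) x s"
      by (rule outputs_tree_of_main_inv[OF hom rep a_def y_def main n])
    ultimately show ?thesis unfolding W_def by blast
  qed
  ultimately show ?thesis
    by - (rule exI[of _ program], rule exI[of _ T], rule exI[of _ W], rule exI[of _ 2],
        intro conjI allI impI)
qed

end
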